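(* Let $T>0$ and let $\alpha:[0,T]\to[c,d]\subset(1,2)$ and $b:[0,T]\to(0,\infty)$ be continuously differentiable. Let $(\Gamma_i)_{i\ge1}$ be the sequence of arrival times of a Poisson process with unit rate, let $(V_i)_{i\ge1}$ be a sequence of i.i.d. random variables uniformly distributed on $[0,T]$, and let $(\gamma_i)_{i\ge1}$ be a sequence of i.i.d. random variables with $P(\gamma_i=1)=P(\gamma_i=-1)=1/2$. Assume that the three sequences $(\Gamma_i)_{i\ge1}$, $(V_i)_{i\ge1}$, $(\gamma_i)_{i\ge1}$ are independent, and define $$Y(t)=b(t)\,C_{\alpha(t)}^{1/\alpha(t)}\,T^{1/\alpha(t)}\sum_{i=1}^{\infty}\gamma_i\,\Gamma_i^{-1/\alpha(t)}\,\mathbf{1}_{[0,t]}(V_i)\qquad(t\in[0,T]).$$ Then $Y$ is $1/\alpha(u)$-localisable at every $u\in(0,T)$, with local form $Y'_u=b(u)L_{\alpha(u)}$.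
   Context: $C_\alpha=\left(\int_0^\infty x^{-\alpha}\sin(x)\,dx\right)^{-1}$. $L_\alpha$ denotes symmetric $\alpha$-stable Lévy motion, $L_\alpha(t)=\int_0^tM(dz)$, $t\in\mathbb{R}$ (with $\int_0^t=-\int_t^0$ for $t<0$), where $M$ is a symmetric $\alpha$-stable random measure on $\mathbb{R}$ with Lebesgue control measure; i.e. for $f\in L^\alpha(\mathbb{R})$, $\int f\,dM$ is symmetric $\alpha$-stable with characteristic function $\theta\mapsto\exp(-|\theta|^\alpha\int|f(x)|^\alpha dx)$, and $f\mapsto\int f\,dM$ is linear. Localisability: a process $Y$ indexed by an interval is $h$-localisable at a point $u$ in its interior if there is a non-trivial process $Y'_u=\{Y'_u(t):t\in\mathbb{R}\}$, called the local form of $Y$ at $u$, such that $r^{-h}(Y(u+rt)-Y(u))\to Y'_u(t)$ as $r\to0^+$ in the sense of convergence of finite-dimensional distributions (as processes in $t$). Local forms are identified up to equality of finite-dimensional distributions. *)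

theory Defs
  imports "HOL-Probability.Probability"
begin

text \<open>At the end points of an interval the derivative is one-sided, whence \<^term>\<open>at x within S\<close>.\<close>

definition continuously_differentiable_on :: "(real \<Rightarrow> real) \<Rightarrow> real set \<Rightarrow> bool" where
  "continuously_differentiable_on f S \<longleftrightarrow>
     (\<exists>f'. (\<forall>x\<in>S. (f has_real_derivative f' x) (at x within S)) \<and> continuous_on S f')"

definition stochastic_process :: "'w measure \<Rightarrow> real set \<Rightarrow> (real \<Rightarrow> 'w \<Rightarrow> real) \<Rightarrow> bool" where
  "stochastic_process M I Y \<longleftrightarrow> prob_space M \<and> (\<forall>t\<in>I. Y t \<in> borel_measurable M)"

text \<open>The subtraction in the increments is truncated, which is harmless because almost all paths
  are nondecreasing.\<close>

definition poisson_process :: "'w measure \<Rightarrow> real \<Rightarrow> (real \<Rightarrow> 'w \<Rightarrow> nat) \<Rightarrow> bool" where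
  "poisson_process M rate N \<longleftrightarrow>
     prob_space M \<and>
     (\<forall>t\<ge>0. N t \<in> measurable M (count_space UNIV)) \<and>
     (AE \<omega> in M. N 0 \<omega> = 0 \<and> mono_on {0..} (\<lambda>t. N t \<omega>) \<and>
        (\<forall>t\<ge>0. ((\<lambda>s. N s \<omega>) \<longlongrightarrow> N t \<omega>) (at_right t))) \<and>
     (\<forall>s t. 0 \<le> s \<longrightarrow> s < t \<longrightarrow>
        distr M (count_space UNIV) (\<lambda>\<omega>. N t \<omega> - N s \<omega>) = measure_pmf (poisson_pmf (rate * (t - s)))) \<and>
     (\<forall>\<tau> n. 0 \<le> \<tau> 0 \<longrightarrow> mono \<tau> \<longrightarrow>
        prob_space.indep_vars M (\<lambda>_. count_space UNIV)
          (\<lambda>k \<omega>. N (\<tau> (Suc k)) \<omega> - N (\<tau> k) \<omega>) {..<n::nat})"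

text \<open>The sequence is indexed from \<open>0\<close>: \<open>\<Gamma> i\<close> is the time of arrival number \<open>i + 1\<close>.\<close>

definition arrival_times ::
    "'w measure \<Rightarrow> (real \<Rightarrow> 'w \<Rightarrow> nat) \<Rightarrow> (nat \<Rightarrow> 'w \<Rightarrow> real) \<Rightarrow> bool" where
  "arrival_times M N \<Gamma> \<longleftrightarrow>
     (\<forall>i. \<Gamma> i \<in> borel_measurable M \<and> (AE \<omega> in M. \<Gamma> i \<omega> = Inf {t. 0 \<le> t \<and> Suc i \<le> N t \<omega>}))"

definition converges_in_distribution ::
    "'b::topological_space set \<Rightarrow> 'p filter \<Rightarrow> 'w measure \<Rightarrow> ('p \<Rightarrow> 'w \<Rightarrow> 'b)
      \<Rightarrow> 'v measure \<Rightarrow> ('v \<Rightarrow> 'b) \<Rightarrow> bool" where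
  "converges_in_distribution S F M X N Z \<longleftrightarrow>
     (\<forall>f::'b \<Rightarrow> real. continuous_on S f \<longrightarrow> bounded (f ` S) \<longrightarrow>
        ((\<lambda>r. LINT \<omega>|M. f (X r \<omega>)) \<longlongrightarrow> (LINT \<omega>|N. f (Z \<omega>))) F)"

text \<open>Euclidean \<open>n\<close>-space is represented by \<^term>\<open>{..<n::nat} \<rightarrow>\<^sub>E (UNIV :: real set)\<close>, as for finite
  products of measures; as a subspace of \<^typ>\<open>nat \<Rightarrow> real\<close> with the product topology, in which the
  coordinates from \<open>n\<close> on are constant, it carries the usual topology.\<close>

definition fdd_converges ::
    "'p filter \<Rightarrow> 'w measure \<Rightarrow> ('p \<Rightarrow> real \<Rightarrow> 'w \<Rightarrow> real)
      \<Rightarrow> 'v measure \<Rightarrow> (real \<Rightarrow> 'v \<Rightarrow> real) \<Rightarrow> bool" where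
  "fdd_converges F M X N Z \<longleftrightarrow>
     (\<forall>(n::nat) (\<tau>::nat \<Rightarrow> real).
        converges_in_distribution ({..<n} \<rightarrow>\<^sub>E (UNIV :: real set)) F
          M (\<lambda>r \<omega>. \<lambda>k\<in>{..<n}. X r (\<tau> k) \<omega>)
          N (\<lambda>\<omega>. \<lambda>k\<in>{..<n}. Z (\<tau> k) \<omega>))"

definition has_local_form ::
    "'w measure \<Rightarrow> real set \<Rightarrow> (real \<Rightarrow> 'w \<Rightarrow> real) \<Rightarrow> real \<Rightarrow> real
      \<Rightarrow> 'v measure \<Rightarrow> (real \<Rightarrow> 'v \<Rightarrow> real) \<Rightarrow> bool" where
  "has_local_form M I Y h u N Z \<longleftrightarrow>
     is_interval I \<and> u \<in> interior I \<and>
     stochastic_process M I Y \<and> stochastic_process N UNIV Z \<and>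
     (\<exists>t. \<not> (AE \<omega> in N. Z t \<omega> = 0)) \<and>
     fdd_converges (at_right 0) M (\<lambda>r t \<omega>. r powr (- h) * (Y (u + r * t) \<omega> - Y u \<omega>)) N Z"

text \<open>It is no restriction to look for the local form on the path space: every real-valued process
  indexed by the real line has the same finite-dimensional distributions as the coordinate process
  under its law.\<close>

definition localisable ::
    "'w measure \<Rightarrow> real set \<Rightarrow> (real \<Rightarrow> 'w \<Rightarrow> real) \<Rightarrow> real \<Rightarrow> real \<Rightarrow> bool" where
  "localisable M I Y h u \<longleftrightarrow>
     (\<exists>(N :: (real \<Rightarrow> real) measure) Z. has_local_form M I Y h u N Z)"

definition L_space :: "real \<Rightarrow> (real \<Rightarrow> real) set" where
  "L_space a = {f \<in> borel_measurable borel. integrable lborel (\<lambda>x. \<bar>f x\<bar> powr a)}"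

text \<open>\<open>\<Phi> f\<close> is the integral of \<open>f\<close> with respect to a symmetric \<open>a\<close>-stable random measure on the real
  line with Lebesgue control measure; the measure itself is \<open>\<lambda>A. \<Phi> (indicator A)\<close>. The integral is
  only determined up to null sets, so linearity is required almost surely.\<close>

definition stable_integral ::
    "real \<Rightarrow> 'v measure \<Rightarrow> ((real \<Rightarrow> real) \<Rightarrow> 'v \<Rightarrow> real) \<Rightarrow> bool" where
  "stable_integral a N \<Phi> \<longleftrightarrow>
     prob_space N \<and>
     (\<forall>f\<in>L_space a. \<Phi> f \<in> borel_measurable N \<and>
        (\<forall>\<theta>. char (distr N borel (\<Phi> f)) \<theta> =
           complex_of_real (exp (- (\<bar>\<theta>\<bar> powr a * (LINT x|lborel. \<bar>f x\<bar> powr a)))))) \<and>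
     (\<forall>f\<in>L_space a. \<forall>g\<in>L_space a. \<forall>p q.
        AE \<omega> in N. \<Phi> (\<lambda>x. p * f x + q * g x) \<omega> = p * \<Phi> f \<omega> + q * \<Phi> g \<omega>)"

definition levy_motion :: "((real \<Rightarrow> real) \<Rightarrow> 'v \<Rightarrow> real) \<Rightarrow> real \<Rightarrow> 'v \<Rightarrow> real" where
  "levy_motion \<Phi> t \<omega> =
     (if 0 \<le> t then \<Phi> (indicator {0..t}) \<omega> else - \<Phi> (indicator {t..0}) \<omega>)"

definition stable_const :: "real \<Rightarrow> real" where
  "stable_const a = inverse (LBINT x:{0<..}. x powr (- a) * sin x)"

end

theory Submission
  imports Defs
begin

text \<open>Write \<open>h = 1 / \<alpha> u\<close> and let \<open>B t\<close> be the factor in front of the series. In the increment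
  \<open>Y (u + r t) - Y u\<close> two things change: the index and the factor move from their values at \<open>u\<close> to
  those at \<open>u + r t\<close>, and the indicator moves from \<open>[0, u]\<close> to \<open>[0, u + r t]\<close>. The proof separates them.

  If only the indicator moves, the increment is \<open>B u\<close> times the series with terms
  \<open>\<gamma>\<^sub>i \<Gamma>\<^sub>i powr (- h) * f V\<^sub>i\<close>, where \<open>f\<close> is a difference of two indicators. By the LePage
  representation (\<open>char_lepage\<close>) such a series is symmetric stable with index \<open>\<alpha> u\<close>, with the scale
  parameter given by the integral of \<open>\<bar>f\<bar> powr \<alpha> u\<close>. Multiplication by \<open>r powr (- h)\<close>
  compensates the substitution \<open>v = u + r x\<close> exactly, so for all small \<open>r\<close> the rescaled increments have
  the joint characteristic functions of \<open>b u\<close> times Levy motion (\<open>char_stable_increment\<close>), and hence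
  its finite-dimensional laws (\<open>char_unique_PiM\<close>). No limit is involved in this part.

  The rest is a random sign series whose coefficients are differences of
  \<open>B t * \<Gamma>\<^sub>i powr (- (1 / \<alpha> t))\<close> between the times \<open>u + r t\<close> and \<open>u\<close>. As \<open>B\<close> and \<open>\<alpha>\<close> are
  Lipschitz at \<open>u\<close>, these are at most a multiple of \<open>r\<close> times a square summable sequence that does not
  depend on \<open>r\<close>. Given the arrival times and the marks, the rest is therefore of order \<open>r\<close>; since
  \<open>h < 1\<close>, it vanishes in probability after multiplication by \<open>r powr (- h)\<close>
  (\<open>remainder_tendsto_0\<close>). A vector of constant law plus a negligible perturbation converges in law
  (\<open>slutsky\<close>).

  The LePage representation rests on two facts. Given the arrival times, averaging over signs and
  marks turns the characteristic function of a partial sum into a product over the arrivals, and the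
  expectation of such a product is known explicitly (\<open>expectation_product_arrivals\<close>). The exponent
  obtained in this way is the integral of \<open>1 - cos (A * x powr (- (1 / a)))\<close> over the positive axis,
  which \<open>cos_layer_cake\<close> expresses by \<open>stable_const a\<close>. Convergence of the series comes from
  Kolmogorov's maximal inequality for the signs (\<open>AE_summable_signs\<close>) and the linear growth of the
  arrival times (\<open>AE_arrivals_lower_bound\<close>).

  That the local form can be realised on the path space also follows from the exact self-similarity:
  the laws of the rescaled increments at finitely many times do not depend on \<open>r\<close>, so they are
  consistent, and Kolmogorov's extension theorem applies (\<open>local_form_exists\<close>).\<close>

section \<open>Independent random elements\<close>

text \<open>The joint law of independent random elements is a product, so by Fubini's theorem one of them
  can be held fixed while the other is averaged over an independent copy.\<close>

lemma (in prob_space) integral_freeze: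
  fixes F :: "_ \<Rightarrow> 'c :: {banach, second_countable_topology}"
  assumes ind: "indep_var Q X R E"
    and F[measurable]: "F \<in> borel_measurable (Q \<Otimes>\<^sub>M R)"
    and bounded: "\<And>p. norm (F p) \<le> B"
  shows "(LINT \<omega>|M. F (X \<omega>, E \<omega>)) = (LINT \<omega>|M. LINT \<omega>'|M. F (X \<omega>, E \<omega>'))"
proof -
  have [measurable]: "X \<in> measurable M Q" "E \<in> measurable M R"
    using indep_var_rv1[OF ind] indep_var_rv2[OF ind] by simp_all
  interpret X: prob_space "distr M Q X" by (rule prob_space_distr) simp
  interpret E: prob_space "distr M R E" by (rule prob_space_distr) simp
  interpret XE: pair_prob_space "distr M Q X" "distr M R E" ..
  have F': "F \<in> borel_measurable (distr M Q X \<Otimes>\<^sub>M distr M R E)"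
    using F by (subst measurable_cong_sets[OF sets_pair_measure_cong[OF sets_distr sets_distr] refl])
  have int: "integrable (distr M Q X \<Otimes>\<^sub>M distr M R E) F"
    using F' bounded by (intro XE.integrable_const_bound[of _ B]) auto
  have "(LINT \<omega>|M. F (X \<omega>, E \<omega>)) = (LINT p|distr M (Q \<Otimes>\<^sub>M R) (\<lambda>\<omega>. (X \<omega>, E \<omega>)). F p)"
    by (rule integral_distr[symmetric]) measurable
  also have "\<dots> = (LINT p|(distr M Q X \<Otimes>\<^sub>M distr M R E). F p)"
    using indep_var_distribution_eq[of Q X R E] ind by simp
  also have "\<dots> = (LINT x|distr M Q X. LINT y|distr M R E. F (x, y))"
    using XE.integral_fst'[OF int] by simp
  also have "\<dots> = (LINT \<omega>|M. LINT y|distr M R E. F (X \<omega>, y))"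
    by (rule integral_distr) measurable
  also have "\<dots> = (LINT \<omega>|M. LINT \<omega>'|M. F (X \<omega>, E \<omega>'))"
    by (intro Bochner_Integration.integral_cong refl, subst integral_distr)
       (auto intro!: measurable_compose[OF _ F] measurable_Pair1' dest: measurable_space)
  finally show ?thesis .
qed

text \<open>The indicator of the exceptional set has iterated integral zero.\<close>

lemma (in prob_space) AE_freeze:
  assumes ind: "indep_var Q X R E"
    and [measurable]: "Measurable.pred (Q \<Otimes>\<^sub>M R) P"
    and ae: "AE \<omega> in M. AE \<omega>' in M. P (X \<omega>, E \<omega>')"
  shows "AE \<omega> in M. P (X \<omega>, E \<omega>)"
proof -
  have [measurable]: "X \<in> measurable M Q" "E \<in> measurable M R"
    using indep_var_rv1[OF ind] indep_var_rv2[OF ind] by simp_all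
  define F :: "_ \<Rightarrow> real" where "F p = (if P p then 0 else 1)" for p
  have [measurable]: "F \<in> borel_measurable (Q \<Otimes>\<^sub>M R)"
    unfolding F_def by measurable
  have "(LINT \<omega>|M. F (X \<omega>, E \<omega>)) = (LINT \<omega>|M. LINT \<omega>'|M. F (X \<omega>, E \<omega>'))"
    by (intro integral_freeze[OF ind, of _ 1]) (auto simp: F_def)
  also have "\<dots> = 0"
  proof (rule integral_eq_zero_AE)
    show "AE \<omega> in M. (LINT \<omega>'|M. F (X \<omega>, E \<omega>')) = 0"
      using ae
    proof eventually_elim
      case (elim \<omega>)
      then have "AE \<omega>' in M. F (X \<omega>, E \<omega>') = 0"
        by eventually_elim (simp add: F_def)
      then show ?case by (rule integral_eq_zero_AE)
    qed
  qed
  finally have "AE \<omega> in M. F (X \<omega>, E \<omega>) = 0"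
    by (subst (asm) integral_nonneg_eq_0_iff_AE)
       (auto simp: F_def intro!: integrable_const_bound[of _ 1])
  then show ?thesis
    by eventually_elim (simp add: F_def split: if_splits)
qed

section \<open>Random sign series\<close>

text \<open>The partial sums, stopped when they first reach modulus \<open>\<delta>\<close>. The stopped sum at time \<open>n\<close>
  remembers whether the barrier has been reached up to then, which turns a statement about a maximum
  into one about a single variable.\<close>

fun stopped_sum :: "(nat \<Rightarrow> real) \<Rightarrow> real \<Rightarrow> nat \<Rightarrow> (nat \<Rightarrow> real) \<Rightarrow> real" where
  "stopped_sum a \<delta> 0 e = 0"
| "stopped_sum a \<delta> (Suc n) e =
     (if \<delta> \<le> \<bar>stopped_sum a \<delta> n e\<bar> then stopped_sum a \<delta> n e
      else stopped_sum a \<delta> n e + e n * a n)"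


lemma stopped_sum_stops:
  assumes "\<delta> > 0" "k \<le> n" "\<delta> \<le> \<bar>\<Sum>i<k. e i * a i\<bar>"
  shows "\<delta> \<le> \<bar>stopped_sum a \<delta> n e\<bar>"
proof -
  have eq: "stopped_sum a \<delta> k e = (\<Sum>i<k. e i * a i) \<or> \<delta> \<le> \<bar>stopped_sum a \<delta> k e\<bar>" for k
    by (induction k) auto
  have "\<delta> \<le> \<bar>stopped_sum a \<delta> k e\<bar>"
    using eq[of k] assms by auto
  with \<open>k \<le> n\<close> show ?thesis
    by (induction rule: dec_induct) auto
qed

lemma stopped_sum_cong: "(\<And>i. i < n \<Longrightarrow> e i = e' i) \<Longrightarrow> stopped_sum a \<delta> n e = stopped_sum a \<delta> n e'"
  by (induction n) auto

lemma stopped_sum_measurable: "k \<le> n \<Longrightarrow> (\<lambda>e. stopped_sum a \<delta> k e) \<in> borel_measurable (PiM {..<n} (\<lambda>_. borel))"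
proof (induction k)
  case 0
  have "stopped_sum a \<delta> 0 = (\<lambda>e. 0)" by (rule ext) simp
  then show ?case by simp
next
  case (Suc k)
  then have [measurable]: "(\<lambda>e. stopped_sum a \<delta> k e) \<in> borel_measurable (PiM {..<n} (\<lambda>_. borel))"
    by simp
  have [measurable]: "(\<lambda>e. e k) \<in> borel_measurable (PiM {..<n} (\<lambda>_. borel :: real measure))"
    using Suc.prems by (intro measurable_component_singleton) auto
  show ?case unfolding stopped_sum.simps by measurable
qed

lemma stopped_sum_bounded:
  assumes "\<And>i. \<bar>e i\<bar> = 1"
  shows "\<bar>stopped_sum a \<delta> n e\<bar> \<le> (\<Sum>i<n. \<bar>a i\<bar>)"
proof (induction n)
  case (Suc n)
  have "\<bar>stopped_sum a \<delta> n e + e n * a n\<bar> \<le> \<bar>stopped_sum a \<delta> n e\<bar> + \<bar>a n\<bar>"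
    using assms[of n] by (metis abs_mult abs_triangle_ineq mult_1)
  with Suc show ?case by auto
qed simp

locale rademacher_sequence = prob_space M for M :: "'w measure" +
  fixes \<epsilon> :: "nat \<Rightarrow> 'w \<Rightarrow> real"
  assumes indep_signs: "indep_vars (\<lambda>_. borel) \<epsilon> UNIV"
    and prob_plus: "\<And>i. measure M {\<omega> \<in> space M. \<epsilon> i \<omega> = 1} = 1 / 2"
    and prob_minus: "\<And>i. measure M {\<omega> \<in> space M. \<epsilon> i \<omega> = - 1} = 1 / 2"
begin

lemma sign_measurable[measurable]: "\<epsilon> i \<in> borel_measurable M"
  using indep_signs unfolding indep_vars_def2 by blast

lemma AE_sign: "AE \<omega> in M. \<epsilon> i \<omega> = 1 \<or> \<epsilon> i \<omega> = - 1"
proof -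
  have "measure M ({\<omega> \<in> space M. \<epsilon> i \<omega> = 1} \<union> {\<omega> \<in> space M. \<epsilon> i \<omega> = - 1})
      = measure M {\<omega> \<in> space M. \<epsilon> i \<omega> = 1} + measure M {\<omega> \<in> space M. \<epsilon> i \<omega> = - 1}"
    by (intro finite_measure_Union) auto
  then have "prob {\<omega> \<in> space M. \<epsilon> i \<omega> = 1 \<or> \<epsilon> i \<omega> = - 1} = 1"
    unfolding prob_plus prob_minus by (simp add: Un_def conj_disj_distribL)
  then show ?thesis
    by (intro AE_I_eq_1) (auto simp: emeasure_eq_measure)
qed

lemma AE_signs: "AE \<omega> in M. \<forall>i. \<epsilon> i \<omega> = 1 \<or> \<epsilon> i \<omega> = - 1"
  using AE_sign by (simp add: AE_all_countable)

lemma integral_sign: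
  fixes g :: "real \<Rightarrow> 'c :: {banach, second_countable_topology}"
  assumes [measurable]: "g \<in> borel_measurable borel"
  shows "(LINT \<omega>|M. g (\<epsilon> i \<omega>)) = (1 / 2) *\<^sub>R (g 1 + g (- 1))"
proof -
  let ?A = "\<lambda>c. {\<omega> \<in> space M. \<epsilon> i \<omega> = c}"
  have "(LINT \<omega>|M. g (\<epsilon> i \<omega>)) = (LINT \<omega>|M. indicator (?A 1) \<omega> *\<^sub>R g 1 + indicator (?A (-1)) \<omega> *\<^sub>R g (-1))"
  proof (rule integral_cong_AE)
    show ae: "AE \<omega> in M. g (\<epsilon> i \<omega>) = indicator (?A 1) \<omega> *\<^sub>R g 1 + indicator (?A (-1)) \<omega> *\<^sub>R g (-1)"
      using AE_sign[of i] AE_space by eventually_elim (auto simp: indicator_def)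
    show "(\<lambda>\<omega>. indicator (?A 1) \<omega> *\<^sub>R g 1 + indicator (?A (-1)) \<omega> *\<^sub>R g (-1)) \<in> borel_measurable M"
      by measurable
    show "(\<lambda>\<omega>. g (\<epsilon> i \<omega>)) \<in> borel_measurable M"
      by measurable
  qed
  also have "\<dots> = measure M (?A 1) *\<^sub>R g 1 + measure M (?A (-1)) *\<^sub>R g (-1)"
    by (subst Bochner_Integration.integral_add)
       (auto intro!: integrable_scaleR_left integrable_real_indicator simp: emeasure_eq_measure)
  finally show ?thesis
    by (simp only: prob_plus prob_minus scaleR_add_right)
qed


lemma stopped_sum_random[measurable]: "(\<lambda>\<omega>. stopped_sum a \<delta> n (\<lambda>i. \<epsilon> i \<omega>)) \<in> borel_measurable M"
  by (induction n) auto

lemma AE_stopped_sum_bounded: "AE \<omega> in M. \<bar>stopped_sum a \<delta> n (\<lambda>i. \<epsilon> i \<omega>)\<bar> \<le> (\<Sum>i<n. \<bar>a i\<bar>)"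
  using AE_signs
proof eventually_elim
  case (elim \<omega>)
  then have "\<bar>\<epsilon> i \<omega>\<bar> = 1" for i by (cases "\<epsilon> i \<omega> = 1") auto
  then show ?case by (rule stopped_sum_bounded)
qed

lemma integrable_AE_bounded:
  fixes f :: "'w \<Rightarrow> real"
  assumes "f \<in> borel_measurable M" "AE \<omega> in M. \<bar>f \<omega>\<bar> \<le> B"
  shows "integrable M f"
  using assms by (intro integrable_const_bound[of _ B]) auto

text \<open>A step adds the new sign times a quantity that depends only on the earlier signs; the cross term
  has expectation zero, and stopping only discards variance.\<close>

lemma expectation_stopped_sum:
  "expectation (\<lambda>\<omega>. (stopped_sum a \<delta> n (\<lambda>i. \<epsilon> i \<omega>))\<^sup>2) \<le> (\<Sum>i<n. (a i)\<^sup>2)"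
proof (induction n)
  case (Suc n)
  define Z where "Z \<omega> = stopped_sum a \<delta> n (\<lambda>i. \<epsilon> i \<omega>)" for \<omega>
  define I :: "'w \<Rightarrow> real" where "I \<omega> = (if \<delta> \<le> \<bar>Z \<omega>\<bar> then 0 else 1)" for \<omega>
  let ?G = "\<lambda>e. (if \<delta> \<le> \<bar>stopped_sum a \<delta> n e\<bar> then 0 else stopped_sum a \<delta> n e)"
  let ?B = "\<Sum>i<n. \<bar>a i\<bar>"
  have [measurable]: "Z \<in> borel_measurable M"
    unfolding Z_def by (rule stopped_sum_random)
  have [measurable]: "I \<in> borel_measurable M"
    unfolding I_def by measurable
  have Z_bound: "AE \<omega> in M. \<bar>Z \<omega>\<bar> \<le> ?B"
    unfolding Z_def by (rule AE_stopped_sum_bounded)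
  have ZI: "?G (\<lambda>i\<in>{..<n}. \<epsilon> i \<omega>) = Z \<omega> * I \<omega>" for \<omega>
  proof -
    have "stopped_sum a \<delta> n (\<lambda>i\<in>{..<n}. \<epsilon> i \<omega>) = Z \<omega>"
      unfolding Z_def by (intro stopped_sum_cong) simp
    then show ?thesis unfolding I_def by simp
  qed
  have mG: "?G \<in> borel_measurable (PiM {..<n} (\<lambda>_. borel))"
    using stopped_sum_measurable[OF order_refl, of a \<delta> n] by measurable
  have "indep_var (PiM {..<n} (\<lambda>_. borel)) (\<lambda>\<omega>. restrict (\<lambda>i. \<epsilon> i \<omega>) {..<n})
      (PiM {n} (\<lambda>_. borel)) (\<lambda>\<omega>. restrict (\<lambda>i. \<epsilon> i \<omega>) {n})"
    by (rule indep_var_restrict[OF indep_signs]) auto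
  then have "indep_var borel (?G \<circ> (\<lambda>\<omega>. restrict (\<lambda>i. \<epsilon> i \<omega>) {..<n}))
      borel ((\<lambda>e. e n) \<circ> (\<lambda>\<omega>. restrict (\<lambda>i. \<epsilon> i \<omega>) {n}))"
    by (rule indep_var_compose[OF _ mG]) auto
  then have ind: "indep_var borel (\<lambda>\<omega>. Z \<omega> * I \<omega>) borel (\<epsilon> n)"
    by (simp only: comp_def ZI) simp
  have int_ZI: "integrable M (\<lambda>\<omega>. Z \<omega> * I \<omega>)"
    using Z_bound by (intro integrable_AE_bounded[of _ ?B]) (auto elim!: eventually_mono simp: I_def sum_nonneg)
  have int_e: "integrable M (\<epsilon> n)"
    using AE_sign[of n] by (intro integrable_AE_bounded[of _ 1]) auto
  have "expectation (\<lambda>\<omega>. Z \<omega> * I \<omega> * \<epsilon> n \<omega>) = expectation (\<lambda>\<omega>. Z \<omega> * I \<omega>) * expectation (\<epsilon> n)"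
    using ind int_ZI int_e by (rule indep_var_lebesgue_integral)
  also have "expectation (\<epsilon> n) = 0"
    using integral_sign[of "\<lambda>x. x" n] by simp
  finally have cross: "expectation (\<lambda>\<omega>. Z \<omega> * I \<omega> * \<epsilon> n \<omega>) = 0" by simp
  have int_cross: "integrable M (\<lambda>\<omega>. Z \<omega> * I \<omega> * \<epsilon> n \<omega>)"
    using ind int_ZI int_e by (rule indep_var_integrable)
  have int_Z2: "integrable M (\<lambda>\<omega>. (Z \<omega>)\<^sup>2)"
    using Z_bound
    by (intro integrable_AE_bounded[of _ "?B\<^sup>2"]) (auto elim!: eventually_mono simp: abs_le_square_iff[symmetric] sum_nonneg)
  have "expectation (\<lambda>\<omega>. (stopped_sum a \<delta> (Suc n) (\<lambda>i. \<epsilon> i \<omega>))\<^sup>2)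
      \<le> expectation (\<lambda>\<omega>. (Z \<omega>)\<^sup>2 + 2 * a n * (Z \<omega> * I \<omega> * \<epsilon> n \<omega>) + (a n)\<^sup>2)"
  proof (rule integral_mono_AE)
    show "integrable M (\<lambda>\<omega>. (Z \<omega>)\<^sup>2 + 2 * a n * (Z \<omega> * I \<omega> * \<epsilon> n \<omega>) + (a n)\<^sup>2)"
      by (intro Bochner_Integration.integrable_add integrable_mult_right int_Z2 int_cross) simp
    have "AE \<omega> in M. \<bar>stopped_sum a \<delta> (Suc n) (\<lambda>i. \<epsilon> i \<omega>)\<bar> \<le> (\<Sum>i<Suc n. \<bar>a i\<bar>)"
      by (rule AE_stopped_sum_bounded)
    then show "integrable M (\<lambda>\<omega>. (stopped_sum a \<delta> (Suc n) (\<lambda>i. \<epsilon> i \<omega>))\<^sup>2)"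
      by (intro integrable_AE_bounded[of _ "(\<Sum>i<Suc n. \<bar>a i\<bar>)\<^sup>2"] borel_measurable_power stopped_sum_random)
         (auto elim!: eventually_mono simp: abs_le_square_iff[symmetric] sum_nonneg simp del: stopped_sum.simps sum.lessThan_Suc)
    show "AE \<omega> in M. (stopped_sum a \<delta> (Suc n) (\<lambda>i. \<epsilon> i \<omega>))\<^sup>2
        \<le> (Z \<omega>)\<^sup>2 + 2 * a n * (Z \<omega> * I \<omega> * \<epsilon> n \<omega>) + (a n)\<^sup>2"
      using AE_sign[of n] by eventually_elim (auto simp: Z_def[symmetric] I_def power2_eq_square algebra_simps)
  qed
  also have "\<dots> = expectation (\<lambda>\<omega>. (Z \<omega>)\<^sup>2) + (a n)\<^sup>2"
    using int_Z2 int_cross by (simp add: cross prob_space)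
  also have "\<dots> \<le> (\<Sum>i<Suc n. (a i)\<^sup>2)"
    using Suc.IH by (simp add: Z_def)
  finally show ?case .
qed simp

text \<open>Kolmogorov's maximal inequality: Chebyshev's inequality for the stopped sum.\<close>

lemma maximal_inequality:
  assumes "\<delta> > 0"
  shows "prob {\<omega> \<in> space M. \<exists>k\<le>n. \<delta> \<le> \<bar>\<Sum>i<k. \<epsilon> i \<omega> * a i\<bar>} \<le> (\<Sum>i<n. (a i)\<^sup>2) / \<delta>\<^sup>2"
proof -
  let ?Z = "\<lambda>\<omega>. stopped_sum a \<delta> n (\<lambda>i. \<epsilon> i \<omega>)"
  have "AE \<omega> in M. \<bar>?Z \<omega>\<bar> \<le> (\<Sum>i<n. \<bar>a i\<bar>)"
    by (rule AE_stopped_sum_bounded)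
  then have int: "integrable M (\<lambda>\<omega>. (?Z \<omega>)\<^sup>2)"
    by (intro integrable_AE_bounded[of _ "(\<Sum>i<n. \<bar>a i\<bar>)\<^sup>2"])
       (auto elim!: eventually_mono simp: abs_le_square_iff[symmetric] sum_nonneg)
  have "prob {\<omega> \<in> space M. \<exists>k\<le>n. \<delta> \<le> \<bar>\<Sum>i<k. \<epsilon> i \<omega> * a i\<bar>} \<le> prob {\<omega> \<in> space M. (?Z \<omega>)\<^sup>2 \<ge> \<delta>\<^sup>2}"
  proof (rule finite_measure_mono, safe)
    fix \<omega> k assume "k \<le> n" "\<delta> \<le> \<bar>\<Sum>i<k. \<epsilon> i \<omega> * a i\<bar>"
    then have "\<delta> \<le> \<bar>?Z \<omega>\<bar>"
      by (rule stopped_sum_stops[OF \<open>\<delta> > 0\<close>])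
    with \<open>\<delta> > 0\<close> show "\<delta>\<^sup>2 \<le> (?Z \<omega>)\<^sup>2"
      by (simp add: abs_le_square_iff[symmetric])
  qed measurable
  also have "\<dots> \<le> expectation (\<lambda>\<omega>. (?Z \<omega>)\<^sup>2) / \<delta>\<^sup>2"
    using assms int by (intro integral_Markov_inequality_measure[where A = "{}"]) auto
  also have "\<dots> \<le> (\<Sum>i<n. (a i)\<^sup>2) / \<delta>\<^sup>2"
    by (intro divide_right_mono expectation_stopped_sum) simp
  finally show ?thesis .
qed

lemma maximal_inequality_infinite:
  assumes "\<delta> > 0" "summable (\<lambda>i. (a i)\<^sup>2)"
  shows "prob {\<omega> \<in> space M. \<exists>k. \<delta> \<le> \<bar>\<Sum>i<k. \<epsilon> i \<omega> * a i\<bar>} \<le> (\<Sum>i. (a i)\<^sup>2) / \<delta>\<^sup>2"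
proof -
  let ?A = "\<lambda>n. {\<omega> \<in> space M. \<exists>k\<le>n. \<delta> \<le> \<bar>\<Sum>i<k. \<epsilon> i \<omega> * a i\<bar>}"
  have "(\<lambda>n. prob (?A n)) \<longlonglongrightarrow> prob (\<Union>n. ?A n)"
  proof (rule finite_Lim_measure_incseq)
    show "range ?A \<subseteq> events" by auto
    show "incseq ?A" unfolding incseq_def by (blast intro: order_trans)
  qed
  moreover have "prob (?A n) \<le> (\<Sum>i. (a i)\<^sup>2) / \<delta>\<^sup>2" for n
    using maximal_inequality[OF assms(1), of n a] sum_le_suminf[OF assms(2), of "{..<n}"]
    by (elim order_trans, intro divide_right_mono) auto
  ultimately have "prob (\<Union>n. ?A n) \<le> (\<Sum>i. (a i)\<^sup>2) / \<delta>\<^sup>2"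
    by (intro LIMSEQ_le_const2) auto
  moreover have "(\<Union>n. ?A n) = {\<omega> \<in> space M. \<exists>k. \<delta> \<le> \<bar>\<Sum>i<k. \<epsilon> i \<omega> * a i\<bar>}"
    by auto
  ultimately show ?thesis by simp
qed


text \<open>The partial sums are almost surely Cauchy, because by the maximal inequality their oscillation
  after time \<open>m\<close> is controlled by the tail of the sum of squares.\<close>

lemma AE_summable_signs:
  assumes "summable (\<lambda>i. (a i)\<^sup>2)"
  shows "AE \<omega> in M. summable (\<lambda>i. \<epsilon> i \<omega> * a i)"
proof -
  \<comment> \<open>Annulling the first \<open>m\<close> coefficients makes the partial sums start at \<open>m\<close>.\<close>
  define a' where "a' m i = (if i < m then 0 else a i)" for m i
  define S where "S m k \<omega> = (\<Sum>i<k. \<epsilon> i \<omega> * a' m i)" for m k \<omega>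
  have [measurable]: "S m k \<in> borel_measurable M" for m k
    unfolding S_def by measurable
  have bad: "prob {\<omega> \<in> space M. \<exists>k. \<delta> \<le> \<bar>S m k \<omega>\<bar>} \<le> (\<Sum>i. (a (i + m))\<^sup>2) / \<delta>\<^sup>2" if "\<delta> > 0" for \<delta> m
  proof -
    have "(\<lambda>i. (a' m (i + m))\<^sup>2) sums (\<Sum>i. (a (i + m))\<^sup>2)"
      using summable_ignore_initial_segment[OF assms, of m] by (simp add: a'_def summable_sums)
    then have "(\<lambda>i. (a' m i)\<^sup>2) sums (\<Sum>i. (a (i + m))\<^sup>2)"
      by (subst (asm) sums_iff_shift) (simp add: a'_def)
    then show ?thesis
      using maximal_inequality_infinite[OF that, of "a' m"] by (simp add: S_def sums_iff)
  qed
  have tail: "(\<lambda>m. (\<Sum>i. (a (i + m))\<^sup>2)) \<longlonglongrightarrow> 0"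
    using suminf_exist_split2[OF assms] by simp
  have "AE \<omega> in M. \<exists>m. \<forall>k. \<bar>S m k \<omega>\<bar> < \<delta>" if "\<delta> > 0" for \<delta>
  proof -
    let ?N = "{\<omega> \<in> space M. \<not> (\<exists>m. \<forall>k. \<bar>S m k \<omega>\<bar> < \<delta>)}"
    have "prob ?N \<le> (\<Sum>i. (a (i + m))\<^sup>2) / \<delta>\<^sup>2" for m
    proof -
      have "prob ?N \<le> prob {\<omega> \<in> space M. \<exists>k. \<delta> \<le> \<bar>S m k \<omega>\<bar>}"
        by (intro finite_measure_mono) (auto simp: not_less)
      with bad[OF that, of m] show ?thesis by linarith
    qed
    moreover have "(\<lambda>m. (\<Sum>i. (a (i + m))\<^sup>2) / \<delta>\<^sup>2) \<longlonglongrightarrow> 0"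
      using tendsto_divide[OF tail tendsto_const, of "\<delta>\<^sup>2"] that by simp
    ultimately have "prob ?N \<le> 0"
      by (intro LIMSEQ_le_const) auto
    then have "emeasure M ?N = 0"
      by (simp add: emeasure_eq_measure measure_le_0_iff)
    then show ?thesis
      by (intro AE_I[of _ _ ?N]) auto
  qed
  then have "AE \<omega> in M. \<forall>n. \<exists>m. \<forall>k. \<bar>S m k \<omega>\<bar> < inverse (real (Suc n))"
    by (subst AE_all_countable) simp
  then show ?thesis
  proof eventually_elim
    case (elim \<omega>)
    show "summable (\<lambda>i. \<epsilon> i \<omega> * a i)"
      unfolding summable_Cauchy
    proof (intro allI impI)
      fix e :: real assume "e > 0"
      then obtain n where n: "inverse (real (Suc n)) < e / 2"
        using reals_Archimedean[of "e / 2"] by auto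
      obtain m where m: "\<And>k. \<bar>S m k \<omega>\<bar> < inverse (real (Suc n))"
        using elim by blast
      have "norm (\<Sum>i\<in>{p..<q}. \<epsilon> i \<omega> * a i) < e" if "p \<ge> m" for p q
      proof (cases "p \<le> q")
        case True
        have "(\<Sum>i\<in>{p..<q}. \<epsilon> i \<omega> * a i) = (\<Sum>i\<in>{p..<q}. \<epsilon> i \<omega> * a' m i)"
          using that by (intro sum.cong) (auto simp: a'_def)
        also have "\<dots> = S m q \<omega> - S m p \<omega>"
          unfolding S_def using sum_diff_nat_ivl[of 0 p q "\<lambda>i. \<epsilon> i \<omega> * a' m i"] True
          by (simp add: lessThan_atLeast0)
        finally show ?thesis
          using m[of p] m[of q] n unfolding real_norm_def by linarith
      qed (use \<open>e > 0\<close> in simp)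
      then show "\<exists>N. \<forall>m\<ge>N. \<forall>n. norm (\<Sum>i\<in>{m..<n}. \<epsilon> i \<omega> * a i) < e" by blast
    qed
  qed
qed

text \<open>If the limit has modulus at least \<open>\<delta>\<close>, some partial sum has modulus at least \<open>\<delta> / 2\<close>; the
  factor 4 comes from there.\<close>

lemma prob_sign_series_ge:
  assumes "\<delta> > 0" "summable (\<lambda>i. (a i)\<^sup>2)"
  shows "prob {\<omega> \<in> space M. \<delta> \<le> \<bar>\<Sum>i. \<epsilon> i \<omega> * a i\<bar>} \<le> 4 * (\<Sum>i. (a i)\<^sup>2) / \<delta>\<^sup>2"
proof -
  have "prob {\<omega> \<in> space M. \<delta> \<le> \<bar>\<Sum>i. \<epsilon> i \<omega> * a i\<bar>} \<le>
      prob {\<omega> \<in> space M. \<exists>k. \<delta> / 2 \<le> \<bar>\<Sum>i<k. \<epsilon> i \<omega> * a i\<bar>}"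
  proof (rule finite_measure_mono_AE)
    show "AE \<omega> in M. \<omega> \<in> {\<omega> \<in> space M. \<delta> \<le> \<bar>\<Sum>i. \<epsilon> i \<omega> * a i\<bar>} \<longrightarrow>
        \<omega> \<in> {\<omega> \<in> space M. \<exists>k. \<delta> / 2 \<le> \<bar>\<Sum>i<k. \<epsilon> i \<omega> * a i\<bar>}"
      using AE_summable_signs[OF assms(2)]
    proof eventually_elim
      case (elim \<omega>)
      then have "(\<lambda>k. \<bar>\<Sum>i<k. \<epsilon> i \<omega> * a i\<bar>) \<longlonglongrightarrow> \<bar>\<Sum>i. \<epsilon> i \<omega> * a i\<bar>"
        by (intro tendsto_rabs summable_LIMSEQ)
      then have "\<exists>k. \<delta> / 2 \<le> \<bar>\<Sum>i<k. \<epsilon> i \<omega> * a i\<bar>" if "\<delta> \<le> \<bar>\<Sum>i. \<epsilon> i \<omega> * a i\<bar>"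
        using order_tendstoD(1)[of _ _ _ "\<delta> / 2"] that assms(1)
        by (fastforce simp: eventually_sequentially intro: less_imp_le)
      then show ?case by auto
    qed
  qed measurable
  also have "\<dots> \<le> 4 * (\<Sum>i. (a i)\<^sup>2) / \<delta>\<^sup>2"
    using maximal_inequality_infinite[of "\<delta> / 2" a] assms by (simp add: power_divide field_simps)
  finally show ?thesis .
qed

text \<open>Averaging over a symmetric sign replaces the exponential by its even part, the cosine.\<close>

lemma char_sign_sum:
  "(LINT \<omega>|M. iexp (\<Sum>i<n. \<epsilon> i \<omega> * a i)) = complex_of_real (\<Prod>i<n. cos (a i))"
proof -
  have "(LINT \<omega>|M. iexp (\<Sum>i<n. \<epsilon> i \<omega> * a i)) = (LINT \<omega>|M. (\<Prod>i<n. iexp (\<epsilon> i \<omega> * a i)))"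
    by (simp add: exp_sum sum_distrib_left)
  also have "\<dots> = (\<Prod>i<n. LINT \<omega>|M. iexp (\<epsilon> i \<omega> * a i))"
  proof (rule indep_vars_lebesgue_integral)
    show "indep_vars (\<lambda>_. borel) (\<lambda>i \<omega>. iexp (\<epsilon> i \<omega> * a i)) {..<n}"
      by (rule indep_vars_compose2[OF indep_vars_subset[OF indep_signs]]) auto
    show "integrable M (\<lambda>\<omega>. iexp (\<epsilon> i \<omega> * a i))" for i
      by (intro integrable_const_bound[of _ 1]) auto
  qed simp
  also have "\<dots> = (\<Prod>i<n. complex_of_real (cos (a i)))"
  proof (rule prod.cong)
    fix i
    have "(LINT \<omega>|M. iexp (\<epsilon> i \<omega> * a i)) = (1 / 2) *\<^sub>R (iexp (1 * a i) + iexp (- 1 * a i))"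
      using integral_sign[of "\<lambda>x. iexp (x * a i)" i] by simp
    also have "\<dots> = complex_of_real (cos (a i))"
      by (simp add: complex_eq_iff Re_exp Im_exp)
    finally show "(LINT \<omega>|M. iexp (\<epsilon> i \<omega> * a i)) = complex_of_real (cos (a i))" .
  qed simp
  finally show ?thesis by simp
qed

end

section \<open>Arrival times of the Poisson process\<close>

text \<open>A right-continuous path with values in the natural numbers is constant to the right of each point.
  So the infimum that defines an arrival time is attained, and arrival times and counts determine
  each other.\<close>

lemma arrival_le_iff:
  fixes n :: "real \<Rightarrow> nat"
  assumes "n 0 = 0" and mono: "mono_on {0..} n"
    and rc: "\<And>t. t \<ge> 0 \<Longrightarrow> (n \<longlongrightarrow> n t) (at_right t)"
    and unbounded: "\<exists>t\<ge>0. i < n t"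
    and g: "g = Inf {t. 0 \<le> t \<and> Suc i \<le> n t}"
  shows "0 < g" and "0 \<le> t \<Longrightarrow> g \<le> t \<longleftrightarrow> i < n t"
proof -
  define A where "A = {t. 0 \<le> t \<and> Suc i \<le> n t}"
  have A: "A \<noteq> {}" "bdd_below A"
    using unbounded unfolding A_def by (auto intro!: bdd_belowI[of _ 0])
  have "0 \<le> g"
    unfolding g A_def[symmetric] using A by (intro cInf_greatest) (auto simp: A_def)
  have "eventually (\<lambda>t. n t = n g) (at_right g)"
    using rc[OF \<open>0 \<le> g\<close>] by (simp add: tendsto_discrete)
  moreover have "eventually (\<lambda>t. Suc i \<le> n t) (at_right g)"
    using eventually_at_right_less[of g]
  proof eventually_elim
    case (elim t)
    then obtain s where s: "s \<in> A" "s < t"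
      using A cInf_less_iff[of A t] by (auto simp: g A_def)
    then have "n s \<le> n t"
      using mono by (auto simp: A_def mono_on_def)
    with s show ?case by (auto simp: A_def)
  qed
  ultimately have "eventually (\<lambda>t. Suc i \<le> n g) (at_right g)"
    by eventually_elim simp
  then have ng: "Suc i \<le> n g" by simp
  with \<open>n 0 = 0\<close> \<open>0 \<le> g\<close> show "0 < g"
    by (cases "g = 0") auto
  show "g \<le> t \<longleftrightarrow> i < n t" if "0 \<le> t"
  proof
    assume "g \<le> t"
    then have "n g \<le> n t"
      using mono \<open>0 \<le> g\<close> by (auto simp: mono_on_def)
    with ng show "i < n t" by simp
  next
    assume "i < n t"
    then have "t \<in> A" using that by (simp add: A_def)
    then show "g \<le> t"
      unfolding g A_def[symmetric] using A by (intro cInf_lower)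
  qed
qed

lemma poisson_generating_function:
  fixes z :: real
  assumes "l > 0"
  shows "(LINT k|measure_pmf (poisson_pmf l). z ^ k) = exp (l * (z - 1))"
    and "integrable (measure_pmf (poisson_pmf l)) (\<lambda>k. z ^ k)"
proof -
  have sums: "(\<lambda>k. pmf (poisson_pmf l) k * z ^ k) sums (exp (- l) * exp (l * z))" for z
    using sums_mult[OF exp_converges[of "l * z"], of "exp (- l)"] assms
    by (simp add: power_mult_distrib divide_inverse mult_ac)
  have abs: "summable (\<lambda>k. norm (pmf (poisson_pmf l) k * z ^ k))"
    using sums_summable[OF sums[of "\<bar>z\<bar>"]] by (simp add: abs_mult power_abs)
  have int: "integrable (count_space UNIV) (\<lambda>k. pmf (poisson_pmf l) k * z ^ k)"
    using abs by (simp add: integrable_count_space_nat_iff)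
  have "(\<lambda>k. pmf (poisson_pmf l) k * z ^ k) sums (LINT k|count_space UNIV. pmf (poisson_pmf l) k * z ^ k)"
    by (rule sums_integral_count_space_nat[OF int])
  then have "(LINT k|count_space UNIV. pmf (poisson_pmf l) k * z ^ k) = exp (l * (z - 1))"
    using sums[of z] sums_unique2 by (fastforce simp: exp_add[symmetric] algebra_simps)
  then show "(LINT k|measure_pmf (poisson_pmf l). z ^ k) = exp (l * (z - 1))"
    by (subst measure_pmf_eq_density) (simp add: integral_density)
  show "integrable (measure_pmf (poisson_pmf l)) (\<lambda>k. z ^ k)"
    using int by (subst measure_pmf_eq_density) (simp add: integrable_density)
qed

text \<open>If the arrival times \<open>g i\<close> are rounded up to a grid of mesh \<open>h\<close>, a product over arrivals depends only
  on the number of arrivals in each cell.\<close>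

lemma count_product_grid:
  assumes "h > 0" and ord: "\<forall>i t. 0 \<le> t \<longrightarrow> (g i \<le> t \<longleftrightarrow> i < n t)" and "n 0 = (0 :: nat)"
    and mono: "mono_on {0..} n"
  shows "(\<Prod>i<n (real m * h). \<psi> (h * of_int \<lceil>g i / h\<rceil>)) =
    (\<Prod>k<m. \<psi> (h * real (Suc k)) ^ (n (real (Suc k) * h) - n (real k * h)) :: real)"
proof (induction m)
  case 0
  then show ?case using \<open>n 0 = 0\<close> by simp
next
  case (Suc m)
  let ?a = "n (real m * h)" and ?b = "n (real (Suc m) * h)"
  have le: "?a \<le> ?b"
    using mono \<open>h > 0\<close> by (auto simp: mono_on_def)
  have grid: "h * of_int \<lceil>g i / h\<rceil> = h * real (Suc m)" if "?a \<le> i" "i < ?b" for i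
  proof -
    have "g i \<le> real (Suc m) * h" "real m * h < g i"
      using ord[rule_format, of "real (Suc m) * h" i] ord[rule_format, of "real m * h" i] that \<open>h > 0\<close> by auto
    then have "g i / h \<le> real (Suc m)" "real m < g i / h"
      using \<open>h > 0\<close> by (auto simp: field_simps)
    then have "\<lceil>g i / h\<rceil> = int (Suc m)"
      by (intro ceiling_unique) auto
    then show ?thesis by simp
  qed
  have "(\<Prod>i<?b. \<psi> (h * of_int \<lceil>g i / h\<rceil>)) =
      (\<Prod>i<?a. \<psi> (h * of_int \<lceil>g i / h\<rceil>)) * (\<Prod>i\<in>{?a..<?b}. \<psi> (h * of_int \<lceil>g i / h\<rceil>))"
    using le by (simp add: prod.atLeastLessThan_concat lessThan_atLeast0)
  also have "(\<Prod>i\<in>{?a..<?b}. \<psi> (h * of_int \<lceil>g i / h\<rceil>)) = (\<Prod>i\<in>{?a..<?b}. \<psi> (h * real (Suc m)))"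
    by (intro prod.cong refl arg_cong[of _ _ \<psi>] grid) auto
  finally show ?case
    using Suc.IH by (simp del: of_nat_Suc)
qed

lemma grid_integral:
  fixes f :: "real \<Rightarrow> real"
  assumes "h > 0"
  shows "set_integrable lborel {0<..real m * h} (\<lambda>x. f (h * of_int \<lceil>x / h\<rceil>))"
    and "(LBINT x:{0<..real m * h}. f (h * of_int \<lceil>x / h\<rceil>)) = (\<Sum>k<m. h * f (h * real (Suc k)))"
proof (induction m)
  case 0
  case 1 show ?case by (simp add: set_integrable_def)
  case 2 show ?case by (simp add: set_lebesgue_integral_def)
next
  case (Suc m)
  let ?F = "\<lambda>x. f (h * of_int \<lceil>x / h\<rceil>)"
  let ?I = "{real m * h<..real (Suc m) * h}"
  have split: "{0<..real (Suc m) * h} = {0<..real m * h} \<union> ?I"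
    using assms by (auto simp: algebra_simps ivl_disj_un)
  have le: "real m * h \<le> real (Suc m) * h"
    using assms by (intro mult_right_mono) auto
  have const: "?F x = f (h * real (Suc m))" if "x \<in> ?I" for x
  proof -
    have "x / h \<le> real (Suc m)" "real m < x / h"
      using assms that by (auto simp: field_simps)
    then have "\<lceil>x / h\<rceil> = int (Suc m)"
      by (intro ceiling_unique) auto
    then show ?thesis by simp
  qed
  have int: "set_integrable lborel ?I ?F"
    by (subst set_integrable_cong[OF refl refl const])
       (use le in \<open>auto simp: set_integrable_def simp del: of_nat_Suc intro!: integrable_mult_left integrable_real_indicator\<close>)
  have "(LBINT x:?I. ?F x) = (LBINT x:?I. f (h * real (Suc m)))"
    using const by (intro set_lebesgue_integral_cong) auto
  also have "\<dots> = h * f (h * real (Suc m))"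
    using le by (simp add: set_lebesgue_integral_def algebra_simps)
  finally have val: "(LBINT x:?I. ?F x) = h * f (h * real (Suc m))" .
  case 1
  show ?case unfolding split using Suc.IH(1) int by (intro set_integrable_Un) auto
  case 2
  show ?case unfolding split
    using Suc.IH int val by (subst set_integral_Un) (auto simp del: of_nat_Suc)
qed

text \<open>From some index on the factors lie between 0 and 1, so the modulus of the products decreases and
  the sign is constant.\<close>

lemma convergent_product_eventually_nonneg:
  fixes f :: "nat \<Rightarrow> real"
  assumes "\<And>i. \<bar>f i\<bar> \<le> 1" "eventually (\<lambda>i. 0 \<le> f i) sequentially"
  shows "convergent (\<lambda>n. \<Prod>i<n. f i)"
proof -
  obtain k where k: "\<And>i. i \<ge> k \<Longrightarrow> 0 \<le> f i"
    using assms(2) by (auto simp: eventually_sequentially)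
  have "decseq (\<lambda>n. \<Prod>i<n. f (i + k))"
    unfolding decseq_Suc_iff
  proof
    fix n
    have "f (n + k) \<le> 1" using assms(1)[of "n + k"] by linarith
    then show "(\<Prod>i<Suc n. f (i + k)) \<le> (\<Prod>i<n. f (i + k))"
      using k by (simp add: mult_left_le prod_nonneg)
  qed
  moreover have "0 \<le> (\<Prod>i<n. f (i + k))" for n
    using k by (intro prod_nonneg) auto
  ultimately obtain L where "(\<lambda>n. \<Prod>i<n. f (i + k)) \<longlonglongrightarrow> L"
    using decseq_convergent[of "\<lambda>n. \<Prod>i<n. f (i + k)" 0] by blast
  then have "convergent (\<lambda>n. \<Prod>i<n. f (i + k))"
    by (rule convergentI)
  then have "convergent (\<lambda>n. (\<Prod>i<k. f i) * (\<Prod>i<n. f (i + k)))"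
    by (intro convergent_mult convergent_const)
  also have "(\<lambda>n. (\<Prod>i<k. f i) * (\<Prod>i<n. f (i + k))) = (\<lambda>n. \<Prod>i<n + k. f i)"
  proof
    fix n
    show "(\<Prod>i<k. f i) * (\<Prod>i<n. f (i + k)) = (\<Prod>i<n + k. f i)"
      by (induction n) (auto simp: mult.assoc[symmetric])
  qed
  finally show ?thesis
    using convergent_ignore_initial_segment[of "\<lambda>n. \<Prod>i<n. f i" k] by simp
qed

locale poisson_arrivals = prob_space M for M :: "'w measure" +
  fixes N :: "real \<Rightarrow> 'w \<Rightarrow> nat" and \<Gamma> :: "nat \<Rightarrow> 'w \<Rightarrow> real"
  assumes poisson: "poisson_process M 1 N"
    and arrivals: "arrival_times M N \<Gamma>"
begin

lemma arrival_measurable[measurable]: "\<Gamma> i \<in> borel_measurable M"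
  using arrivals by (simp add: arrival_times_def)

lemma count_measurable: "t \<ge> 0 \<Longrightarrow> N t \<in> measurable M (count_space UNIV)"
  using poisson by (simp add: poisson_process_def)

lemma count_paths:
  "AE \<omega> in M. N 0 \<omega> = 0 \<and> mono_on {0..} (\<lambda>t. N t \<omega>) \<and> (\<forall>t\<ge>0. ((\<lambda>s. N s \<omega>) \<longlongrightarrow> N t \<omega>) (at_right t))"
  using poisson unfolding poisson_process_def by blast

lemma independent_increments:
  assumes "0 \<le> \<tau> 0" "mono \<tau>"
  shows "indep_vars (\<lambda>_. count_space UNIV) (\<lambda>k \<omega>. N (\<tau> (Suc k)) \<omega> - N (\<tau> k) \<omega>) {..<m}"
proof -
  have "\<forall>\<tau> n. 0 \<le> \<tau> 0 \<longrightarrow> mono \<tau> \<longrightarrow>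
      indep_vars (\<lambda>_. count_space UNIV) (\<lambda>k \<omega>. N (\<tau> (Suc k)) \<omega> - N (\<tau> k) \<omega>) {..<n :: nat}"
    using poisson unfolding poisson_process_def by blast
  with assms show ?thesis by blast
qed

lemma increment_generating_function:
  fixes z :: real
  assumes "0 \<le> s" "s < t"
  shows "expectation (\<lambda>\<omega>. z ^ (N t \<omega> - N s \<omega>)) = exp ((t - s) * (z - 1))"
    and "integrable M (\<lambda>\<omega>. z ^ (N t \<omega> - N s \<omega>))"
proof -
  have [measurable]: "(\<lambda>\<omega>. N t \<omega> - N s \<omega>) \<in> measurable M (count_space UNIV)"
    using count_measurable[of s] count_measurable[of t] assms
    by (intro measurable_compose_countable[where f = "\<lambda>k \<omega>. N t \<omega> - k" and g = "N s"])
       (auto intro: measurable_compose[of "N t"])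
  have distr: "distr M (count_space UNIV) (\<lambda>\<omega>. N t \<omega> - N s \<omega>) = measure_pmf (poisson_pmf (t - s))"
    using poisson assms unfolding poisson_process_def by simp
  have "expectation (\<lambda>\<omega>. z ^ (N t \<omega> - N s \<omega>)) = (LINT k|distr M (count_space UNIV) (\<lambda>\<omega>. N t \<omega> - N s \<omega>). z ^ k)"
    by (subst integral_distr) auto
  then show "expectation (\<lambda>\<omega>. z ^ (N t \<omega> - N s \<omega>)) = exp ((t - s) * (z - 1))"
    unfolding distr using assms by (simp add: poisson_generating_function)
  have "integrable (distr M (count_space UNIV) (\<lambda>\<omega>. N t \<omega> - N s \<omega>)) (\<lambda>k. z ^ k)"
    unfolding distr using assms by (simp add: poisson_generating_function)
  then show "integrable M (\<lambda>\<omega>. z ^ (N t \<omega> - N s \<omega>))"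
    by (subst (asm) integrable_distr_eq) auto
qed

lemma count_generating_function:
  fixes z :: real
  assumes "t > 0"
  shows "expectation (\<lambda>\<omega>. z ^ N t \<omega>) = exp (t * (z - 1))"
    and "integrable M (\<lambda>\<omega>. z ^ N t \<omega>)"
proof -
  have [measurable]: "N t \<in> measurable M (count_space UNIV)" "N 0 \<in> measurable M (count_space UNIV)"
    using count_measurable[of t] count_measurable[of 0] assms by simp_all
  have ae: "AE \<omega> in M. z ^ N t \<omega> = z ^ (N t \<omega> - N 0 \<omega>)"
    using count_paths by eventually_elim simp
  have "expectation (\<lambda>\<omega>. z ^ N t \<omega>) = expectation (\<lambda>\<omega>. z ^ (N t \<omega> - N 0 \<omega>))"
    using ae by (intro integral_cong_AE) auto
  then show "expectation (\<lambda>\<omega>. z ^ N t \<omega>) = exp (t * (z - 1))"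
    using increment_generating_function(1)[of 0 t z] assms by simp
  have "integrable M (\<lambda>\<omega>. z ^ N t \<omega>) \<longleftrightarrow> integrable M (\<lambda>\<omega>. z ^ (N t \<omega> - N 0 \<omega>))"
    using ae by (intro integrable_cong_AE) auto
  then show "integrable M (\<lambda>\<omega>. z ^ N t \<omega>)"
    using increment_generating_function(2)[of 0 t z] assms by simp
qed

text \<open>Markov's inequality for \<open>(1 / 2) ^ N t\<close>, whose expectation is \<open>exp (- t / 2)\<close>.\<close>

lemma AE_count_unbounded: "AE \<omega> in M. \<forall>i. \<exists>t\<ge>0. i < N t \<omega>"
proof (subst AE_all_countable, intro allI)
  fix i
  have [measurable]: "N (real n) \<in> measurable M (count_space UNIV)" for n
    by (rule count_measurable) simp
  let ?A = "{\<omega> \<in> space M. \<forall>n. N (real n) \<omega> \<le> i}"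
  have "prob ?A \<le> 2 ^ i * exp (- (real (Suc n) / 2))" for n
  proof -
    have "prob ?A \<le> prob {\<omega> \<in> space M. (1 / 2) ^ N (real (Suc n)) \<omega> \<ge> (1 / 2 :: real) ^ i}"
      by (intro finite_measure_mono) (auto intro!: power_decreasing simp del: of_nat_Suc)
    also have "\<dots> \<le> expectation (\<lambda>\<omega>. (1 / 2 :: real) ^ N (real (Suc n)) \<omega>) / (1 / 2) ^ i"
      by (intro integral_Markov_inequality_measure[where A = "{}"] count_generating_function(2)) auto
    also have "\<dots> = 2 ^ i * exp (- (real (Suc n) / 2))"
      by (subst count_generating_function(1)) (auto simp: power_divide)
    finally show ?thesis .
  qed
  moreover have "(\<lambda>n. 2 ^ i * exp (- (real (Suc n) / 2))) \<longlonglongrightarrow> 0"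
    by real_asymp
  ultimately have "prob ?A \<le> 0"
    using LIMSEQ_le_const[of "\<lambda>n. 2 ^ i * exp (- (real (Suc n) / 2))" 0 "prob ?A"] by blast
  then have "emeasure M ?A = 0"
    by (simp add: emeasure_eq_measure measure_le_0_iff)
  then have "AE \<omega> in M. \<omega> \<notin> ?A"
    by (intro AE_not_in null_setsI) auto
  then show "AE \<omega> in M. \<exists>t\<ge>0. i < N t \<omega>"
    using AE_space
  proof eventually_elim
    case (elim \<omega>)
    then obtain n where "i < N (real n) \<omega>" by (auto simp: not_le)
    then show ?case by (intro exI[of _ "real n"]) simp
  qed
qed

lemma AE_arrivals:
  "AE \<omega> in M. (\<forall>i. 0 < \<Gamma> i \<omega>) \<and> (\<forall>i t. 0 \<le> t \<longrightarrow> (\<Gamma> i \<omega> \<le> t \<longleftrightarrow> i < N t \<omega>))"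
proof -
  have "AE \<omega> in M. \<forall>i. \<Gamma> i \<omega> = Inf {t. 0 \<le> t \<and> Suc i \<le> N t \<omega>}"
    using arrivals by (simp add: arrival_times_def AE_all_countable)
  then show ?thesis
    using count_paths AE_count_unbounded
  proof eventually_elim
    case (elim \<omega>)
    then show ?case
      using arrival_le_iff[of "\<lambda>t. N t \<omega>"] by blast
  qed
qed

text \<open>By Markov's inequality for \<open>2 ^ N t\<close> at \<open>t = (i + 1) / 2\<close>, the probability that \<open>i + 1\<close> arrivals
  occur up to this time is at most the power \<open>i + 1\<close> of \<open>exp (1 / 2) / 2 < 1\<close>. The
  Borel--Cantelli lemma leaves finitely many exceptions, and these are absorbed by the random constant.\<close>

lemma AE_arrivals_lower_bound: "AE \<omega> in M. \<exists>\<kappa>>0. \<forall>i. \<kappa> * real (Suc i) \<le> \<Gamma> i \<omega>"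
proof -
  let ?t = "\<lambda>i. real (Suc i) / 2"
  have [measurable]: "N (?t i) \<in> measurable M (count_space UNIV)" for i
    by (rule count_measurable) simp
  let ?B = "\<lambda>i. {\<omega> \<in> space M. i < N (?t i) \<omega>}"
  have bound: "prob (?B i) \<le> (exp (1 / 2) / 2) ^ Suc i" for i
  proof -
    have "prob (?B i) \<le> prob {\<omega> \<in> space M. (2 :: real) ^ N (?t i) \<omega> \<ge> 2 ^ Suc i}"
      by (intro finite_measure_mono) (auto intro!: power_increasing simp del: of_nat_Suc power_Suc)
    also have "\<dots> \<le> expectation (\<lambda>\<omega>. (2 :: real) ^ N (?t i) \<omega>) / 2 ^ Suc i"
      by (intro integral_Markov_inequality_measure[where A = "{}"] count_generating_function(2)) auto
    also have "\<dots> = (exp (1 / 2) / 2) ^ Suc i"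
      by (subst count_generating_function(1)) (auto simp: power_divide exp_of_nat_mult[symmetric] simp del: power_Suc of_nat_Suc)
    finally show ?thesis .
  qed
  have "exp (1 / 2 :: real) < 2"
  proof -
    have "exp (1 / 2 :: real) * exp (1 / 2) = exp 1"
      by (simp add: exp_add[symmetric])
    then show ?thesis
      using exp_le mult_mono[of 2 "exp (1 / 2 :: real)" 2 "exp (1 / 2)"] by fastforce
  qed
  then have "summable (\<lambda>i. (exp (1 / 2 :: real) / 2) ^ Suc i)"
    by (subst summable_Suc_iff) (simp add: summable_geometric)
  then have "summable (\<lambda>i. prob (?B i))"
    by (rule summable_comparison_test') (use bound in auto)
  then have "AE \<omega> in M. eventually (\<lambda>i. \<omega> \<in> space M - ?B i) sequentially"
    by (intro borel_cantelli_AE1) (auto simp: emeasure_eq_measure simp del: of_nat_Suc)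
  then show ?thesis
    using AE_arrivals
  proof eventually_elim
    case (elim \<omega>)
    then obtain n where n: "\<And>i. i \<ge> n \<Longrightarrow> ?t i < \<Gamma> i \<omega>"
      unfolding eventually_sequentially
      by (metis (no_types, lifting) Diff_iff mem_Collect_eq not_less divide_nonneg_nonneg of_nat_0_le_iff zero_le_numeral)
    define \<kappa> where "\<kappa> = Min (insert (1 / 2) ((\<lambda>i. \<Gamma> i \<omega> / real (Suc i)) ` {..<n}))"
    have "\<kappa> > 0"
      unfolding \<kappa>_def using elim by (subst Min_gr_iff) auto
    moreover have "\<kappa> * real (Suc i) \<le> \<Gamma> i \<omega>" for i
    proof (cases "i < n")
      case True
      then have "\<kappa> \<le> \<Gamma> i \<omega> / real (Suc i)"
        unfolding \<kappa>_def by (intro Min_le) auto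
      then show ?thesis by (simp add: pos_le_divide_eq)
    next
      case False
      have "\<kappa> \<le> 1 / 2"
        unfolding \<kappa>_def by (intro Min_le) auto
      then have "\<kappa> * real (Suc i) \<le> 1 / 2 * real (Suc i)"
        by (intro mult_right_mono) auto
      also have "\<dots> \<le> \<Gamma> i \<omega>"
        using n[of i] False by simp
      finally show ?thesis .
    qed
    ultimately show ?case by blast
  qed
qed


text \<open>The cell counts are independent Poisson variables, so the generating functions multiply.\<close>

lemma grid_product_expectation:
  fixes \<psi> :: "real \<Rightarrow> real"
  assumes "h > 0"
  shows "expectation (\<lambda>\<omega>. \<Prod>k<m. \<psi> (h * real (Suc k)) ^ (N (real (Suc k) * h) \<omega> - N (real k * h) \<omega>)) =
    exp (\<Sum>k<m. h * (\<psi> (h * real (Suc k)) - 1))"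
proof -
  let ?\<tau> = "\<lambda>k. real k * h"
  have "mono ?\<tau>" using assms by (intro monoI mult_right_mono) auto
  then have "indep_vars (\<lambda>_. count_space UNIV) (\<lambda>k \<omega>. N (?\<tau> (Suc k)) \<omega> - N (?\<tau> k) \<omega>) {..<m}"
    by (intro independent_increments) simp
  then have "indep_vars (\<lambda>_. borel)
      (\<lambda>k \<omega>. \<psi> (h * real (Suc k)) ^ (N (?\<tau> (Suc k)) \<omega> - N (?\<tau> k) \<omega>)) {..<m}"
    by (rule indep_vars_compose2) simp
  then have "expectation (\<lambda>\<omega>. \<Prod>k<m. \<psi> (h * real (Suc k)) ^ (N (?\<tau> (Suc k)) \<omega> - N (?\<tau> k) \<omega>)) =
      (\<Prod>k<m. expectation (\<lambda>\<omega>. \<psi> (h * real (Suc k)) ^ (N (?\<tau> (Suc k)) \<omega> - N (?\<tau> k) \<omega>)))"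
    using assms by (intro indep_vars_lebesgue_integral increment_generating_function(2))
      (auto intro!: mult_strict_right_mono)
  also have "\<dots> = (\<Prod>k<m. exp (h * (\<psi> (h * real (Suc k)) - 1)))"
  proof (intro prod.cong refl)
    fix k
    have "?\<tau> (Suc k) - ?\<tau> k = h" by (simp add: algebra_simps)
    then show "expectation (\<lambda>\<omega>. \<psi> (h * real (Suc k)) ^ (N (?\<tau> (Suc k)) \<omega> - N (?\<tau> k) \<omega>)) =
        exp (h * (\<psi> (h * real (Suc k)) - 1))"
      using increment_generating_function(1)[of "?\<tau> k" "?\<tau> (Suc k)" "\<psi> (h * real (Suc k))"] assms
      by (auto simp del: of_nat_Suc)
  qed
  finally show ?thesis by (simp add: exp_sum)
qed

text \<open>The formula for the Laplace functional of the Poisson process. It holds on a grid, and rounding up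
  to the grid becomes harmless as the mesh tends to zero, since \<open>\<psi>\<close> is continuous at the arrival times,
  which are positive.\<close>

lemma expectation_product_until:
  fixes \<psi> :: "real \<Rightarrow> real"
  assumes [measurable]: "\<psi> \<in> borel_measurable borel"
    and bound: "\<And>x. \<bar>\<psi> x\<bar> \<le> 1"
    and cont: "\<And>x. x > 0 \<Longrightarrow> isCont \<psi> x"
    and "s > 0"
  shows "expectation (\<lambda>\<omega>. \<Prod>i<N s \<omega>. \<psi> (\<Gamma> i \<omega>)) = exp (LBINT x:{0<..s}. \<psi> x - 1)"
proof -
  \<comment> \<open>The mesh divides \<open>s\<close>, so that the grid cells fill \<open>(0, s]\<close> exactly.\<close>
  define h where "h m = s / real (Suc m)" for m
  have h: "h m > 0" "real (Suc m) * h m = s" for m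
    using \<open>s > 0\<close> by (auto simp: h_def)
  have h0: "h \<longlonglongrightarrow> 0"
    unfolding h_def by real_asymp
  define G where "G m x = h m * of_int \<lceil>x / h m\<rceil>" for m x
  have G_lim: "(\<lambda>m. G m x) \<longlonglongrightarrow> x" for x
  proof (rule tendsto_sandwich[where f = "\<lambda>_. x" and h = "\<lambda>m. x + h m"])
    show "eventually (\<lambda>m. x \<le> G m x) sequentially"
    proof (intro always_eventually allI)
      fix m
      show "x \<le> G m x"
        unfolding G_def using h(1)[of m] mult_left_mono[OF le_of_int_ceiling[of "x / h m"], of "h m"]
        by simp
    qed
    show "eventually (\<lambda>m. G m x \<le> x + h m) sequentially"
    proof (intro always_eventually allI)
      fix m
      have "of_int \<lceil>x / h m\<rceil> \<le> x / h m + 1" by linarith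
      then have "h m * of_int \<lceil>x / h m\<rceil> \<le> h m * (x / h m + 1)"
        using h(1)[of m] by (intro mult_left_mono) auto
      then show "G m x \<le> x + h m"
        using h(1)[of m] by (simp add: G_def distrib_left)
    qed
    show "(\<lambda>m. x + h m) \<longlonglongrightarrow> x"
      using tendsto_add[OF tendsto_const h0, of x] by simp
  qed simp
  have [measurable]: "G m \<in> borel_measurable borel" for m
    unfolding G_def by measurable
  have \<psi>_lim: "(\<lambda>m. \<psi> (G m x)) \<longlonglongrightarrow> \<psi> x" if "x > 0" for x
    using isCont_tendsto_compose[OF cont[OF that] G_lim] .
  have [measurable]: "N s \<in> measurable M (count_space UNIV)"
    using \<open>s > 0\<close> by (intro count_measurable) simp
  have mprod[measurable]: "(\<lambda>\<omega>. \<Prod>i<N s \<omega>. f (\<Gamma> i \<omega>)) \<in> borel_measurable M"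
    if [measurable]: "f \<in> borel_measurable borel" for f :: "real \<Rightarrow> real"
    by (rule measurable_compose_countable[of "\<lambda>n \<omega>. \<Prod>i<n. f (\<Gamma> i \<omega>)"]) measurable
  have "(\<lambda>m. expectation (\<lambda>\<omega>. \<Prod>i<N s \<omega>. \<psi> (G m (\<Gamma> i \<omega>)))) \<longlonglongrightarrow> expectation (\<lambda>\<omega>. \<Prod>i<N s \<omega>. \<psi> (\<Gamma> i \<omega>))"
  proof (rule integral_dominated_convergence[where w = "\<lambda>_. 1"])
    show "AE \<omega> in M. (\<lambda>m. \<Prod>i<N s \<omega>. \<psi> (G m (\<Gamma> i \<omega>))) \<longlonglongrightarrow> (\<Prod>i<N s \<omega>. \<psi> (\<Gamma> i \<omega>))"
      using AE_arrivals by eventually_elim (intro tendsto_prod \<psi>_lim, simp)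
    show "AE \<omega> in M. norm (\<Prod>i<N s \<omega>. \<psi> (G m (\<Gamma> i \<omega>))) \<le> 1" for m
      using bound by (auto simp: abs_prod intro!: prod_le_1)
    show "(\<lambda>\<omega>. \<Prod>i<N s \<omega>. \<psi> (G m (\<Gamma> i \<omega>))) \<in> borel_measurable M" for m
      using mprod[of "\<lambda>x. \<psi> (G m x)"] by measurable
  qed measurable
  moreover have "expectation (\<lambda>\<omega>. \<Prod>i<N s \<omega>. \<psi> (G m (\<Gamma> i \<omega>))) = exp (LBINT x:{0<..s}. \<psi> (G m x) - 1)" for m
  proof -
    have [measurable]: "N (real k * h m) \<in> measurable M (count_space UNIV)" for k
      using h(1)[of m] by (intro count_measurable) (auto intro!: mult_nonneg_nonneg less_imp_le)
    have ae: "AE \<omega> in M. (\<Prod>i<N s \<omega>. \<psi> (G m (\<Gamma> i \<omega>))) =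
       (\<Prod>k<Suc m. \<psi> (h m * real (Suc k)) ^ (N (real (Suc k) * h m) \<omega> - N (real k * h m) \<omega>))"
      using AE_arrivals count_paths
    proof eventually_elim
      case (elim \<omega>)
      then show ?case
        using count_product_grid[OF h(1)[of m], where g = "\<lambda>i. \<Gamma> i \<omega>" and n = "\<lambda>t. N t \<omega>" and m = "Suc m" and \<psi> = \<psi>] h(2)[of m]
        unfolding G_def by (auto simp del: prod.lessThan_Suc of_nat_Suc)
    qed
    have "expectation (\<lambda>\<omega>. \<Prod>i<N s \<omega>. \<psi> (G m (\<Gamma> i \<omega>))) =
       expectation (\<lambda>\<omega>. \<Prod>k<Suc m. \<psi> (h m * real (Suc k)) ^ (N (real (Suc k) * h m) \<omega> - N (real k * h m) \<omega>))"
      by (rule integral_cong_AE[OF mprod _ ae]) measurable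
    also have "\<dots> = exp (\<Sum>k<Suc m. h m * (\<psi> (h m * real (Suc k)) - 1))"
      by (rule grid_product_expectation[OF h(1)])
    also have "\<dots> = exp (LBINT x:{0<..s}. \<psi> (G m x) - 1)"
      using grid_integral(2)[OF h(1)[of m], where m = "Suc m" and f = "\<lambda>x. \<psi> x - 1"] unfolding h(2) G_def by simp
    finally show ?thesis .
  qed
  moreover have "(\<lambda>m. exp (LBINT x:{0<..s}. \<psi> (G m x) - 1)) \<longlonglongrightarrow> exp (LBINT x:{0<..s}. \<psi> x - 1)"
    unfolding set_lebesgue_integral_def
  proof (intro tendsto_exp integral_dominated_convergence[where w = "\<lambda>x. 2 * indicator {0<..s} x"])
    show "AE x in lborel. (\<lambda>m. indicator {0<..s} x *\<^sub>R (\<psi> (G m x) - 1)) \<longlonglongrightarrow> indicator {0<..s} x *\<^sub>R (\<psi> x - 1)"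
      using \<psi>_lim by (auto simp: indicator_def intro!: tendsto_intros)
    have "\<bar>\<psi> x - 1\<bar> \<le> 2" for x using bound[of x] by linarith
    then show "AE x in lborel. norm (indicator {0<..s} x *\<^sub>R (\<psi> (G m x) - 1)) \<le> 2 * indicator {0<..s} x" for m
      by (auto simp: indicator_def)
  qed (use \<open>s > 0\<close> in \<open>auto intro!: integrable_mult_right integrable_real_indicator\<close>)
  ultimately show ?thesis
    using LIMSEQ_unique by auto
qed

text \<open>The products over the first \<open>n\<close> arrivals and over the arrivals up to time \<open>s\<close> are partial products
  of one infinite product. It converges because the factors of late arrivals are close to 1 and at
  most 1, so that the modulus of the partial products is eventually monotone. The latter products have
  a known expectation; the former are those that the partial sums of a series produce.\<close>

lemma expectation_product_arrivals:
  fixes \<psi> :: "real \<Rightarrow> real"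
  assumes [measurable]: "\<psi> \<in> borel_measurable borel"
    and bound: "\<And>x. \<bar>\<psi> x\<bar> \<le> 1"
    and cont: "\<And>x. x > 0 \<Longrightarrow> isCont \<psi> x"
    and lim: "(\<psi> \<longlongrightarrow> 1) at_top"
    and int: "set_integrable lborel {0<..} (\<lambda>x. 1 - \<psi> x)"
  shows "(\<lambda>n. expectation (\<lambda>\<omega>. \<Prod>i<n. \<psi> (\<Gamma> i \<omega>))) \<longlonglongrightarrow> exp (- (LBINT x:{0<..}. 1 - \<psi> x))"
proof -
  define Q where "Q n \<omega> = (\<Prod>i<n. \<psi> (\<Gamma> i \<omega>))" for n \<omega>
  define L where "L \<omega> = lim (\<lambda>n. Q n \<omega>)" for \<omega>
  have [measurable]: "Q n \<in> borel_measurable M" for n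
    unfolding Q_def by measurable
  have [measurable]: "L \<in> borel_measurable M"
    unfolding L_def by measurable
  have Q_bound: "norm (Q n \<omega>) \<le> 1" for n \<omega>
    unfolding Q_def using bound by (auto simp: abs_prod intro!: prod_le_1)
  have Q_lim: "AE \<omega> in M. (\<lambda>n. Q n \<omega>) \<longlonglongrightarrow> L \<omega>"
    using AE_arrivals
  proof eventually_elim
    case (elim \<omega>)
    have "filterlim (\<lambda>i. \<Gamma> i \<omega>) at_top sequentially"
      unfolding filterlim_at_top
    proof
      fix Z :: real
      have "Z \<le> \<Gamma> i \<omega>" if "i \<ge> N (max 0 Z) \<omega>" for i
        using elim that by (metis linorder_not_less max.cobounded2 nle_le order_trans)
      then show "eventually (\<lambda>i. Z \<le> \<Gamma> i \<omega>) sequentially"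
        by (auto simp: eventually_sequentially)
    qed
    then have "(\<lambda>i. \<psi> (\<Gamma> i \<omega>)) \<longlonglongrightarrow> 1"
      by (rule filterlim_compose[OF lim])
    then have "eventually (\<lambda>i. 0 \<le> \<psi> (\<Gamma> i \<omega>)) sequentially"
      by (rule eventually_mono[OF order_tendstoD(1)[of _ 1 sequentially 0]]) auto
    then have "convergent (\<lambda>n. Q n \<omega>)"
      unfolding Q_def by (intro convergent_product_eventually_nonneg bound)
    then show ?case
      by (simp add: L_def convergent_LIMSEQ_iff)
  qed
  have lim_L: "(\<lambda>n. expectation (Q n)) \<longlonglongrightarrow> expectation L"
    by (rule integral_dominated_convergence[where w = "\<lambda>_. 1"]) (use Q_lim Q_bound in auto)
  have N_meas[measurable]: "N (real (Suc k)) \<in> measurable M (count_space UNIV)" for k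
    by (rule count_measurable) simp
  have mQ[measurable]: "(\<lambda>\<omega>. Q (N (real (Suc k)) \<omega>) \<omega>) \<in> borel_measurable M" for k
    by (rule measurable_compose_countable[of "\<lambda>n \<omega>. Q n \<omega>"]) (simp_all del: of_nat_Suc add: N_meas)
  have lim_N: "(\<lambda>k. expectation (\<lambda>\<omega>. Q (N (real (Suc k)) \<omega>) \<omega>)) \<longlonglongrightarrow> expectation L"
  proof (rule integral_dominated_convergence[where w = "\<lambda>_. 1"])
    show "AE \<omega> in M. (\<lambda>k. Q (N (real (Suc k)) \<omega>) \<omega>) \<longlonglongrightarrow> L \<omega>"
      using Q_lim AE_arrivals
    proof eventually_elim
      case (elim \<omega>)
      have "filterlim (\<lambda>k. N (real (Suc k)) \<omega>) sequentially sequentially"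
        unfolding filterlim_at_top
      proof
        fix Z :: nat
        have "Z \<le> N (real (Suc k)) \<omega>" if "k \<ge> nat \<lceil>\<Gamma> Z \<omega>\<rceil>" for k
        proof -
          have "\<Gamma> Z \<omega> \<le> real (Suc k)" using that by linarith
          then show ?thesis using elim(2)[THEN conjunct2, rule_format, of "real (Suc k)" Z] by simp
        qed
        then show "eventually (\<lambda>k. Z \<le> N (real (Suc k)) \<omega>) sequentially"
          unfolding eventually_sequentially by blast
      qed
      then show ?case by (rule filterlim_compose[OF elim(1)])
    qed
  qed (use Q_bound mQ in auto)
  have eq: "expectation (\<lambda>\<omega>. Q (N (real (Suc k)) \<omega>) \<omega>) = exp (LBINT x:{0<..real (Suc k)}. \<psi> x - 1)" for k
    unfolding Q_def by (rule expectation_product_until) (use bound cont in auto)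
  have lim_exp: "(\<lambda>k. exp (LBINT x:{0<..real (Suc k)}. \<psi> x - 1)) \<longlonglongrightarrow> exp (- (LBINT x:{0<..}. 1 - \<psi> x))"
  proof (rule tendsto_exp)
    have "(\<lambda>k. LBINT x:{0<..real (Suc k)}. \<psi> x - 1) \<longlonglongrightarrow> (LBINT x:{0<..}. \<psi> x - 1)"
      unfolding set_lebesgue_integral_def
    proof (rule integral_dominated_convergence[where w = "\<lambda>x. \<bar>indicator {0<..} x *\<^sub>R (1 - \<psi> x)\<bar>"])
      show "integrable lborel (\<lambda>x. \<bar>indicator {0<..} x *\<^sub>R (1 - \<psi> x)\<bar>)"
        using int unfolding set_integrable_def by (rule integrable_abs)
      show "AE x in lborel. (\<lambda>k. indicator {0<..real (Suc k)} x *\<^sub>R (\<psi> x - 1)) \<longlonglongrightarrow> indicator {0<..} x *\<^sub>R (\<psi> x - 1)"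
      proof (intro AE_I2 tendsto_eventually)
        fix x :: real
        have "indicator {0<..real (Suc k)} x = (indicator {0<..} x :: real)" if "k \<ge> nat \<lceil>x\<rceil>" for k
          using that by (auto simp: indicator_def)
        then show "eventually (\<lambda>k. indicator {0<..real (Suc k)} x *\<^sub>R (\<psi> x - 1) = indicator {0<..} x *\<^sub>R (\<psi> x - 1)) sequentially"
          unfolding eventually_sequentially by metis
      qed
    qed (auto simp: indicator_def)
    also have "(LBINT x:{0<..}. \<psi> x - 1) = - (LBINT x:{0<..}. 1 - \<psi> x)"
    proof -
      have "(\<lambda>x. indicator {0<..} x *\<^sub>R (\<psi> x - 1)) = (\<lambda>x. - (indicator {0<..} x *\<^sub>R (1 - \<psi> x)))"
        by (simp add: fun_eq_iff algebra_simps)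
      then show ?thesis
        unfolding set_lebesgue_integral_def by (simp only: Bochner_Integration.integral_minus)
    qed
    finally show "(\<lambda>k. LBINT x:{0<..real (Suc k)}. \<psi> x - 1) \<longlonglongrightarrow> - (LBINT x:{0<..}. 1 - \<psi> x)" .
  qed
  have "expectation L = exp (- (LBINT x:{0<..}. 1 - \<psi> x))"
    using LIMSEQ_unique[OF lim_N lim_exp[folded eq]] .
  with lim_L show ?thesis
    by (simp add: Q_def[abs_def])
qed

end

section \<open>The stable constant\<close>

lemma set_integrable_powr_split:
  fixes a :: real
  assumes "1 < a" "a < 2"
  shows "set_integrable lborel {0<..1} (\<lambda>y. y powr (1 - a))" "set_integrable lborel {1<..} (\<lambda>y. y powr (- a))"
proof -
  have "(\<lambda>y::real. y powr (1 - a)) absolutely_integrable_on {0..1}"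
    using has_integral_powr_from_0[of "1 - a" 1] assms
    by (intro nonnegative_absolutely_integrable_1) (auto simp: integrable_on_def)
  then have "set_integrable lebesgue {0<..1} (\<lambda>y::real. y powr (1 - a))"
    by (rule set_integrable_subset) auto
  then show "set_integrable lborel {0<..1} (\<lambda>y. y powr (1 - a))"
    unfolding set_integrable_def by (subst (asm) integrable_completion) auto
  have "(\<lambda>y::real. y powr (- a)) absolutely_integrable_on {1..}"
    using has_integral_powr_to_inf[of "-a" 1] assms
    by (intro nonnegative_absolutely_integrable_1) (auto simp: integrable_on_def)
  then have "set_integrable lebesgue {1<..} (\<lambda>y::real. y powr (- a))"
    by (rule set_integrable_subset) auto
  then show "set_integrable lborel {1<..} (\<lambda>y. y powr (- a))"
    unfolding set_integrable_def by (subst (asm) integrable_completion) auto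
qed

text \<open>At 0 the sine gains one power of \<open>y\<close>, which makes \<open>a < 2\<close> sufficient; at infinity \<open>a > 1\<close> is.\<close>

lemma set_integrable_sin_powr:
  fixes a :: real
  assumes "1 < a" "a < 2"
  shows "set_integrable lborel {0<..} (\<lambda>y. y powr (- a) * sin y)"
proof -
  have "set_integrable lborel {0<..1} (\<lambda>y. y powr (- a) * sin y)"
  proof (rule set_integrable_bound[OF set_integrable_powr_split(1)[OF assms]])
    have "norm (y powr (- a) * sin y) \<le> y powr (1 - a)" if "0 < y" for y
    proof -
      have "\<bar>y powr (- a) * sin y\<bar> \<le> y powr (- a) * y"
        using abs_sin_x_le_abs_x[of y] that by (simp add: abs_mult mult_left_mono)
      also have "\<dots> = y powr (1 - a)"
        using that by (simp add: powr_diff powr_minus field_simps)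
      finally show ?thesis by simp
    qed
    then show "AE y in lborel. y \<in> {0<..1} \<longrightarrow> norm (y powr (- a) * sin y) \<le> norm (y powr (1 - a))"
      by auto
  qed (auto simp: set_borel_measurable_def)
  moreover have "set_integrable lborel {1<..} (\<lambda>y. y powr (- a) * sin y)"
  proof (rule set_integrable_bound[OF set_integrable_powr_split(2)[OF assms]])
    show "AE y in lborel. y \<in> {1<..} \<longrightarrow> norm (y powr (- a) * sin y) \<le> norm (y powr (- a))"
      by (auto simp: abs_mult mult_left_le)
  qed (auto simp: set_borel_measurable_def)
  ultimately have "set_integrable lborel ({0<..1} \<union> {1<..}) (\<lambda>y. y powr (- a) * sin y)"
    by (intro set_integrable_Un) auto
  also have "{0<..1} \<union> {1<..} = {(0::real)<..}" by auto
  finally show ?thesis .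
qed

lemma integral_sin_interval:
  fixes R :: real
  assumes "0 \<le> R"
  shows "(LBINT y:{0<..<R}. sin y) = 1 - cos R"
proof -
  have "(LBINT y. sin y * indicator {0..R} y) = - cos R - - cos 0"
    using \<open>0 \<le> R\<close> by (intro integral_FTC_Icc_real[of 0 R "\<lambda>y. - cos y"]) (auto intro!: derivative_eq_intros)
  moreover have "(LBINT y. sin y * indicator {0..R} y) = (LBINT y. indicator {0<..<R} y *\<^sub>R sin y)"
    using AE_lborel_singleton[of 0] AE_lborel_singleton[of R]
    by (intro integral_cong_AE) (auto simp: indicator_def)
  ultimately show ?thesis by (simp add: set_lebesgue_integral_def)
qed

text \<open>With \<open>R = A * x powr (- (1 / a))\<close> write \<open>1 - cos R\<close> as the integral of the sine over \<open>(0, R)\<close> and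
  exchange the integrals: for fixed \<open>y\<close> the condition \<open>y < R\<close> describes an interval of length
  \<open>A powr a * y powr (- a)\<close> in \<open>x\<close>. This does a substitution and an integration by parts in a single
  step that is absolutely convergent.\<close>

lemma cos_layer_cake:
  fixes a A :: real
  assumes "1 < a" "a < 2" "A \<ge> 0"
  shows "set_integrable lborel {0<..} (\<lambda>x. 1 - cos (A * x powr (- (1 / a))))"
    and "(LBINT x:{0<..}. 1 - cos (A * x powr (- (1 / a)))) = A powr a * (LBINT y:{0<..}. y powr (- a) * sin y)"
proof -
  define D where "D = {p :: real \<times> real. 0 < fst p \<and> 0 < snd p \<and> fst p < A * snd p powr (- (1 / a))}"
  define F where "F p = indicator D p * sin (fst p)" for p :: "real \<times> real"
  have [measurable]: "D \<in> sets (lborel \<Otimes>\<^sub>M lborel)"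
  proof -
    have "Measurable.pred (lborel \<Otimes>\<^sub>M lborel) (\<lambda>p :: real \<times> real. 0 < fst p \<and> 0 < snd p \<and> fst p < A * snd p powr (- (1 / a)))"
      by measurable
    then show ?thesis unfolding D_def pred_def by (simp add: space_pair_measure)
  qed
  have [measurable]: "F \<in> borel_measurable (lborel \<Otimes>\<^sub>M lborel)"
    unfolding F_def by measurable
  have D_iff: "(y, x) \<in> D \<longleftrightarrow> 0 < y \<and> x \<in> {0<..<A powr a * y powr (- a)}" for y x
  proof (cases "0 < x \<and> 0 < y")
    case True
    have "y < A * x powr (- (1 / a)) \<longleftrightarrow> x powr (1 / a) < A / y"
      using True by (simp add: powr_minus field_simps)
    also have "\<dots> \<longleftrightarrow> x < (A / y) powr a"
    proof
      assume *: "x powr (1 / a) < A / y"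
      have "(x powr (1 / a)) powr a < (A / y) powr a"
        using * assms by (intro powr_less_mono2) auto
      then show "x < (A / y) powr a"
        using True assms by (simp add: powr_powr)
    next
      assume *: "x < (A / y) powr a"
      have "x powr (1 / a) < ((A / y) powr a) powr (1 / a)"
        using * True assms by (intro powr_less_mono2) auto
      then show "x powr (1 / a) < A / y"
        using True assms by (simp add: powr_powr)
    qed
    also have "(A / y) powr a = A powr a * y powr (- a)"
      using True assms by (simp add: powr_divide powr_minus field_simps)
    finally show ?thesis using True by (auto simp: D_def)
  qed (auto simp: D_def)
  have inner_x: "(LBINT x. indicator D (y, x) * c) = indicator {0<..} y * (A powr a * y powr (- a)) * c" for y c :: real
  proof -
    have "(LBINT x. indicator D (y, x) * c) = (LBINT x. indicator {0<..} y * indicator {0<..<A powr a * y powr (- a)} x * c)"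
      by (intro Bochner_Integration.integral_cong) (auto simp: D_iff indicator_def)
    then show ?thesis by simp
  qed
  have int: "integrable (lborel \<Otimes>\<^sub>M lborel) F"
  proof (rule lborel_pair.Fubini_integrable)
    have "(LBINT x. norm (F (y, x))) = A powr a * \<bar>indicator {0<..} y *\<^sub>R (y powr (- a) * sin y)\<bar>" for y
      using inner_x[of y "\<bar>sin y\<bar>"] by (simp add: F_def abs_mult mult_ac)
    moreover have "integrable lborel (\<lambda>y. A powr a * \<bar>indicator {0<..} y *\<^sub>R (y powr (- a) * sin y)\<bar>)"
      using set_integrable_sin_powr[OF assms(1,2)] unfolding set_integrable_def
      by (intro integrable_mult_right integrable_abs)
    ultimately show "integrable lborel (\<lambda>y. LBINT x. norm (F (y, x)))" by simp
    have "integrable lborel (\<lambda>x. F (y, x))" for y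
    proof -
      have "F (y, x) = (indicator {0<..} y * sin y) * indicator {0<..<A powr a * y powr (- a)} x" for x
        by (auto simp: F_def D_iff indicator_def)
      then show ?thesis by (simp add: integrable_real_indicator)
    qed
    then show "AE y in lborel. integrable lborel (\<lambda>x. F (y, x))" by simp
  qed simp
  have inner_y: "(LBINT y. F (y, x)) = indicator {0<..} x *\<^sub>R (1 - cos (A * x powr (- (1 / a))))" for x
  proof (cases "0 < x")
    case True
    then have "(LBINT y. F (y, x)) = (LBINT y:{0<..<A * x powr (- (1 / a))}. sin y)"
      unfolding set_lebesgue_integral_def F_def
      by (intro Bochner_Integration.integral_cong) (auto simp: D_def indicator_def)
    then show ?thesis
      using integral_sin_interval[of "A * x powr (- (1 / a))"] True assms by simp
  next
    case False
    then show ?thesis by (simp add: F_def D_def)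
  qed
  show "set_integrable lborel {0<..} (\<lambda>x. 1 - cos (A * x powr (- (1 / a))))"
    using lborel_pair.integrable_snd[of "\<lambda>y x. F (y, x)"] int
    unfolding set_integrable_def inner_y[symmetric] by (simp add: case_prod_beta')
  have "(LBINT x. LBINT y. F (y, x)) = (LBINT y. LBINT x. F (y, x))"
    using lborel_pair.Fubini_integral[of "\<lambda>y x. F (y, x)"] int by (simp add: case_prod_beta')
  also have "(LBINT y. LBINT x. F (y, x)) = (LBINT y. A powr a * (indicator {0<..} y *\<^sub>R (y powr (- a) * sin y)))"
    by (intro Bochner_Integration.integral_cong refl) (use inner_x[of _ "sin _"] in \<open>simp add: F_def mult_ac\<close>)
  finally show "(LBINT x:{0<..}. 1 - cos (A * x powr (- (1 / a)))) = A powr a * (LBINT y:{0<..}. y powr (- a) * sin y)"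
    by (simp add: inner_y set_lebesgue_integral_def)
qed

text \<open>The integral equals that of \<open>1 - cos (x powr (- (1 / a)))\<close>, which is nonnegative, and positive
  for \<open>1 < x < 2\<close>.\<close>

lemma sin_powr_integral_pos:
  fixes a :: real
  assumes "1 < a" "a < 2"
  shows "(LBINT y:{0<..}. y powr (- a) * sin y) > 0"
proof -
  let ?g = "\<lambda>x. 1 - cos (1 * x powr (- (1 / a)))"
  have "(LBINT x:{0<..}. ?g x) \<noteq> 0"
  proof
    assume "(LBINT x:{0<..}. ?g x) = 0"
    then have "AE x in lborel. indicator {0<..} x *\<^sub>R ?g x = 0"
      using cos_layer_cake(1)[OF assms, of 1] unfolding set_lebesgue_integral_def set_integrable_def
      by (subst (asm) integral_nonneg_eq_0_iff_AE) auto
    then have "AE x in lborel. x \<notin> {1<..<2::real}"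
    proof eventually_elim
      case (elim x)
      show ?case
      proof
        assume x: "x \<in> {1<..<2}"
        then have "0 < x powr (- (1 / a))" "x powr (- (1 / a)) < 1"
          using assms by (auto simp: powr_less_one)
        then have "0 < x powr (- (1 / a))" "x powr (- (1 / a)) \<le> pi"
          using pi_gt3 by auto
        then have "cos (x powr (- (1 / a))) < cos 0"
          by (intro cos_monotone_0_pi) auto
        with elim x show False by simp
      qed
    qed
    then have "emeasure lborel {1<..<2::real} = 0"
      by (subst (asm) AE_iff_measurable[where N = "{1<..<2}"]) auto
    then show False by simp
  qed
  moreover have "(LBINT x:{0<..}. ?g x) \<ge> 0"
    unfolding set_lebesgue_integral_def by (intro Bochner_Integration.integral_nonneg) auto
  moreover have "(LBINT x:{0<..}. ?g x) = (LBINT y:{0<..}. y powr (- a) * sin y)"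
    using cos_layer_cake(2)[OF assms, of 1] by simp
  ultimately show ?thesis by linarith
qed

section \<open>The LePage series\<close>

lemma pred_summable[measurable (raw)]:
  fixes f :: "nat \<Rightarrow> 'a \<Rightarrow> real"
  assumes [measurable]: "\<And>i. f i \<in> borel_measurable M"
  shows "Measurable.pred M (\<lambda>x. summable (\<lambda>i. f i x))"
proof -
  have "{x \<in> space M. Cauchy (\<lambda>n. \<Sum>i<n. f i x)} \<in> sets M"
    by measurable
  then show ?thesis
    by (simp add: pred_def summable_iff_convergent Cauchy_convergent_iff)
qed

abbreviation sequence_space :: "(nat \<Rightarrow> real) measure" where
  "sequence_space \<equiv> \<Pi>\<^sub>M i\<in>UNIV. borel"

locale poisson_sign_series =
  rademacher_sequence M \<epsilon> + poisson_arrivals M N \<Gamma>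
  for M :: "'w measure" and \<epsilon> :: "nat \<Rightarrow> 'w \<Rightarrow> real"
    and N :: "real \<Rightarrow> 'w \<Rightarrow> nat" and \<Gamma> :: "nat \<Rightarrow> 'w \<Rightarrow> real" +
  fixes V :: "nat \<Rightarrow> 'w \<Rightarrow> real"
  assumes indep_marks: "indep_vars (\<lambda>_. borel) V UNIV"
    and marks_identical: "\<And>i. distr M borel (V i) = distr M borel (V 0)"
    and indep_sequences:
      "indep_vars (\<lambda>_. sequence_space) (\<lambda>k \<omega> i. ([\<Gamma>, V, \<epsilon>] ! k) i \<omega>) {0, 1, 2}"
begin

lemma mark_measurable[measurable]: "V i \<in> borel_measurable M"
  using indep_marks unfolding indep_vars_def2 by blast

text \<open>The part of the randomness that is held fixed when the signs are averaged.\<close>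

definition data :: "'w \<Rightarrow> (nat \<Rightarrow> real) \<times> (nat \<Rightarrow> real)" where
  "data \<omega> = (\<lambda>i. \<Gamma> i \<omega>, \<lambda>i. V i \<omega>)"

lemma data_measurable[measurable]: "data \<in> measurable M (sequence_space \<Otimes>\<^sub>M sequence_space)"
  unfolding data_def by (intro measurable_Pair measurable_PiM_single') auto

lemma signs_measurable[measurable]: "(\<lambda>\<omega> i. \<epsilon> i \<omega>) \<in> measurable M sequence_space"
  by (intro measurable_PiM_single') auto

text \<open>Independence of two random elements requires a common type of values, whence both sides are
  families of sequences here; the components are projected out afterwards.\<close>

lemma indep_data_signs:
  "indep_var (\<Pi>\<^sub>M k\<in>{0, 1}. sequence_space) (\<lambda>\<omega>. \<lambda>k\<in>{0, 1}. \<lambda>i. ([\<Gamma>, V, \<epsilon>] ! k) i \<omega>)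
    (\<Pi>\<^sub>M k\<in>{2}. sequence_space) (\<lambda>\<omega>. \<lambda>k\<in>{2}. \<lambda>i. ([\<Gamma>, V, \<epsilon>] ! k) i \<omega>)"
  by (rule indep_var_restrict[OF indep_sequences]) auto

lemma split_data_measurable:
  "(\<lambda>(x, y). ((x 0, x 1), y 2)) \<in>
    (\<Pi>\<^sub>M k\<in>{0, 1 :: nat}. sequence_space) \<Otimes>\<^sub>M (\<Pi>\<^sub>M k\<in>{2 :: nat}. sequence_space) \<rightarrow>\<^sub>M
    (sequence_space \<Otimes>\<^sub>M sequence_space) \<Otimes>\<^sub>M sequence_space"
  unfolding case_prod_beta'
  by (intro measurable_Pair measurable_compose[OF measurable_fst] measurable_compose[OF measurable_snd]
      measurable_component_singleton) auto

lemma integral_freeze_data: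
  fixes F :: "_ \<Rightarrow> 'c :: {banach, second_countable_topology}"
  assumes F: "F \<in> borel_measurable ((sequence_space \<Otimes>\<^sub>M sequence_space) \<Otimes>\<^sub>M sequence_space)"
    and "\<And>p. norm (F p) \<le> B"
  shows "(LINT \<omega>|M. F (data \<omega>, \<lambda>i. \<epsilon> i \<omega>)) = (LINT \<omega>|M. LINT \<omega>'|M. F (data \<omega>, \<lambda>i. \<epsilon> i \<omega>'))"
  using integral_freeze[OF indep_data_signs measurable_compose[OF split_data_measurable F], of B] assms(2)
  by (simp add: data_def)

lemma AE_freeze_data:
  assumes P: "Measurable.pred ((sequence_space \<Otimes>\<^sub>M sequence_space) \<Otimes>\<^sub>M sequence_space) P"
    and "AE \<omega> in M. AE \<omega>' in M. P (data \<omega>, \<lambda>i. \<epsilon> i \<omega>')"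
  shows "AE \<omega> in M. P (data \<omega>, \<lambda>i. \<epsilon> i \<omega>)"
  using AE_freeze[OF indep_data_signs measurable_compose[OF split_data_measurable P]] assms(2)
  by (simp add: data_def)

lemma indep_arrivals_marks:
  "indep_var sequence_space (\<lambda>\<omega> i. \<Gamma> i \<omega>) sequence_space (\<lambda>\<omega> i. V i \<omega>)"
proof -
  let ?X = "\<lambda>k \<omega> i. ([\<Gamma>, V, \<epsilon>] ! k) i \<omega>"
  have "indep_var (PiM {0} (\<lambda>_. sequence_space)) (\<lambda>\<omega>. restrict (\<lambda>k. ?X k \<omega>) {0})
      (PiM {1} (\<lambda>_. sequence_space)) (\<lambda>\<omega>. restrict (\<lambda>k. ?X k \<omega>) {1})"
    by (rule indep_var_restrict[OF indep_sequences]) auto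
  then have "indep_var sequence_space ((\<lambda>x. x 0) \<circ> (\<lambda>\<omega>. restrict (\<lambda>k. ?X k \<omega>) {0}))
      sequence_space ((\<lambda>x. x 1) \<circ> (\<lambda>\<omega>. restrict (\<lambda>k. ?X k \<omega>) {1}))"
    by (rule indep_var_compose) (auto intro!: measurable_component_singleton)
  then show ?thesis
    by (simp add: comp_def)
qed

lemma AE_summable_series:
  assumes [measurable]: "\<And>i. A i \<in> borel_measurable (sequence_space \<Otimes>\<^sub>M sequence_space)"
    and "AE \<omega> in M. summable (\<lambda>i. (A i (data \<omega>))\<^sup>2)"
  shows "AE \<omega> in M. summable (\<lambda>i. \<epsilon> i \<omega> * A i (data \<omega>))"
proof -
  have "AE \<omega> in M. (\<lambda>(x, e). summable (\<lambda>i. e i * A i x)) (data \<omega>, \<lambda>i. \<epsilon> i \<omega>)"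
  proof (rule AE_freeze_data)
    show "Measurable.pred ((sequence_space \<Otimes>\<^sub>M sequence_space) \<Otimes>\<^sub>M sequence_space) (\<lambda>(x, e). summable (\<lambda>i. e i * A i x))"
      by measurable
    show "AE \<omega> in M. AE \<omega>' in M. (\<lambda>(x, e). summable (\<lambda>i. e i * A i x)) (data \<omega>, \<lambda>i. \<epsilon> i \<omega>')"
      using assms(2) by eventually_elim (simp add: AE_summable_signs)
  qed
  then show ?thesis by simp
qed

text \<open>Chebyshev's inequality given the arrivals and the marks, on the event that the conditional
  variance is at most \<open>\<kappa>\<close>.\<close>

lemma prob_series_ge:
  assumes [measurable]: "\<And>i. A i \<in> borel_measurable (sequence_space \<Otimes>\<^sub>M sequence_space)"
    and "\<delta> > 0" "\<kappa> \<ge> 0"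
  shows "prob {\<omega> \<in> space M. \<delta> \<le> \<bar>\<Sum>i. \<epsilon> i \<omega> * A i (data \<omega>)\<bar>} \<le>
    prob {\<omega> \<in> space M. \<not> (summable (\<lambda>i. (A i (data \<omega>))\<^sup>2) \<and> (\<Sum>i. (A i (data \<omega>))\<^sup>2) \<le> \<kappa>)} + 4 * \<kappa> / \<delta>\<^sup>2"
    (is "prob ?E \<le> prob ?B + _")
proof -
  define F :: "((nat \<Rightarrow> real) \<times> (nat \<Rightarrow> real)) \<times> (nat \<Rightarrow> real) \<Rightarrow> real"
    where "F p = (if \<delta> \<le> \<bar>\<Sum>i. snd p i * A i (fst p)\<bar> then 1 else 0)" for p
  have [measurable]: "F \<in> borel_measurable ((sequence_space \<Otimes>\<^sub>M sequence_space) \<Otimes>\<^sub>M sequence_space)"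
    unfolding F_def by measurable
  have inner: "(LINT \<omega>'|M. F (data \<omega>, \<lambda>i. \<epsilon> i \<omega>')) = prob {\<omega>' \<in> space M. \<delta> \<le> \<bar>\<Sum>i. \<epsilon> i \<omega>' * A i (data \<omega>)\<bar>}" for \<omega>
  proof -
    have "(LINT \<omega>'|M. F (data \<omega>, \<lambda>i. \<epsilon> i \<omega>')) =
        (LINT \<omega>'|M. indicator {\<omega>' \<in> space M. \<delta> \<le> \<bar>\<Sum>i. \<epsilon> i \<omega>' * A i (data \<omega>)\<bar>} \<omega>')"
      by (intro Bochner_Integration.integral_cong) (auto simp: F_def)
    then show ?thesis by simp
  qed
  have "prob ?E = (LINT \<omega>|M. F (data \<omega>, \<lambda>i. \<epsilon> i \<omega>))"
  proof -
    have "(LINT \<omega>|M. F (data \<omega>, \<lambda>i. \<epsilon> i \<omega>)) = (LINT \<omega>|M. indicator ?E \<omega>)"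
      by (intro Bochner_Integration.integral_cong) (auto simp: F_def)
    then show ?thesis by simp
  qed
  also have "\<dots> = (LINT \<omega>|M. LINT \<omega>'|M. F (data \<omega>, \<lambda>i. \<epsilon> i \<omega>'))"
    by (rule integral_freeze_data[of _ 1]) (auto simp: F_def)
  also have "\<dots> \<le> (LINT \<omega>|M. indicator ?B \<omega> + 4 * \<kappa> / \<delta>\<^sup>2)"
  proof (rule integral_mono)
    have [measurable]: "(\<lambda>\<omega>. LINT \<omega>'|M. F (data \<omega>, \<lambda>i. \<epsilon> i \<omega>')) \<in> borel_measurable M"
      by measurable
    show "integrable M (\<lambda>\<omega>. LINT \<omega>'|M. F (data \<omega>, \<lambda>i. \<epsilon> i \<omega>'))"
      by (intro integrable_const_bound[of _ 1]) (simp_all add: inner)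
    show "integrable M (\<lambda>\<omega>. indicator ?B \<omega> + 4 * \<kappa> / \<delta>\<^sup>2)"
      by (intro Bochner_Integration.integrable_add integrable_real_indicator) (auto simp: emeasure_eq_measure)
    fix \<omega> assume "\<omega> \<in> space M"
    show "(LINT \<omega>'|M. F (data \<omega>, \<lambda>i. \<epsilon> i \<omega>')) \<le> indicator ?B \<omega> + 4 * \<kappa> / \<delta>\<^sup>2"
    proof (cases "\<omega> \<in> ?B")
      case True
      have "prob {\<omega>' \<in> space M. \<delta> \<le> \<bar>\<Sum>i. \<epsilon> i \<omega>' * A i (data \<omega>)\<bar>} \<le> 1" by simp
      moreover have "0 \<le> 4 * \<kappa> / \<delta>\<^sup>2" using \<open>\<kappa> \<ge> 0\<close> by simp
      ultimately have "prob {\<omega>' \<in> space M. \<delta> \<le> \<bar>\<Sum>i. \<epsilon> i \<omega>' * A i (data \<omega>)\<bar>} \<le> 1 + 4 * \<kappa> / \<delta>\<^sup>2"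
        by linarith
      then show ?thesis unfolding inner using True by simp
    next
      case False
      then have "summable (\<lambda>i. (A i (data \<omega>))\<^sup>2)" and le: "(\<Sum>i. (A i (data \<omega>))\<^sup>2) \<le> \<kappa>"
        using \<open>\<omega> \<in> space M\<close> by auto
      then have "(LINT \<omega>'|M. F (data \<omega>, \<lambda>i. \<epsilon> i \<omega>')) \<le> 4 * (\<Sum>i. (A i (data \<omega>))\<^sup>2) / \<delta>\<^sup>2"
        unfolding inner using \<open>\<delta> > 0\<close> by (intro prob_sign_series_ge)
      also have "\<dots> \<le> 4 * \<kappa> / \<delta>\<^sup>2"
        using le by (intro divide_right_mono) auto
      finally show ?thesis using False by simp
    qed
  qed
  also have "\<dots> = prob ?B + 4 * \<kappa> / \<delta>\<^sup>2"
    by (subst Bochner_Integration.integral_add)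
       (auto intro!: integrable_real_indicator simp: prob_space emeasure_eq_measure)
  finally show ?thesis .
qed

lemma char_series_partial:
  assumes [measurable]: "\<And>i. A i \<in> borel_measurable (sequence_space \<Otimes>\<^sub>M sequence_space)"
  shows "(LINT \<omega>|M. iexp (\<Sum>i<n. \<epsilon> i \<omega> * A i (data \<omega>))) =
    complex_of_real (expectation (\<lambda>\<omega>. \<Prod>i<n. cos (A i (data \<omega>))))"
proof -
  have "(LINT \<omega>|M. (\<lambda>p. iexp (\<Sum>i<n. snd p i * A i (fst p))) (data \<omega>, \<lambda>i. \<epsilon> i \<omega>)) =
      (LINT \<omega>|M. LINT \<omega>'|M. (\<lambda>p. iexp (\<Sum>i<n. snd p i * A i (fst p))) (data \<omega>, \<lambda>i. \<epsilon> i \<omega>'))"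
    by (rule integral_freeze_data[of _ 1]) auto
  then show ?thesis
    by (simp del: of_real_sum of_real_mult of_real_prod add: char_sign_sum)
qed

lemma expectation_marks:
  fixes g :: "real \<Rightarrow> real"
  assumes "g \<in> borel_measurable borel"
  shows "expectation (\<lambda>\<omega>. g (V i \<omega>)) = expectation (\<lambda>\<omega>. g (V 0 \<omega>))"
proof -
  have "expectation (\<lambda>\<omega>. g (V i \<omega>)) = (LINT x|distr M borel (V i). g x)" for i
    using assms by (subst integral_distr) auto
  then show ?thesis using marks_identical[of i] by metis
qed

text \<open>Given the arrival times, the factors are independent and their marks have the same law.\<close>

lemma expectation_marked_product:
  assumes [measurable]: "(\<lambda>(x, v). G x v) \<in> borel_measurable (borel \<Otimes>\<^sub>M borel)"
    and bound: "\<And>x v. \<bar>G x v\<bar> \<le> (1 :: real)"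
  shows "expectation (\<lambda>\<omega>. \<Prod>i<n. G (\<Gamma> i \<omega>) (V i \<omega>)) =
    expectation (\<lambda>\<omega>. \<Prod>i<n. expectation (\<lambda>\<omega>'. G (\<Gamma> i \<omega>) (V 0 \<omega>')))"
proof -
  have "(LINT \<omega>|M. (\<lambda>p. \<Prod>i<n. G (fst p i) (snd p i)) (\<lambda>i. \<Gamma> i \<omega>, \<lambda>i. V i \<omega>)) =
      (LINT \<omega>|M. LINT \<omega>'|M. (\<lambda>p. \<Prod>i<n. G (fst p i) (snd p i)) (\<lambda>i. \<Gamma> i \<omega>, \<lambda>i. V i \<omega>'))"
    by (rule integral_freeze[OF indep_arrivals_marks, of _ 1])
       (auto simp: abs_prod intro!: prod_le_1 bound)
  also have "\<dots> = (LINT \<omega>|M. (\<Prod>i<n. (LINT \<omega>'|M. G (\<Gamma> i \<omega>) (V 0 \<omega>'))))"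
  proof (intro Bochner_Integration.integral_cong refl)
    fix \<omega>
    have G[measurable]: "G x \<in> borel_measurable borel" for x
      using measurable_compose[OF measurable_Pair1' assms(1), of x] by simp
    have "(LINT \<omega>'|M. (\<Prod>i<n. G (\<Gamma> i \<omega>) (V i \<omega>'))) = (\<Prod>i<n. (LINT \<omega>'|M. G (\<Gamma> i \<omega>) (V i \<omega>')))"
    proof (rule indep_vars_lebesgue_integral)
      show "indep_vars (\<lambda>_. borel) (\<lambda>i \<omega>'. G (\<Gamma> i \<omega>) (V i \<omega>')) {..<n}"
        by (rule indep_vars_compose2[OF indep_vars_subset[OF indep_marks]]) auto
      show "integrable M (\<lambda>\<omega>'. G (\<Gamma> i \<omega>) (V i \<omega>'))" for i
        using bound by (intro integrable_const_bound[of _ 1]) auto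
    qed simp
    also have "\<dots> = (\<Prod>i<n. (LINT \<omega>'|M. G (\<Gamma> i \<omega>) (V 0 \<omega>')))"
      by (intro prod.cong refl expectation_marks) simp
    finally show "(LINT \<omega>'|M. (\<lambda>p. \<Prod>i<n. G (fst p i) (snd p i)) (\<lambda>i. \<Gamma> i \<omega>, \<lambda>i. V i \<omega>')) =
        (\<Prod>i<n. (LINT \<omega>'|M. G (\<Gamma> i \<omega>) (V 0 \<omega>')))" by simp
  qed
  finally show ?thesis by simp
qed

text \<open>The arrival times grow at least linearly.\<close>

lemma AE_summable_arrivals_powr:
  assumes "p > 1"
  shows "AE \<omega> in M. summable (\<lambda>i. \<Gamma> i \<omega> powr (- p))"
  using AE_arrivals_lower_bound
proof eventually_elim
  case (elim \<omega>)
  then obtain \<kappa> where \<kappa>: "\<kappa> > 0" "\<And>i. \<kappa> * real (Suc i) \<le> \<Gamma> i \<omega>" by blast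
  have "summable (\<lambda>i. real i powr (- p))"
    using assms by (simp add: summable_real_powr_iff)
  then have "summable (\<lambda>i. \<kappa> powr (- p) * real (Suc i) powr (- p))"
    by (intro summable_mult) (subst summable_Suc_iff)
  then show ?case
  proof (rule summable_comparison_test'[where N = 0])
    fix i
    have "\<Gamma> i \<omega> powr (- p) \<le> (\<kappa> * real (Suc i)) powr (- p)"
      using \<kappa> assms by (intro powr_mono2') auto
    then show "norm (\<Gamma> i \<omega> powr (- p)) \<le> \<kappa> powr (- p) * real (Suc i) powr (- p)"
      using \<kappa> by (simp add: powr_mult)
  qed
qed

context
  fixes a B :: real and f :: "real \<Rightarrow> real"
  assumes a: "1 < a" "a < 2"
    and f[measurable]: "f \<in> borel_measurable borel"
    and f_bound: "\<And>v. \<bar>f v\<bar> \<le> B"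
begin

definition jump :: "nat \<Rightarrow> (nat \<Rightarrow> real) \<times> (nat \<Rightarrow> real) \<Rightarrow> real" where
  "jump i x = fst x i powr (- (1 / a)) * f (snd x i)"

lemma jump_measurable[measurable]: "jump i \<in> borel_measurable (sequence_space \<Otimes>\<^sub>M sequence_space)"
  unfolding jump_def by measurable

lemma jump_data: "jump i (data \<omega>) = \<Gamma> i \<omega> powr (- (1 / a)) * f (V i \<omega>)"
  by (simp add: jump_def data_def)

lemma AE_summable_lepage:
  "AE \<omega> in M. summable (\<lambda>i. \<epsilon> i \<omega> * (\<Gamma> i \<omega> powr (- (1 / a)) * f (V i \<omega>)))"
proof -
  have p: "1 < 2 / a" using a by simp
  have "AE \<omega> in M. summable (\<lambda>i. (jump i (data \<omega>))\<^sup>2)"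
    using AE_summable_arrivals_powr[OF p]
  proof eventually_elim
    case (elim \<omega>)
    show ?case
    proof (rule summable_comparison_test'[where N = 0])
      show "summable (\<lambda>i. B\<^sup>2 * \<Gamma> i \<omega> powr (- (2 / a)))"
        using elim a by (intro summable_mult) auto
      fix i
      have "(f (V i \<omega>))\<^sup>2 \<le> B\<^sup>2"
        using f_bound[of "V i \<omega>"] by (simp add: abs_le_square_iff[symmetric])
      moreover have "(\<Gamma> i \<omega> powr (- (1 / a)))\<^sup>2 = \<Gamma> i \<omega> powr (- (2 / a))"
        by (simp add: power2_eq_square powr_add[symmetric])
      ultimately show "norm ((jump i (data \<omega>))\<^sup>2) \<le> B\<^sup>2 * \<Gamma> i \<omega> powr (- (2 / a))"
        by (simp add: jump_data power_mult_distrib mult.commute mult_right_mono)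
    qed
  qed
  then show ?thesis
    using AE_summable_series[of jump] by (simp add: jump_data)
qed

text \<open>The characteristic function at \<open>\<theta>\<close> of the contribution of an arrival at time \<open>x\<close>, that is, of a random
  sign times the jump.\<close>

definition mark_char :: "real \<Rightarrow> real \<Rightarrow> real" where
  "mark_char \<theta> x = expectation (\<lambda>\<omega>. cos (\<theta> * (x powr (- (1 / a)) * f (V 0 \<omega>))))"

lemma mark_char_measurable[measurable]: "mark_char \<theta> \<in> borel_measurable borel"
  unfolding mark_char_def by measurable

lemma mark_char_bound: "\<bar>mark_char \<theta> x\<bar> \<le> 1"
proof -
  have "norm (mark_char \<theta> x) \<le> expectation (\<lambda>\<omega>. norm (cos (\<theta> * (x powr (- (1 / a)) * f (V 0 \<omega>)))))"
    unfolding mark_char_def by (rule integral_norm_bound)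
  also have "\<dots> \<le> expectation (\<lambda>\<omega>. 1)"
    by (intro integral_mono integrable_const_bound[of _ 1]) auto
  finally show ?thesis by (simp add: prob_space)
qed

lemma mark_char_isCont:
  assumes "x > 0"
  shows "isCont (mark_char \<theta>) x"
  unfolding continuous_at_sequentially
proof (intro allI impI)
  fix s assume s: "s \<longlonglongrightarrow> x"
  show "(mark_char \<theta> \<circ> s) \<longlonglongrightarrow> mark_char \<theta> x"
    unfolding comp_def mark_char_def
  proof (rule integral_dominated_convergence[where w = "\<lambda>_. 1"])
    show "AE \<omega> in M. (\<lambda>n. cos (\<theta> * (s n powr (- (1 / a)) * f (V 0 \<omega>)))) \<longlonglongrightarrow> cos (\<theta> * (x powr (- (1 / a)) * f (V 0 \<omega>)))"
      using assms s by (intro AE_I2 tendsto_intros) auto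
  qed auto
qed

lemma mark_char_at_top: "(mark_char \<theta> \<longlongrightarrow> 1) at_top"
proof -
  have "((\<lambda>x. expectation (\<lambda>\<omega>. cos (\<theta> * (x powr (- (1 / a)) * f (V 0 \<omega>))))) \<longlongrightarrow> expectation (\<lambda>\<omega>. 1)) at_top"
  proof (rule integral_dominated_convergence_at_top[where w = "\<lambda>_. 1"])
    have "((\<lambda>x. x powr (- (1 / a))) \<longlongrightarrow> 0) at_top"
      using a by (intro tendsto_neg_powr filterlim_ident) auto
    then have "((\<lambda>x. cos (\<theta> * (x powr (- (1 / a)) * f (V 0 \<omega>)))) \<longlongrightarrow> cos (\<theta> * (0 * f (V 0 \<omega>)))) at_top" for \<omega>
      by (intro tendsto_intros)
    then show "AE \<omega> in M. ((\<lambda>x. cos (\<theta> * (x powr (- (1 / a)) * f (V 0 \<omega>)))) \<longlongrightarrow> 1) at_top"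
      by simp
  qed auto
  then show ?thesis by (simp add: mark_char_def[abs_def] prob_space)
qed

text \<open>The layer-cake identity for every value of the mark, averaged over the mark.\<close>

lemma mark_char_integral:
  shows "set_integrable lborel {0<..} (\<lambda>x. 1 - mark_char \<theta> x)"
    and "(LBINT x:{0<..}. 1 - mark_char \<theta> x) =
      \<bar>\<theta>\<bar> powr a * expectation (\<lambda>\<omega>. \<bar>f (V 0 \<omega>)\<bar> powr a) / stable_const a"
proof -
  let ?I = "LBINT y:{0<..}. y powr (- a) * sin y"
  define F where "F p = indicator {0<..} (snd p) *\<^sub>R (1 - cos (\<theta> * (snd p powr (- (1 / a)) * f (V 0 (fst p)))))" for p
  interpret P: pair_sigma_finite M lborel ..
  have [measurable]: "F \<in> borel_measurable (M \<Otimes>\<^sub>M lborel)"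
    unfolding F_def by measurable
  have F_nonneg: "0 \<le> F p" for p by (simp add: F_def)
  have F_eq: "F (\<omega>, x) = indicator {0<..} x *\<^sub>R (1 - cos (\<bar>\<theta> * f (V 0 \<omega>)\<bar> * x powr (- (1 / a))))" for \<omega> x
  proof -
    have "cos (\<bar>c\<bar> * y) = cos (c * y)" for c y :: real
      by (cases "c \<ge> 0") auto
    then show ?thesis by (simp add: F_def mult_ac)
  qed
  have inner: "integrable lborel (\<lambda>x. F (\<omega>, x))" "(LBINT x. F (\<omega>, x)) = \<bar>\<theta> * f (V 0 \<omega>)\<bar> powr a * ?I" for \<omega>
    using cos_layer_cake[OF a, of "\<bar>\<theta> * f (V 0 \<omega>)\<bar>"]
    unfolding set_integrable_def set_lebesgue_integral_def F_eq by simp_all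
  have int: "integrable (M \<Otimes>\<^sub>M lborel) F"
  proof (rule P.Fubini_integrable)
    have "\<bar>\<theta> * f v\<bar> powr a \<le> (\<bar>\<theta>\<bar> * B) powr a" for v
      using a f_bound[of v] by (intro powr_mono2) (auto simp: abs_mult mult_left_mono)
    then have "integrable M (\<lambda>\<omega>. \<bar>\<theta> * f (V 0 \<omega>)\<bar> powr a)"
      by (intro integrable_const_bound[of _ "(\<bar>\<theta>\<bar> * B) powr a"]) auto
    then show "integrable M (\<lambda>\<omega>. LBINT x. norm (F (\<omega>, x)))"
      using F_nonneg inner by simp
  qed (use inner in auto)
  have inner': "(LINT \<omega>|M. F (\<omega>, x)) = indicator {0<..} x *\<^sub>R (1 - mark_char \<theta> x)" for x
  proof -
    have "integrable M (\<lambda>\<omega>. cos (\<theta> * (x powr (- (1 / a)) * f (V 0 \<omega>))))"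
      by (intro integrable_const_bound[of _ 1]) auto
    then show ?thesis
      by (simp add: F_def mark_char_def prob_space)
  qed
  show "set_integrable lborel {0<..} (\<lambda>x. 1 - mark_char \<theta> x)"
    using P.integrable_snd[of "\<lambda>\<omega> x. F (\<omega>, x)"] int
    unfolding set_integrable_def inner'[symmetric] by (simp add: case_prod_beta')
  have "(LBINT x. (LINT \<omega>|M. F (\<omega>, x))) = (LINT \<omega>|M. (LBINT x. F (\<omega>, x)))"
    using P.Fubini_integral[of "\<lambda>\<omega> x. F (\<omega>, x)"] int by (simp add: case_prod_beta')
  also have "\<dots> = \<bar>\<theta>\<bar> powr a * expectation (\<lambda>\<omega>. \<bar>f (V 0 \<omega>)\<bar> powr a) * ?I"
    by (simp add: inner abs_mult powr_mult)
  finally show "(LBINT x:{0<..}. 1 - mark_char \<theta> x) =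
      \<bar>\<theta>\<bar> powr a * expectation (\<lambda>\<omega>. \<bar>f (V 0 \<omega>)\<bar> powr a) / stable_const a"
    by (simp add: inner' set_lebesgue_integral_def stable_const_def divide_inverse)
qed

text \<open>The LePage representation: the series is symmetric stable with index \<open>a\<close>. Given the arrivals, the
  characteristic function of a partial sum is a product of values of \<open>mark_char\<close>, and the Laplace
  functional gives the limit of its expectation.\<close>

lemma char_lepage:
  "(LINT \<omega>|M. iexp (\<theta> * (\<Sum>i. \<epsilon> i \<omega> * (\<Gamma> i \<omega> powr (- (1 / a)) * f (V i \<omega>))))) =
    complex_of_real (exp (- (\<bar>\<theta>\<bar> powr a * expectation (\<lambda>\<omega>. \<bar>f (V 0 \<omega>)\<bar> powr a) / stable_const a)))"
proof -
  let ?J = "\<lambda>i \<omega>. \<Gamma> i \<omega> powr (- (1 / a)) * f (V i \<omega>)"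
  have partial: "(LINT \<omega>|M. iexp (\<theta> * (\<Sum>i<n. \<epsilon> i \<omega> * ?J i \<omega>))) =
      complex_of_real (expectation (\<lambda>\<omega>. \<Prod>i<n. mark_char \<theta> (\<Gamma> i \<omega>)))" for n
  proof -
    have "(LINT \<omega>|M. iexp (\<theta> * (\<Sum>i<n. \<epsilon> i \<omega> * ?J i \<omega>))) = (LINT \<omega>|M. iexp (\<Sum>i<n. \<epsilon> i \<omega> * (\<theta> * jump i (data \<omega>))))"
      by (simp add: jump_data sum_distrib_left mult_ac)
    also have "\<dots> = complex_of_real (expectation (\<lambda>\<omega>. \<Prod>i<n. cos (\<theta> * jump i (data \<omega>))))"
      by (rule char_series_partial) measurable
    also have "expectation (\<lambda>\<omega>. \<Prod>i<n. cos (\<theta> * jump i (data \<omega>))) =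
        expectation (\<lambda>\<omega>. \<Prod>i<n. mark_char \<theta> (\<Gamma> i \<omega>))"
      unfolding jump_data mark_char_def by (rule expectation_marked_product) auto
    finally show ?thesis .
  qed
  have "(\<lambda>n. LINT \<omega>|M. iexp (\<theta> * (\<Sum>i<n. \<epsilon> i \<omega> * ?J i \<omega>))) \<longlonglongrightarrow> (LINT \<omega>|M. iexp (\<theta> * (\<Sum>i. \<epsilon> i \<omega> * ?J i \<omega>)))"
  proof (rule integral_dominated_convergence[where w = "\<lambda>_. 1"])
    show "AE \<omega> in M. (\<lambda>n. iexp (\<theta> * (\<Sum>i<n. \<epsilon> i \<omega> * ?J i \<omega>))) \<longlonglongrightarrow> iexp (\<theta> * (\<Sum>i. \<epsilon> i \<omega> * ?J i \<omega>))"
      using AE_summable_lepage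
    proof eventually_elim
      case (elim \<omega>)
      show ?case
        by (intro tendsto_exp tendsto_mult tendsto_const tendsto_of_real summable_LIMSEQ elim)
    qed
  qed auto
  moreover have "(\<lambda>n. expectation (\<lambda>\<omega>. \<Prod>i<n. mark_char \<theta> (\<Gamma> i \<omega>))) \<longlonglongrightarrow> exp (- (LBINT x:{0<..}. 1 - mark_char \<theta> x))"
    by (intro expectation_product_arrivals mark_char_bound mark_char_isCont mark_char_at_top mark_char_integral(1)) auto
  then have "(\<lambda>n. LINT \<omega>|M. iexp (\<theta> * (\<Sum>i<n. \<epsilon> i \<omega> * ?J i \<omega>))) \<longlonglongrightarrow>
      complex_of_real (exp (- (LBINT x:{0<..}. 1 - mark_char \<theta> x)))"
    unfolding partial by (rule tendsto_of_real)
  ultimately show ?thesis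
    unfolding mark_char_integral(2) by (rule LIMSEQ_unique)
qed

end

end

section \<open>Uniqueness of joint characteristic functions\<close>

text \<open>Normalising a weighted measure makes its transform accessible to theorems on probability measures.\<close>

lemma weighted_law:
  fixes X G :: "'a \<Rightarrow> real"
  assumes "prob_space M" and [measurable]: "X \<in> borel_measurable M" "G \<in> borel_measurable M"
    and G: "\<And>\<omega>. 0 \<le> G \<omega>" "\<And>\<omega>. G \<omega> \<le> c"
    and m: "m = (LINT \<omega>|M. G \<omega>)" "m > 0"
  defines "\<mu> \<equiv> distr (density M (\<lambda>\<omega>. ennreal (G \<omega> / m))) borel X"
  shows "real_distribution \<mu>"
    and "char \<mu> t = (LINT \<omega>|M. complex_of_real (G \<omega>) * iexp (t * X \<omega>)) / m"
    and "A \<in> sets borel \<Longrightarrow> measure \<mu> A = (LINT \<omega>|M. G \<omega> * indicator A (X \<omega>)) / m"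
proof -
  interpret prob_space M by fact
  have int: "integrable M G"
    using G by (intro integrable_const_bound[of _ c]) auto
  have "(\<integral>\<^sup>+ \<omega>. ennreal (G \<omega> / m) \<partial>M) = ennreal (LINT \<omega>|M. G \<omega> / m)"
    using int G m by (intro nn_integral_eq_integral integrable_divide) auto
  then have "emeasure (density M (\<lambda>\<omega>. ennreal (G \<omega> / m))) (space M) = 1"
    using m by (simp add: emeasure_density cong: nn_integral_cong)
  then have "prob_space (density M (\<lambda>\<omega>. ennreal (G \<omega> / m)))"
    by (intro prob_spaceI) simp
  then show \<mu>: "real_distribution \<mu>"
    unfolding \<mu>_def real_distribution_def real_distribution_axioms_def
    by (auto intro!: prob_space.prob_space_distr)
  have integral: "(LINT x|\<mu>. h x) = (LINT \<omega>|M. (G \<omega> / m) *\<^sub>R h (X \<omega>))"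
    if [measurable]: "h \<in> borel_measurable borel" for h :: "real \<Rightarrow> 'b :: {banach, second_countable_topology}"
    unfolding \<mu>_def using G m by (subst integral_distr) (auto simp: integral_density)
  have "char \<mu> t = (LINT \<omega>|M. (G \<omega> / m) *\<^sub>R iexp (t * X \<omega>))"
    unfolding char_def by (rule integral) measurable
  also have "\<dots> = (LINT \<omega>|M. (complex_of_real (G \<omega>) * iexp (t * X \<omega>)) / m)"
    by (simp add: scaleR_conv_of_real)
  finally show "char \<mu> t = (LINT \<omega>|M. complex_of_real (G \<omega>) * iexp (t * X \<omega>)) / m"
    by simp
  show "measure \<mu> A = (LINT \<omega>|M. G \<omega> * indicator A (X \<omega>)) / m" if [measurable]: "A \<in> sets borel"
    using integral[of "indicator A :: real \<Rightarrow> real"] that by (simp add: \<mu>_def)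
qed

text \<open>The common mass, read off at \<open>t = 0\<close>, is either zero, and both sides vanish, or can be divided out;
  then Levy's uniqueness theorem applies.\<close>

lemma weighted_char_unique:
  fixes X G :: "'a \<Rightarrow> real" and X' G' :: "'b \<Rightarrow> real"
  assumes M: "prob_space M" "X \<in> borel_measurable M" "G \<in> borel_measurable M"
      "\<And>\<omega>. 0 \<le> G \<omega>" "\<And>\<omega>. G \<omega> \<le> c"
    and N: "prob_space N" "X' \<in> borel_measurable N" "G' \<in> borel_measurable N"
      "\<And>\<omega>. 0 \<le> G' \<omega>" "\<And>\<omega>. G' \<omega> \<le> c"
    and eq: "\<And>t. (LINT \<omega>|M. complex_of_real (G \<omega>) * iexp (t * X \<omega>)) =
      (LINT \<omega>|N. complex_of_real (G' \<omega>) * iexp (t * X' \<omega>))"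
    and A: "A \<in> sets borel"
  shows "(LINT \<omega>|M. G \<omega> * indicator A (X \<omega>)) = (LINT \<omega>|N. G' \<omega> * indicator A (X' \<omega>))"
proof -
  define m where "m = (LINT \<omega>|M. G \<omega>)"
  have "complex_of_real (LINT \<omega>|M. G \<omega>) = complex_of_real (LINT \<omega>|N. G' \<omega>)"
    using eq[of 0] by simp
  then have m': "m = (LINT \<omega>|N. G' \<omega>)"
    by (simp add: m_def)
  show ?thesis
  proof (cases "m = 0")
    case True
    have "(LINT \<omega>|K. H \<omega> * indicator A (Z \<omega>)) = 0"
      if "prob_space K" "H \<in> borel_measurable K" "\<And>\<omega>. 0 \<le> H \<omega>" "\<And>\<omega>. H \<omega> \<le> c" "(LINT \<omega>|K. H \<omega>) = 0"
      for K :: "'c measure" and H Z :: "'c \<Rightarrow> real"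
    proof -
      interpret prob_space K by fact
      have "integrable K H"
        using that by (intro integrable_const_bound[of _ c]) auto
      then have "AE \<omega> in K. H \<omega> = 0"
        using that by (subst (asm) integral_nonneg_eq_0_iff_AE) auto
      then show ?thesis
        by (intro integral_eq_zero_AE) (auto elim: eventually_mono)
    qed
    from this[OF M(1,3,4,5)] this[OF N(1,3,4,5)] show ?thesis
      using True m' by (simp add: m_def)
  next
    case False
    then have pos: "m > 0"
      unfolding m_def using M(4) by (simp add: less_le integral_nonneg_AE)
    note wM = weighted_law[OF M m_def pos] and wN = weighted_law[OF N m' pos]
    have "distr (density M (\<lambda>\<omega>. ennreal (G \<omega> / m))) borel X = distr (density N (\<lambda>\<omega>. ennreal (G' \<omega> / m))) borel X'"
      by (rule Levy_uniqueness[OF wM(1) wN(1)]) (rule ext, simp only: wM(2) wN(2) eq)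
    then show ?thesis
      using wM(3)[OF A] wN(3)[OF A] pos by simp
  qed
qed

text \<open>The exponentials are exchanged for indicators of Borel sets one coordinate at a time. With \<open>U\<close> the
  linear combination that is still exponentiated and \<open>W\<close> the product of the indicators obtained so far,
  the next coordinate \<open>X k\<close> is handled by the theorem in one dimension for the weights
  \<open>W * (1 + cos (U - \<phi>))\<close>. Weights must be nonnegative, whence the summand 1; the phases \<open>\<phi> = 0\<close> and
  \<open>\<phi> = pi / 2\<close> recover the real and imaginary parts of \<open>iexp U\<close>.\<close>

lemma char_unique_PiM:
  fixes X :: "'i \<Rightarrow> 'a \<Rightarrow> real" and X' :: "'i \<Rightarrow> 'b \<Rightarrow> real"
  assumes "prob_space M" "prob_space N" "finite J"
    and X[measurable]: "\<And>j. j \<in> J \<Longrightarrow> X j \<in> borel_measurable M"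
    and X'[measurable]: "\<And>j. j \<in> J \<Longrightarrow> X' j \<in> borel_measurable N"
    and eq: "\<And>\<theta> :: 'i \<Rightarrow> real. (LINT \<omega>|M. iexp (\<Sum>j\<in>J. \<theta> j * X j \<omega>)) = (LINT \<omega>|N. iexp (\<Sum>j\<in>J. \<theta> j * X' j \<omega>))"
  shows "distr M (\<Pi>\<^sub>M j\<in>J. borel) (\<lambda>\<omega>. \<lambda>j\<in>J. X j \<omega>) = distr N (\<Pi>\<^sub>M j\<in>J. borel) (\<lambda>\<omega>. \<lambda>j\<in>J. X' j \<omega>)"
proof -
  interpret M: prob_space M by fact
  interpret N: prob_space N by fact
  have bounded: "integrable M f" if "f \<in> borel_measurable M" "\<And>\<omega>. norm (f \<omega>) \<le> c" for f :: "'a \<Rightarrow> complex" and c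
    using that by (intro M.integrable_const_bound[of _ c]) auto
  have bounded': "integrable N f" if "f \<in> borel_measurable N" "\<And>\<omega>. norm (f \<omega>) \<le> c" for f :: "'b \<Rightarrow> complex" and c
    using that by (intro N.integrable_const_bound[of _ c]) auto
  have swap: "(LINT \<omega>|M. complex_of_real (\<Prod>j\<in>K. indicator (B j) (X j \<omega>)) * iexp (\<Sum>j\<in>J - K. \<theta> j * X j \<omega>)) =
    (LINT \<omega>|N. complex_of_real (\<Prod>j\<in>K. indicator (B j) (X' j \<omega>)) * iexp (\<Sum>j\<in>J - K. \<theta> j * X' j \<omega>))"
    if "finite K" "K \<subseteq> J" "\<And>j. B j \<in> sets borel" for K B \<theta>
    using that
  proof (induction K arbitrary: \<theta> B rule: finite_induct)
    case empty
    then show ?case using eq by simp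
  next
    case (insert k K)
    have J: "k \<in> J" "K \<subseteq> J"
      using insert.hyps insert.prems by auto
    note [measurable] = insert.prems(2)
    define L where "L = J - insert k K"
    have L: "L \<subseteq> J" "finite L" "k \<notin> L" "J - K = insert k L"
      using J insert.hyps \<open>finite J\<close> by (auto simp: L_def)
    define W where "W \<omega> = (\<Prod>j\<in>K. indicator (B j) (X j \<omega>) :: real)" for \<omega>
    define W' where "W' \<omega> = (\<Prod>j\<in>K. indicator (B j) (X' j \<omega>) :: real)" for \<omega>
    define U where "U \<omega> = (\<Sum>j\<in>L. \<theta> j * X j \<omega>)" for \<omega>
    define U' where "U' \<omega> = (\<Sum>j\<in>L. \<theta> j * X' j \<omega>)" for \<omega>
    have XL: "X j \<in> borel_measurable M" "X' j \<in> borel_measurable N" if "j \<in> insert k (K \<union> L)" for j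
      using that J L by auto
    have Xk[measurable]: "X k \<in> borel_measurable M" "X' k \<in> borel_measurable N"
      by (rule XL; simp)+
    have [measurable]: "W \<in> borel_measurable M" "W' \<in> borel_measurable N"
      unfolding W_def W'_def
      by (intro borel_measurable_prod measurable_compose[OF XL(1)] measurable_compose[OF XL(2)] borel_measurable_indicator insert.prems(2); simp)+
    have [measurable]: "U \<in> borel_measurable M" "U' \<in> borel_measurable N"
      unfolding U_def U'_def
      by (intro borel_measurable_sum borel_measurable_times borel_measurable_const XL; simp)+
    have W01: "0 \<le> W \<omega>" "W \<omega> \<le> 1" for \<omega>
      unfolding W_def by (auto intro!: prod_nonneg prod_le_1)
    have W'01: "0 \<le> W' \<omega>" "W' \<omega> \<le> 1" for \<omega>
      unfolding W'_def by (auto intro!: prod_nonneg prod_le_1)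
    have IH: "(LINT \<omega>|M. complex_of_real (W \<omega>) * iexp (t * X k \<omega> + s * U \<omega>)) =
        (LINT \<omega>|N. complex_of_real (W' \<omega>) * iexp (t * X' k \<omega> + s * U' \<omega>))" for s t
    proof -
      have "(\<Sum>j\<in>L. (if j = k then t else s * \<theta> j) * Z j) = s * (\<Sum>j\<in>L. \<theta> j * Z j)" for Z :: "'i \<Rightarrow> real"
        unfolding sum_distrib_left using L by (intro sum.cong) auto
      moreover define \<theta>' where "\<theta>' j = (if j = k then t else s * \<theta> j)" for j
      have "(LINT \<omega>|M. complex_of_real (\<Prod>j\<in>K. indicator (B j) (X j \<omega>)) * iexp (\<Sum>j\<in>J - K. \<theta>' j * X j \<omega>)) =
          (LINT \<omega>|N. complex_of_real (\<Prod>j\<in>K. indicator (B j) (X' j \<omega>)) * iexp (\<Sum>j\<in>J - K. \<theta>' j * X' j \<omega>))"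
        by (rule insert.IH[OF J(2) insert.prems(2)])
      ultimately show ?thesis
        using L by (simp add: \<theta>'_def W_def W'_def U_def U'_def)
    qed
    \<comment> \<open>The case \<open>c = 0\<close> is the plain weight, which is subtracted afterwards.\<close>
    have wave: "(LINT \<omega>|M. W \<omega> * (1 + c * cos (U \<omega> - \<phi>)) * indicator (B k) (X k \<omega>)) =
        (LINT \<omega>|N. W' \<omega> * (1 + c * cos (U' \<omega> - \<phi>)) * indicator (B k) (X' k \<omega>))"
      if c: "c \<in> {0, 1}" for c \<phi> :: real
    proof (rule weighted_char_unique[where c = 2, OF \<open>prob_space M\<close> Xk(1) _ _ _ \<open>prob_space N\<close> Xk(2)])
      have range: "0 \<le> 1 + c * cos x" "1 + c * cos x \<le> 2" for x
      proof -
        have "0 \<le> 1 + cos x" "1 + cos x \<le> 2"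
          using cos_ge_minus_one[of x] cos_le_one[of x] by linarith+
        then show "0 \<le> 1 + c * cos x" "1 + c * cos x \<le> 2" using c by auto
      qed
      have *: "0 \<le> w * (1 + c * cos x)" "w * (1 + c * cos x) \<le> 2" if "0 \<le> w" "w \<le> 1" for w x
        using range[of x] that mult_mono[of w 1 "1 + c * cos x" 2] by auto
      show "0 \<le> W \<omega> * (1 + c * cos (U \<omega> - \<phi>))" "W \<omega> * (1 + c * cos (U \<omega> - \<phi>)) \<le> 2" for \<omega>
        using *[OF W01] by auto
      show "0 \<le> W' \<omega> * (1 + c * cos (U' \<omega> - \<phi>))" "W' \<omega> * (1 + c * cos (U' \<omega> - \<phi>)) \<le> 2" for \<omega>
        using *[OF W'01] by auto
      fix t
      define p where "p = c / 2 * iexp (- \<phi>)"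
      define q where "q = c / 2 * iexp \<phi>"
      have expand: "complex_of_real (w * (1 + c * cos (u - \<phi>))) * iexp (t * x) =
          complex_of_real w * iexp (t * x + 0 * u) + p * (complex_of_real w * iexp (t * x + 1 * u)) +
          q * (complex_of_real w * iexp (t * x + (- 1) * u))" for w u x
      proof -
        have cosine: "complex_of_real (cos (u - \<phi>)) = (iexp (- \<phi>) * iexp u + iexp \<phi> * iexp (- u)) / 2"
          by (simp add: cos_of_real[symmetric] cos_exp_eq exp_add[symmetric] algebra_simps)
        have shift: "iexp (t * x + 0 * u) = iexp (t * x)" "iexp (t * x + 1 * u) = iexp (t * x) * iexp u"
            "iexp (t * x + (- 1) * u) = iexp (t * x) * iexp (- u)"
          by (simp_all add: exp_add[symmetric] algebra_simps)
        have ring: "w * (1 + c * ((a * b + a' * b') / 2)) * e = w * e + c / 2 * a * (w * (e * b)) + c / 2 * a' * (w * (e * b'))"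
          for w c a b a' b' e :: complex
          by (simp add: field_simps)
        have "complex_of_real (w * (1 + c * cos (u - \<phi>))) =
            complex_of_real w * (1 + complex_of_real c * ((iexp (- \<phi>) * iexp u + iexp \<phi> * iexp (- u)) / 2))"
          by (simp only: of_real_mult of_real_add of_real_1 cosine)
        then show ?thesis
          unfolding shift p_def q_def by (simp only: ring of_real_divide of_real_numeral)
      qed
      have nW: "norm (complex_of_real (W \<omega>) * iexp x) \<le> 1" for \<omega> x
        using W01[of \<omega>] by (simp add: norm_mult)
      have int: "integrable M (\<lambda>\<omega>. complex_of_real (W \<omega>) * iexp (t * X k \<omega> + s * U \<omega>))" for s
        by (rule bounded[OF _ nW]) measurable
      have nW': "norm (complex_of_real (W' \<omega>) * iexp x) \<le> 1" for \<omega> x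
        using W'01[of \<omega>] by (simp add: norm_mult)
      have int': "integrable N (\<lambda>\<omega>. complex_of_real (W' \<omega>) * iexp (t * X' k \<omega> + s * U' \<omega>))" for s
        by (rule bounded'[OF _ nW']) measurable
      have "(LINT \<omega>|M. complex_of_real (W \<omega> * (1 + c * cos (U \<omega> - \<phi>))) * iexp (t * X k \<omega>)) =
          (LINT \<omega>|M. complex_of_real (W \<omega>) * iexp (t * X k \<omega> + 0 * U \<omega>)) +
          p * (LINT \<omega>|M. complex_of_real (W \<omega>) * iexp (t * X k \<omega> + 1 * U \<omega>)) +
          q * (LINT \<omega>|M. complex_of_real (W \<omega>) * iexp (t * X k \<omega> + (- 1) * U \<omega>))"
        unfolding expand
        by (simp only: Bochner_Integration.integral_add Bochner_Integration.integrable_add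
            integral_mult_right_zero integrable_mult_right int)
      also have "\<dots> = (LINT \<omega>|N. complex_of_real (W' \<omega>) * iexp (t * X' k \<omega> + 0 * U' \<omega>)) +
          p * (LINT \<omega>|N. complex_of_real (W' \<omega>) * iexp (t * X' k \<omega> + 1 * U' \<omega>)) +
          q * (LINT \<omega>|N. complex_of_real (W' \<omega>) * iexp (t * X' k \<omega> + (- 1) * U' \<omega>))"
        unfolding IH ..
      also have "\<dots> = (LINT \<omega>|N. complex_of_real (W' \<omega> * (1 + c * cos (U' \<omega> - \<phi>))) * iexp (t * X' k \<omega>))"
        unfolding expand
        by (simp only: Bochner_Integration.integral_add Bochner_Integration.integrable_add
            integral_mult_right_zero integrable_mult_right int')
      finally show "(LINT \<omega>|M. complex_of_real (W \<omega> * (1 + c * cos (U \<omega> - \<phi>))) * iexp (t * X k \<omega>)) =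
          (LINT \<omega>|N. complex_of_real (W' \<omega> * (1 + c * cos (U' \<omega> - \<phi>))) * iexp (t * X' k \<omega>))" .
    qed (use insert.prems(2) in measurable)
    define D where "D \<omega> = W \<omega> * indicator (B k) (X k \<omega>)" for \<omega>
    define D' where "D' \<omega> = W' \<omega> * indicator (B k) (X' k \<omega>)" for \<omega>
    have [measurable]: "D \<in> borel_measurable M" "D' \<in> borel_measurable N"
      unfolding D_def D'_def by measurable
    have D_bound: "\<bar>D \<omega>\<bar> \<le> 1" for \<omega>
      using W01[of \<omega>] by (auto simp: D_def indicator_def)
    have D'_bound: "\<bar>D' \<omega>\<bar> \<le> 1" for \<omega>
      using W'01[of \<omega>] by (auto simp: D'_def indicator_def)
    have le1: "\<bar>x * cos y\<bar> \<le> 1" if "\<bar>x\<bar> \<le> 1" for x y :: real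
      using that abs_cos_le_one[of y] mult_mono[of "\<bar>x\<bar>" 1 "\<bar>cos y\<bar>" 1] by (simp add: abs_mult)
    have cosine: "(LINT \<omega>|M. D \<omega> * cos (U \<omega> - \<phi>)) = (LINT \<omega>|N. D' \<omega> * cos (U' \<omega> - \<phi>))" for \<phi>
    proof -
      have int: "integrable M D" "integrable M (\<lambda>\<omega>. D \<omega> * cos (U \<omega> - \<phi>))"
        using D_bound le1[OF D_bound] by (auto intro!: M.integrable_const_bound[of _ 1])
      have int': "integrable N D'" "integrable N (\<lambda>\<omega>. D' \<omega> * cos (U' \<omega> - \<phi>))"
        using D'_bound le1[OF D'_bound] by (auto intro!: N.integrable_const_bound[of _ 1])
      have "(LINT \<omega>|M. D \<omega>) = (LINT \<omega>|N. D' \<omega>)"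
        using wave[of 0] by (simp add: D_def D'_def)
      moreover have "(LINT \<omega>|M. D \<omega> + D \<omega> * cos (U \<omega> - \<phi>)) = (LINT \<omega>|N. D' \<omega> + D' \<omega> * cos (U' \<omega> - \<phi>))"
        using wave[of 1 \<phi>] by (simp add: D_def D'_def algebra_simps)
      ultimately show ?thesis
        using int int' by simp
    qed
    have iexp: "complex_of_real d * iexp u = complex_of_real (d * cos (u - 0)) + \<i> * complex_of_real (d * cos (u - pi / 2))" for d u
    proof -
      have "cos (u - pi / 2) = sin u" by (simp add: cos_diff)
      then show ?thesis by (simp add: complex_eq_iff Re_exp Im_exp)
    qed
    have "(LINT \<omega>|M. complex_of_real (D \<omega>) * iexp (U \<omega>)) =
        complex_of_real (LINT \<omega>|M. D \<omega> * cos (U \<omega> - 0)) + \<i> * complex_of_real (LINT \<omega>|M. D \<omega> * cos (U \<omega> - pi / 2))"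
    proof -
      have "integrable M (\<lambda>\<omega>. complex_of_real (D \<omega> * cos (U \<omega> - \<phi>)))" for \<phi>
        using le1[OF D_bound] by (intro bounded[of _ 1]) (auto simp del: of_real_mult)
      then show ?thesis
        unfolding iexp
        by (simp only: Bochner_Integration.integral_add integrable_mult_right integral_mult_right_zero integral_complex_of_real)
    qed
    also have "\<dots> = complex_of_real (LINT \<omega>|N. D' \<omega> * cos (U' \<omega> - 0)) + \<i> * complex_of_real (LINT \<omega>|N. D' \<omega> * cos (U' \<omega> - pi / 2))"
      unfolding cosine ..
    also have "\<dots> = (LINT \<omega>|N. complex_of_real (D' \<omega>) * iexp (U' \<omega>))"
    proof -
      have "integrable N (\<lambda>\<omega>. complex_of_real (D' \<omega> * cos (U' \<omega> - \<phi>)))" for \<phi>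
        using le1[OF D'_bound] by (intro bounded'[of _ 1]) (auto simp del: of_real_mult)
      then show ?thesis
        unfolding iexp
        by (simp only: Bochner_Integration.integral_add integrable_mult_right integral_mult_right_zero integral_complex_of_real)
    qed
    finally show ?case
      by (simp only: prod.insert[OF insert.hyps] D_def D'_def W_def W'_def U_def U'_def L_def mult.commute)
  qed
  have mX: "(\<lambda>\<omega>. \<lambda>j\<in>J. X j \<omega>) \<in> measurable M (\<Pi>\<^sub>M j\<in>J. borel)"
    by (intro measurable_restrict X)
  have mX': "(\<lambda>\<omega>. \<lambda>j\<in>J. X' j \<omega>) \<in> measurable N (\<Pi>\<^sub>M j\<in>J. borel)"
    by (intro measurable_restrict X')
  show ?thesis
  proof (rule measure_eqI_PiM_finite[OF \<open>finite J\<close>, where A = "\<lambda>_. space (\<Pi>\<^sub>M j\<in>J. borel)"])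
    fix B :: "'i \<Rightarrow> real set" assume B: "\<And>j. j \<in> J \<Longrightarrow> B j \<in> sets borel"
    define B' where "B' j = (if j \<in> J then B j else {})" for j
    have B': "B' j \<in> sets borel" for j
      using B by (simp add: B'_def)
    have "complex_of_real (LINT \<omega>|M. (\<Prod>j\<in>J. indicator (B' j) (X j \<omega>))) =
        complex_of_real (LINT \<omega>|N. (\<Prod>j\<in>J. indicator (B' j) (X' j \<omega>)))"
    proof -
      have "(LINT \<omega>|M. complex_of_real (\<Prod>j\<in>J. indicator (B' j) (X j \<omega>)) * iexp (\<Sum>j\<in>J - J. 0 * X j \<omega>)) =
        (LINT \<omega>|N. complex_of_real (\<Prod>j\<in>J. indicator (B' j) (X' j \<omega>)) * iexp (\<Sum>j\<in>J - J. 0 * X' j \<omega>))"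
        by (rule swap[OF \<open>finite J\<close> order_refl B'])
      then show ?thesis
        by (simp del: of_real_prod add: integral_complex_of_real)
    qed
    then have eqp: "(LINT \<omega>|M. (\<Prod>j\<in>J. indicator (B' j) (X j \<omega>)) :: real) = (LINT \<omega>|N. (\<Prod>j\<in>J. indicator (B' j) (X' j \<omega>)))"
      using of_real_eq_iff by blast
    have box: "Pi\<^sub>E J B \<in> sets (\<Pi>\<^sub>M j\<in>J. borel)"
      using B \<open>finite J\<close> by (intro sets_PiM_I_finite) auto
    have ind: "(\<Prod>j\<in>J. indicator (B' j) (Z j) :: real) = indicator (Pi\<^sub>E J B) (\<lambda>j\<in>J. Z j)" for Z :: "'i \<Rightarrow> real"
      using \<open>finite J\<close> by (auto simp: indicator_def B'_def prod_eq_1_iff PiE_def Pi_def)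
    have "(LINT \<omega>|M. (\<Prod>j\<in>J. indicator (B' j) (X j \<omega>)) :: real) = measure (distr M (\<Pi>\<^sub>M j\<in>J. borel) (\<lambda>\<omega>. \<lambda>j\<in>J. X j \<omega>)) (Pi\<^sub>E J B)"
      unfolding ind using integral_distr[OF mX, of "indicator (Pi\<^sub>E J B) :: _ \<Rightarrow> real"] box
      by (simp add: sets.sets_into_space[OF box, simplified space_PiM] Int_absorb2)
    moreover have "(LINT \<omega>|N. (\<Prod>j\<in>J. indicator (B' j) (X' j \<omega>)) :: real) = measure (distr N (\<Pi>\<^sub>M j\<in>J. borel) (\<lambda>\<omega>. \<lambda>j\<in>J. X' j \<omega>)) (Pi\<^sub>E J B)"
      unfolding ind using integral_distr[OF mX', of "indicator (Pi\<^sub>E J B) :: _ \<Rightarrow> real"] box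
      by (simp add: sets.sets_into_space[OF box, simplified space_PiM] Int_absorb2)
    ultimately show "emeasure (distr M (\<Pi>\<^sub>M j\<in>J. borel) (\<lambda>\<omega>. \<lambda>j\<in>J. X j \<omega>)) (Pi\<^sub>E J B) =
        emeasure (distr N (\<Pi>\<^sub>M j\<in>J. borel) (\<lambda>\<omega>. \<lambda>j\<in>J. X' j \<omega>)) (Pi\<^sub>E J B)"
      using eqp M.prob_space_distr[OF mX] N.prob_space_distr[OF mX']
      by (simp add: finite_measure.emeasure_eq_measure prob_space.finite_measure)
  next
    show "range (\<lambda>_. space (\<Pi>\<^sub>M j\<in>J. borel)) \<subseteq> prod_algebra J (\<lambda>_. borel)"
      by (simp add: space_PiM space_in_prod_algebra[of J "\<lambda>_. borel", simplified])
    show "emeasure (distr M (\<Pi>\<^sub>M j\<in>J. borel) (\<lambda>\<omega>. \<lambda>j\<in>J. X j \<omega>)) (space (\<Pi>\<^sub>M j\<in>J. borel)) \<noteq> \<infinity>" for n :: nat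
      using prob_space.emeasure_space_1[OF M.prob_space_distr[OF mX]] by simp
  qed simp_all
qed

section \<open>Convergence in law of perturbed random vectors\<close>

text \<open>The distance of two sequences is a series of truncated coordinate distances with the weights
  \<open>(1 / 2) ^ n\<close>, of total mass 2.\<close>

lemma dist_fun_coordinatewise:
  fixes x y :: "nat \<Rightarrow> real"
  assumes "\<delta> \<ge> 0" "\<And>i. dist (x i) (y i) \<le> \<delta>"
  shows "dist x y \<le> 2 * \<delta>"
proof -
  have geo: "summable (\<lambda>n. (1 / 2) ^ n * \<delta>)"
    by (intro summable_mult2 summable_geometric) simp
  have le: "(1 / 2) ^ n * min (dist (x (from_nat n)) (y (from_nat n))) 1 \<le> (1 / 2) ^ n * \<delta>" for n
    using assms(2)[of "from_nat n"] by (intro mult_left_mono) auto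
  have "dist x y \<le> (\<Sum>n. (1 / 2) ^ n * \<delta>)"
    unfolding dist_fun_def
    using le by (intro suminf_le geo summable_comparison_test'[OF geo, of 0]) auto
  also have "\<dots> = 2 * \<delta>"
    by (subst suminf_mult2[symmetric]) (auto simp: suminf_geometric summable_geometric)
  finally show ?thesis .
qed

text \<open>The coordinates from \<open>n\<close> on are constant, so this is a full product of compact sets.\<close>

lemma compact_box: "compact (Pi\<^sub>E {..<n::nat} (\<lambda>_. {- K..K :: real}))"
proof -
  let ?S = "\<lambda>i. if i < n then {- K..K} else {undefined}"
  have "Pi\<^sub>E {..<n} (\<lambda>_. {- K..K}) = Pi\<^sub>E UNIV ?S"
    by (auto simp: PiE_def Pi_def extensional_def split: if_splits)
  moreover have "compactin (product_topology (\<lambda>_. euclidean) UNIV) (Pi\<^sub>E UNIV ?S)"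
    unfolding compactin_PiE by auto
  ultimately show ?thesis
    by (simp add: euclidean_product_topology compactin_euclidean_iff)
qed

abbreviation coord_space :: "nat \<Rightarrow> (nat \<Rightarrow> real) measure" where
  "coord_space n \<equiv> \<Pi>\<^sub>M k\<in>{..<n}. borel"

lemma measurable_continuous_vector:
  fixes f :: "(nat \<Rightarrow> real) \<Rightarrow> real"
  assumes "continuous_on ({..<n} \<rightarrow>\<^sub>E UNIV) f"
  shows "f \<in> borel_measurable (coord_space n)"
proof -
  have "(\<lambda>x. x) \<in> measurable (coord_space n) (borel :: (nat \<Rightarrow> real) measure)"
  proof (rule measurable_coordinatewise_then_product)
    fix i
    show "(\<lambda>x. x i) \<in> borel_measurable (coord_space n)"
    proof (cases "i < n")
      case True
      then show ?thesis by (intro measurable_component_singleton) auto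
    next
      case False
      then have "(\<lambda>x. x i) \<in> borel_measurable (coord_space n) \<longleftrightarrow>
          (\<lambda>x. undefined :: real) \<in> borel_measurable (coord_space n)"
        by (intro measurable_cong) (auto simp: space_PiM PiE_def extensional_def)
      then show ?thesis by simp
    qed
  qed
  then have "(\<lambda>x. x) \<in> measurable (coord_space n) (restrict_space borel ({..<n} \<rightarrow>\<^sub>E UNIV))"
    by (intro measurable_restrict_space2) (auto simp: space_PiM)
  from measurable_compose[OF this borel_measurable_continuous_on_restrict[OF assms]]
  show ?thesis by simp
qed

lemma tendsto_prob_0_finite:
  assumes "finite A" "\<And>k. k \<in> A \<Longrightarrow> ((\<lambda>r. measure M (E k r)) \<longlongrightarrow> 0) F"
    and sets: "eventually (\<lambda>r. \<forall>k\<in>A. E k r \<in> sets M) F" and "prob_space M"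
  shows "((\<lambda>r. measure M (\<Union>k\<in>A. E k r)) \<longlongrightarrow> 0) F"
proof (rule tendsto_sandwich[where f = "\<lambda>_. 0"])
  interpret prob_space M by fact
  show "eventually (\<lambda>r. measure M (\<Union>k\<in>A. E k r) \<le> (\<Sum>k\<in>A. measure M (E k r))) F"
    using sets by eventually_elim (use \<open>finite A\<close> in \<open>auto intro!: finite_measure_subadditive_finite\<close>)
  show "((\<lambda>r. \<Sum>k\<in>A. measure M (E k r)) \<longlongrightarrow> 0) F"
    using assms(2) by (intro tendsto_null_sum) auto
qed auto

text \<open>All the \<open>Z r\<close> have the law of \<open>L\<close>. A box that carries most of this single law does so for every \<open>r\<close>,
  and on a slightly larger box the test function is uniformly continuous, so replacing \<open>Z r\<close> by the nearby
  \<open>X r\<close> changes its expectation little.\<close>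

lemma slutsky:
  fixes X Z :: "'p \<Rightarrow> nat \<Rightarrow> 'w \<Rightarrow> real" and L :: "nat \<Rightarrow> 'v \<Rightarrow> real"
  assumes M: "prob_space M" and N: "prob_space N"
    and Z[measurable]: "\<And>r k. k < n \<Longrightarrow> Z r k \<in> borel_measurable M"
    and L[measurable]: "\<And>k. k < n \<Longrightarrow> L k \<in> borel_measurable N"
    and X: "eventually (\<lambda>r. \<forall>k<n. X r k \<in> borel_measurable M) F"
    and law: "eventually (\<lambda>r. distr M (coord_space n) (\<lambda>\<omega>. \<lambda>k\<in>{..<n}. Z r k \<omega>) =
      distr N (coord_space n) (\<lambda>\<omega>. \<lambda>k\<in>{..<n}. L k \<omega>)) F"
    and close: "\<And>k \<delta>. k < n \<Longrightarrow> \<delta> > 0 \<Longrightarrow> ((\<lambda>r. measure M {\<omega> \<in> space M. \<delta> \<le> \<bar>X r k \<omega> - Z r k \<omega>\<bar>}) \<longlongrightarrow> 0) F"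
  shows "converges_in_distribution ({..<n} \<rightarrow>\<^sub>E (UNIV :: real set)) F
    M (\<lambda>r \<omega>. \<lambda>k\<in>{..<n}. X r k \<omega>) N (\<lambda>\<omega>. \<lambda>k\<in>{..<n}. L k \<omega>)"
  unfolding converges_in_distribution_def
proof (intro allI impI)
  fix f :: "(nat \<Rightarrow> real) \<Rightarrow> real"
  let ?S = "{..<n} \<rightarrow>\<^sub>E (UNIV :: real set)"
  assume cont: "continuous_on ?S f" and "bounded (f ` ?S)"
  then obtain B where B: "\<And>x. x \<in> ?S \<Longrightarrow> \<bar>f x\<bar> \<le> B"
    unfolding bounded_iff by auto
  have "(\<lambda>k\<in>{..<n}. 0) \<in> ?S" by auto
  with B have "B \<ge> 0" by (meson abs_ge_zero order_trans)
  interpret M: prob_space M by fact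
  interpret N: prob_space N by fact
  have f[measurable]: "f \<in> borel_measurable (coord_space n)"
    by (rule measurable_continuous_vector[OF cont])
  define vec where "vec z \<omega> = (\<lambda>k\<in>{..<n}. z k \<omega>)" for z :: "nat \<Rightarrow> 'w \<Rightarrow> real" and \<omega>
  define vecN where "vecN \<omega> = (\<lambda>k\<in>{..<n}. L k \<omega>)" for \<omega>
  have mZ[measurable]: "vec (Z r) \<in> measurable M (coord_space n)" for r
    unfolding vec_def by (intro measurable_restrict) auto
  have mL[measurable]: "vecN \<in> measurable N (coord_space n)"
    unfolding vecN_def by (intro measurable_restrict) auto
  have vec_S: "vec z \<omega> \<in> ?S" for z and \<omega> :: 'w by (auto simp: vec_def)
  show "((\<lambda>r. LINT \<omega>|M. f (\<lambda>k\<in>{..<n}. X r k \<omega>)) \<longlongrightarrow> (LINT \<omega>|N. f (\<lambda>k\<in>{..<n}. L k \<omega>))) F"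
    unfolding vec_def[symmetric] vecN_def[symmetric]
  proof (rule tendstoI)
    fix e :: real assume "e > 0"
    \<comment> \<open>Two events of probability below \<open>\<eta>\<close>, on which the test function moves by at most \<open>2 * B\<close>,
      contribute less than \<open>e / 2\<close>; the summand 1 covers the case \<open>B = 0\<close>.\<close>
    define \<eta> where "\<eta> = e / (4 * (2 * B + 1))"
    have "\<eta> > 0" using \<open>e > 0\<close> \<open>B \<ge> 0\<close> by (simp add: \<eta>_def)
    define out where "out K = {x \<in> space (coord_space n). \<exists>k<n. \<not> \<bar>x k\<bar> \<le> real K}" for K :: nat
    have out_sets[measurable]: "out K \<in> sets (coord_space n)" for K
    proof -
      have "{x \<in> space (coord_space n). \<not> \<bar>x k\<bar> \<le> real K} \<in> sets (coord_space n)" if "k < n" for k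
      proof -
        have [measurable]: "(\<lambda>x. x k) \<in> borel_measurable (coord_space n)"
          using that by (intro measurable_component_singleton) simp
        show ?thesis by measurable
      qed
      then have "(\<Union>k\<in>{..<n}. {x \<in> space (coord_space n). \<not> \<bar>x k\<bar> \<le> real K}) \<in> sets (coord_space n)"
        by (intro sets.finite_UN) auto
      also have "(\<Union>k\<in>{..<n}. {x \<in> space (coord_space n). \<not> \<bar>x k\<bar> \<le> real K}) = out K"
        by (auto simp: out_def)
      finally show ?thesis .
    qed
    have "(\<lambda>K. measure N {\<omega> \<in> space N. vecN \<omega> \<in> out K}) \<longlonglongrightarrow> measure N (\<Inter>K. {\<omega> \<in> space N. vecN \<omega> \<in> out K})"
    proof (rule N.finite_Lim_measure_decseq)
      show "range (\<lambda>K. {\<omega> \<in> space N. vecN \<omega> \<in> out K}) \<subseteq> sets N" by auto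
      show "decseq (\<lambda>K. {\<omega> \<in> space N. vecN \<omega> \<in> out K})"
        unfolding decseq_def out_def by (fastforce intro: order_trans)
    qed
    also have "(\<Inter>K. {\<omega> \<in> space N. vecN \<omega> \<in> out K}) = {}"
    proof -
      have "\<exists>K. \<forall>k<n. \<bar>x k\<bar> \<le> real K" for x :: "nat \<Rightarrow> real"
      proof -
        obtain K where "(\<Sum>k<n. \<bar>x k\<bar>) \<le> real K" using real_arch_simple by blast
        moreover have "\<bar>x k\<bar> \<le> (\<Sum>k<n. \<bar>x k\<bar>)" if "k < n" for k
          using that by (intro member_le_sum) auto
        ultimately show ?thesis by (meson order_trans)
      qed
      then show ?thesis by (fastforce simp: out_def)
    qed
    finally have "eventually (\<lambda>K. measure N {\<omega> \<in> space N. vecN \<omega> \<in> out K} < \<eta>) sequentially"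
      using \<open>\<eta> > 0\<close> by (auto dest: order_tendstoD(2)[of _ 0 _ \<eta>])
    then obtain K where K: "measure N {\<omega> \<in> space N. vecN \<omega> \<in> out K} < \<eta>"
      by (auto simp: eventually_sequentially)
    let ?C = "Pi\<^sub>E {..<n} (\<lambda>_. {- (real K + 1)..real K + 1})"
    have "uniformly_continuous_on ?C f"
      by (intro compact_uniformly_continuous compact_box continuous_on_subset[OF cont]) (auto simp: PiE_def)
    then obtain d where d: "d > 0" "\<And>x y. x \<in> ?C \<Longrightarrow> y \<in> ?C \<Longrightarrow> dist y x < d \<Longrightarrow> dist (f y) (f x) < e / 4"
      unfolding uniformly_continuous_on_def using \<open>e > 0\<close> by (metis divide_pos_pos zero_less_numeral)
    define \<delta> where "\<delta> = min 1 (d / 3)"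
    have \<delta>: "\<delta> > 0" "\<delta> \<le> 1" "2 * \<delta> < d" using d(1) by (auto simp: \<delta>_def)
    have fdist: "\<bar>f y - f x\<bar> \<le> e / 4" if "x \<in> ?S" "y \<in> ?S" "\<And>k. k < n \<Longrightarrow> \<bar>x k\<bar> \<le> real K" "\<And>k. k < n \<Longrightarrow> \<bar>y k - x k\<bar> < \<delta>" for x y
    proof -
      have "- (real K + 1) \<le> y k \<and> y k \<le> real K + 1" if "k < n" for k
        using \<open>\<And>k. k < n \<Longrightarrow> \<bar>x k\<bar> \<le> real K\<close>[OF that] \<open>\<And>k. k < n \<Longrightarrow> \<bar>y k - x k\<bar> < \<delta>\<close>[OF that] \<delta>(2) by linarith
      moreover have "- (real K + 1) \<le> x k \<and> x k \<le> real K + 1" if "k < n" for k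
        using \<open>\<And>k. k < n \<Longrightarrow> \<bar>x k\<bar> \<le> real K\<close>[OF that] by linarith
      ultimately have "x \<in> ?C" "y \<in> ?C"
        using that(1,2) by (auto simp: PiE_def Pi_def)
      moreover have "dist y x \<le> 2 * \<delta>"
      proof (rule dist_fun_coordinatewise)
        fix i show "dist (y i) (x i) \<le> \<delta>"
          using that(1,2) that(4)[of i] \<delta>(1) by (cases "i < n") (auto simp: dist_real_def PiE_def extensional_def)
      qed (use \<delta> in simp)
      ultimately show ?thesis
        using d(2)[of x y] \<delta>(3) by (simp add: dist_real_def)
    qed
    have "((\<lambda>r. measure M (\<Union>k\<in>{..<n}. {\<omega> \<in> space M. \<delta> \<le> \<bar>X r k \<omega> - Z r k \<omega>\<bar>})) \<longlongrightarrow> 0) F"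
    proof (rule tendsto_prob_0_finite)
      show "eventually (\<lambda>r. \<forall>k\<in>{..<n}. {\<omega> \<in> space M. \<delta> \<le> \<bar>X r k \<omega> - Z r k \<omega>\<bar>} \<in> sets M) F"
        using X
      proof eventually_elim
        case (elim r)
        have "{\<omega> \<in> space M. \<delta> \<le> \<bar>X r k \<omega> - Z r k \<omega>\<bar>} \<in> sets M" if "k < n" for k
        proof -
          have [measurable]: "X r k \<in> borel_measurable M" "Z r k \<in> borel_measurable M"
            using elim that Z by auto
          show ?thesis by measurable
        qed
        then show ?case by simp
      qed
    qed (use close \<delta>(1) M in auto)
    then have "eventually (\<lambda>r. measure M (\<Union>k\<in>{..<n}. {\<omega> \<in> space M. \<delta> \<le> \<bar>X r k \<omega> - Z r k \<omega>\<bar>}) < \<eta>) F"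
      using \<open>\<eta> > 0\<close> by (rule order_tendstoD(2))
    with X law show "eventually (\<lambda>r. dist (LINT \<omega>|M. f (vec (X r) \<omega>)) (LINT \<omega>|N. f (vecN \<omega>)) < e) F"
    proof eventually_elim
      case (elim r)
      have X'[measurable]: "X r k \<in> borel_measurable M" if "k < n" for k
        using elim(1) that by simp
      have mX[measurable]: "vec (X r) \<in> measurable M (coord_space n)"
        unfolding vec_def by (intro measurable_restrict) auto
      define E where "E = (\<Union>k\<in>{..<n}. {\<omega> \<in> space M. \<delta> \<le> \<bar>X r k \<omega> - Z r k \<omega>\<bar>})"
      have E[measurable]: "E \<in> sets M"
        unfolding E_def by (intro sets.finite_UN) auto
      have "measure M E < \<eta>"
        using elim(3) by (simp add: E_def)
      define H where "H = {\<omega> \<in> space M. vec (Z r) \<omega> \<in> out K}"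
      have H[measurable]: "H \<in> sets M" unfolding H_def by measurable
      have law': "distr M (coord_space n) (vec (Z r)) = distr N (coord_space n) vecN"
        using elim(2) by (simp add: vec_def[abs_def] vecN_def[abs_def])
      have "measure M H = measure (distr M (coord_space n) (vec (Z r))) (out K)"
        by (subst measure_distr) (auto simp: H_def vimage_def Int_def conj_commute)
      also have "\<dots> = measure N {\<omega> \<in> space N. vecN \<omega> \<in> out K}"
        unfolding law' by (subst measure_distr) (auto simp: vimage_def Int_def conj_commute)
      finally have "measure M H < \<eta>" using K by simp
      have eqZ: "(LINT \<omega>|N. f (vecN \<omega>)) = (LINT \<omega>|M. f (vec (Z r) \<omega>))"
      proof -
        have "(LINT \<omega>|N. f (vecN \<omega>)) = (LINT x|distr N (coord_space n) vecN. f x)"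
          by (subst integral_distr) auto
        also have "\<dots> = (LINT \<omega>|M. f (vec (Z r) \<omega>))"
          unfolding law'[symmetric] by (subst integral_distr) auto
        finally show ?thesis .
      qed
      have int: "integrable M (\<lambda>\<omega>. f (vec (X r) \<omega>))" "integrable M (\<lambda>\<omega>. f (vec (Z r) \<omega>))"
        using B[OF vec_S] by (auto intro!: M.integrable_const_bound[of _ B])
      have "\<bar>(LINT \<omega>|M. f (vec (X r) \<omega>)) - (LINT \<omega>|M. f (vec (Z r) \<omega>))\<bar> = \<bar>LINT \<omega>|M. f (vec (X r) \<omega>) - f (vec (Z r) \<omega>)\<bar>"
        using int by simp
      also have "\<dots> \<le> (LINT \<omega>|M. \<bar>f (vec (X r) \<omega>) - f (vec (Z r) \<omega>)\<bar>)"
        by (rule integral_abs_bound)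
      also have "\<dots> \<le> (LINT \<omega>|M. e / 4 + 2 * B * (indicator E \<omega> + indicator H \<omega>))"
      proof (rule integral_mono)
        show "integrable M (\<lambda>\<omega>. \<bar>f (vec (X r) \<omega>) - f (vec (Z r) \<omega>)\<bar>)"
          using int by (intro integrable_abs Bochner_Integration.integrable_diff)
        show "integrable M (\<lambda>\<omega>. e / 4 + 2 * B * (indicator E \<omega> + indicator H \<omega>))"
          by (intro Bochner_Integration.integrable_add integrable_mult_right integrable_real_indicator)
             (auto simp: M.emeasure_eq_measure)
        fix \<omega> assume \<omega>: "\<omega> \<in> space M"
        show "\<bar>f (vec (X r) \<omega>) - f (vec (Z r) \<omega>)\<bar> \<le> e / 4 + 2 * B * (indicator E \<omega> + indicator H \<omega>)"
        proof (cases "\<omega> \<in> E \<or> \<omega> \<in> H")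
          case True
          have "\<bar>f (vec (X r) \<omega>) - f (vec (Z r) \<omega>)\<bar> \<le> 2 * B * 1"
            using B[OF vec_S, of "X r" \<omega>] B[OF vec_S, of "Z r" \<omega>] by linarith
          also have "\<dots> \<le> 2 * B * (indicator E \<omega> + indicator H \<omega>)"
            using True \<open>B \<ge> 0\<close> by (intro mult_left_mono) (auto simp: indicator_def)
          finally show ?thesis using \<open>e > 0\<close> by linarith
        next
          case False
          have "\<bar>f (vec (X r) \<omega>) - f (vec (Z r) \<omega>)\<bar> \<le> e / 4"
          proof (rule fdist[OF vec_S vec_S])
            fix k assume "k < n"
            show "\<bar>vec (Z r) \<omega> k\<bar> \<le> real K"
              using False \<omega> \<open>k < n\<close> measurable_space[OF mZ \<omega>] unfolding H_def out_def by auto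
            show "\<bar>vec (X r) \<omega> k - vec (Z r) \<omega> k\<bar> < \<delta>"
              using False \<omega> \<open>k < n\<close> by (auto simp: E_def vec_def not_le)
          qed
          then show ?thesis using False by simp
        qed
      qed
      also have "\<dots> = e / 4 + 2 * B * (measure M E + measure M H)"
        by (simp add: M.prob_space M.emeasure_eq_measure integrable_real_indicator)
      also have "\<dots> \<le> e / 4 + 2 * B * (2 * \<eta>)"
        using \<open>measure M E < \<eta>\<close> \<open>measure M H < \<eta>\<close> \<open>B \<ge> 0\<close> by (intro add_left_mono mult_left_mono) auto
      also have "2 * B * (2 * \<eta>) \<le> e / 2"
      proof -
        have "4 * \<eta> * (2 * B + 1) = e" using \<open>B \<ge> 0\<close> by (simp add: \<eta>_def field_simps)
        then show ?thesis using \<open>\<eta> > 0\<close> by (simp add: algebra_simps)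
      qed
      finally show ?case
        using \<open>e > 0\<close> by (simp add: eqZ dist_real_def)
    qed
  qed
qed

section \<open>Dependence on the stability index\<close>

text \<open>The mean value theorem in the exponent. The derivative contributes the factor \<open>\<bar>ln x\<bar>\<close>, which is
  at most \<open>x powr e / e\<close> for \<open>x \<ge> 1\<close> and \<open>x powr (- e) / e\<close> for \<open>x \<le> 1\<close>; this widens the range of
  exponents by \<open>e\<close> on either side.\<close>

lemma powr_exponent_diff_le:
  fixes x :: real
  assumes x: "0 < x" and st: "s \<in> {p..q}" "t \<in> {p..q}" and "0 < e"
  shows "\<bar>x powr (- s) - x powr (- t)\<bar> \<le> \<bar>s - t\<bar> * ((x powr (- (p - e)) + x powr (- (q + e))) / e)"
proof -
  define K where "K = (x powr (- (p - e)) + x powr (- (q + e))) / e"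
  have deriv: "((\<lambda>z. x powr (- z)) has_real_derivative - ln x * x powr (- z)) (at z within {p..q})" for z
    using x by (auto intro!: derivative_eq_intros simp: powr_def)
  have bound: "norm (- ln x * x powr (- z)) \<le> K" if z: "z \<in> {p..q}" for z
  proof (cases "1 \<le> x")
    case True
    have "\<bar>ln x\<bar> * x powr (- z) \<le> (x powr e / e) * x powr (- p)"
      using True z \<open>0 < e\<close> ln_powr_bound[OF True \<open>0 < e\<close>] by (intro mult_mono powr_mono) auto
    also have "\<dots> = x powr (- (p - e)) / e"
      by (simp add: powr_add[symmetric])
    also have "\<dots> \<le> K"
      unfolding K_def using \<open>0 < e\<close> by (intro divide_right_mono) auto
    finally show ?thesis by (simp add: abs_mult)
  next
    case False
    have "ln (1 / x) \<le> (1 / x) powr e / e"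
      using False x \<open>0 < e\<close> by (intro ln_powr_bound) auto
    then have ln: "\<bar>ln x\<bar> \<le> x powr (- e) / e"
      using False x by (simp add: ln_div powr_divide powr_minus_divide)
    have "x powr (- z) \<le> x powr (- q)"
      using False x z by (intro powr_mono') auto
    then have "\<bar>ln x\<bar> * x powr (- z) \<le> (x powr (- e) / e) * x powr (- q)"
      using ln by (intro mult_mono) auto
    also have "\<dots> = x powr (- (q + e)) / e"
      by (simp add: powr_add[symmetric] add.commute)
    also have "\<dots> \<le> K"
      unfolding K_def using \<open>0 < e\<close> by (intro divide_right_mono) auto
    finally show ?thesis by (simp add: abs_mult)
  qed
  have "norm (x powr (- s) - x powr (- t)) \<le> K * norm (s - t)"
    by (rule field_differentiable_bound[OF _ deriv bound]) (use st in auto)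
  then show ?thesis by (simp add: K_def mult.commute)
qed

text \<open>The Lipschitz condition with one argument fixed at \<open>u\<close>. It suffices here, since every
  comparison is with the values at \<open>u\<close>, and it passes to the integral in the stable constant more
  easily than differentiability.\<close>

definition lipschitz_at :: "(real \<Rightarrow> real) \<Rightarrow> real \<Rightarrow> bool" where
  "lipschitz_at f u \<longleftrightarrow> (\<exists>K. eventually (\<lambda>v. \<bar>f v - f u\<bar> \<le> K * \<bar>v - u\<bar>) (nhds u))"

lemma lipschitz_atE:
  assumes "lipschitz_at f u"
  obtains K where "K > 0" "eventually (\<lambda>v. \<bar>f v - f u\<bar> \<le> K * \<bar>v - u\<bar>) (nhds u)"
proof -
  obtain K where K: "eventually (\<lambda>v. \<bar>f v - f u\<bar> \<le> K * \<bar>v - u\<bar>) (nhds u)"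
    using assms by (auto simp: lipschitz_at_def)
  have "eventually (\<lambda>v. \<bar>f v - f u\<bar> \<le> max K 1 * \<bar>v - u\<bar>) (nhds u)"
    using K
  proof eventually_elim
    case (elim v)
    have "K * \<bar>v - u\<bar> \<le> max K 1 * \<bar>v - u\<bar>" by (intro mult_right_mono) auto
    with elim show ?case by linarith
  qed
  then show ?thesis using that[of "max K 1"] by simp
qed

lemma lipschitz_at_tendsto:
  assumes "lipschitz_at f u"
  shows "(f \<longlongrightarrow> f u) (nhds u)"
proof -
  obtain K where K: "eventually (\<lambda>v. \<bar>f v - f u\<bar> \<le> K * \<bar>v - u\<bar>) (nhds u)"
    using assms by (auto simp: lipschitz_at_def)
  have "((\<lambda>v. K * \<bar>v - u\<bar>) \<longlongrightarrow> K * \<bar>u - u\<bar>) (nhds u)"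
    by (intro tendsto_intros filterlim_ident)
  then have "((\<lambda>v. f v - f u) \<longlongrightarrow> 0) (nhds u)"
    using K by (intro Lim_null_comparison[of "\<lambda>v. f v - f u"]) auto
  then show ?thesis by (simp add: LIM_zero_iff)
qed

lemma lipschitz_at_deriv:
  assumes "(f has_real_derivative D) (at u)"
  shows "lipschitz_at f u"
proof -
  have "((\<lambda>v. (f v - f u) / (v - u)) \<longlongrightarrow> D) (at u)"
    using assms by (simp add: has_field_derivative_iff)
  then have "eventually (\<lambda>v. \<bar>(f v - f u) / (v - u)\<bar> < \<bar>D\<bar> + 1) (at u)"
    by (intro order_tendstoD(2)[OF tendsto_rabs]) auto
  then have "eventually (\<lambda>v. \<bar>f v - f u\<bar> \<le> (\<bar>D\<bar> + 1) * \<bar>v - u\<bar>) (nhds u)"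
    unfolding eventually_at_filter
    by eventually_elim (auto simp: abs_divide field_simps split: if_splits)
  then show ?thesis by (auto simp: lipschitz_at_def)
qed

lemma lipschitz_at_compose:
  assumes f: "lipschitz_at f u" and g: "lipschitz_at g (f u)"
  shows "lipschitz_at (\<lambda>v. g (f v)) u"
proof -
  obtain K where K: "K > 0" "eventually (\<lambda>v. \<bar>f v - f u\<bar> \<le> K * \<bar>v - u\<bar>) (nhds u)"
    using f by (rule lipschitz_atE)
  obtain L where L: "L > 0" "eventually (\<lambda>w. \<bar>g w - g (f u)\<bar> \<le> L * \<bar>w - f u\<bar>) (nhds (f u))"
    using g by (rule lipschitz_atE)
  have "eventually (\<lambda>v. \<bar>g (f v) - g (f u)\<bar> \<le> L * \<bar>f v - f u\<bar>) (nhds u)"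
    using L(2) lipschitz_at_tendsto[OF f] by (rule eventually_compose_filterlim)
  with K(2) have "eventually (\<lambda>v. \<bar>g (f v) - g (f u)\<bar> \<le> (L * K) * \<bar>v - u\<bar>) (nhds u)"
  proof eventually_elim
    case (elim v)
    have "L * \<bar>f v - f u\<bar> \<le> L * (K * \<bar>v - u\<bar>)"
      using elim L by (intro mult_left_mono) auto
    with elim show ?case by (simp add: mult.assoc)
  qed
  then show ?thesis by (auto simp: lipschitz_at_def)
qed

lemma lipschitz_at_mult:
  assumes f: "lipschitz_at f u" and g: "lipschitz_at g u"
  shows "lipschitz_at (\<lambda>v. f v * g v) u"
proof -
  obtain K where K: "K > 0" "eventually (\<lambda>v. \<bar>f v - f u\<bar> \<le> K * \<bar>v - u\<bar>) (nhds u)"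
    using f by (rule lipschitz_atE)
  obtain L where L: "L > 0" "eventually (\<lambda>v. \<bar>g v - g u\<bar> \<le> L * \<bar>v - u\<bar>) (nhds u)"
    using g by (rule lipschitz_atE)
  have "eventually (\<lambda>v. \<bar>f v\<bar> < \<bar>f u\<bar> + 1) (nhds u)"
    by (intro order_tendstoD(2)[OF tendsto_rabs[OF lipschitz_at_tendsto[OF f]]]) auto
  with K(2) L(2) have "eventually (\<lambda>v. \<bar>f v * g v - f u * g u\<bar> \<le> ((\<bar>f u\<bar> + 1) * L + \<bar>g u\<bar> * K) * \<bar>v - u\<bar>) (nhds u)"
  proof eventually_elim
    case (elim v)
    have "f v * g v - f u * g u = f v * (g v - g u) + g u * (f v - f u)"
      by (simp add: algebra_simps)
    then have "\<bar>f v * g v - f u * g u\<bar> \<le> \<bar>f v\<bar> * \<bar>g v - g u\<bar> + \<bar>g u\<bar> * \<bar>f v - f u\<bar>"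
      by (metis abs_mult abs_triangle_ineq)
    also have "\<dots> \<le> (\<bar>f u\<bar> + 1) * (L * \<bar>v - u\<bar>) + \<bar>g u\<bar> * (K * \<bar>v - u\<bar>)"
      using elim by (intro add_mono mult_mono) auto
    finally show ?case by (simp add: algebra_simps)
  qed
  then show ?thesis by (auto simp: lipschitz_at_def)
qed

lemma lipschitz_at_cong:
  assumes "lipschitz_at f u" "eventually (\<lambda>v. f v = g v) (nhds u)"
  shows "lipschitz_at g u"
proof -
  have "f u = g u" using assms(2) by (rule eventually_nhds_x_imp_x)
  obtain K where "eventually (\<lambda>v. \<bar>f v - f u\<bar> \<le> K * \<bar>v - u\<bar>) (nhds u)"
    using assms(1) by (auto simp: lipschitz_at_def)
  with assms(2) have "eventually (\<lambda>v. \<bar>g v - g u\<bar> \<le> K * \<bar>v - u\<bar>) (nhds u)"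
    by eventually_elim (simp add: \<open>f u = g u\<close>)
  then show ?thesis by (auto simp: lipschitz_at_def)
qed

text \<open>The bound on differences of powers is integrable against \<open>\<bar>sin y\<bar>\<close> as long as the widened range
  of exponents stays inside \<open>(1, 2)\<close>.\<close>

lemma lipschitz_at_stable_integral:
  fixes a :: real
  assumes "1 < a" "a < 2"
  shows "lipschitz_at (\<lambda>a. LBINT y:{0<..}. y powr (- a) * sin y) a"
proof -
  define e where "e = min (a - 1) (2 - a) / 3"
  have "e > 0" "3 * e \<le> a - 1" "3 * e \<le> 2 - a"
    using assms by (simp_all add: e_def)
  then have e: "e > 0" "1 < a - e - e" "a + e + e < 2"
    by linarith+
  let ?I = "\<lambda>a. LBINT y:{0<..}. y powr (- a) * sin y"
  let ?g = "\<lambda>y. (y powr (- (a - e - e)) + y powr (- (a + e + e))) / e * \<bar>sin y\<bar>"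
  have "set_integrable lborel {0<..} (\<lambda>y. \<bar>y powr (- s) * sin y\<bar>)" if "1 < s" "s < 2" for s :: real
    using set_integrable_abs[OF set_integrable_sin_powr[OF that]] .
  then have abs: "set_integrable lborel {0<..} (\<lambda>y. y powr (- s) * \<bar>sin y\<bar>)" if "1 < s" "s < 2" for s :: real
    using that by (simp add: abs_mult)
  have "set_integrable lborel {0<..} (\<lambda>y. (y powr (- (a - e - e)) * \<bar>sin y\<bar> + y powr (- (a + e + e)) * \<bar>sin y\<bar>) / e)"
    using e by (intro set_integral_divide_zero set_integrable_divide set_integral_add abs) auto
  then have int: "set_integrable lborel {0<..} ?g"
    by (simp add: algebra_simps add_divide_distrib)
  have "\<bar>?I v - ?I a\<bar> \<le> (LBINT y:{0<..}. ?g y) * \<bar>v - a\<bar>" if v: "v \<in> {a - e..a + e}" for v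
  proof -
    have i: "set_integrable lborel {0<..} (\<lambda>y. y powr (- s) * sin y)" if "s \<in> {a - e..a + e}" for s
      using that e by (intro set_integrable_sin_powr) auto
    have "?I v - ?I a = (LBINT y:{0<..}. y powr (- v) * sin y - y powr (- a) * sin y)"
      using v e by (intro set_integral_diff(2)[symmetric] i) auto
    also have "\<bar>\<dots>\<bar> \<le> (LBINT y:{0<..}. \<bar>y powr (- v) * sin y - y powr (- a) * sin y\<bar>)"
      unfolding set_lebesgue_integral_def
      by (rule order_trans[OF integral_abs_bound]) (simp add: abs_mult)
    also have "\<dots> \<le> (LBINT y:{0<..}. ?g y * \<bar>v - a\<bar>)"
    proof (rule set_integral_mono)
      show "set_integrable lborel {0<..} (\<lambda>y. \<bar>y powr (- v) * sin y - y powr (- a) * sin y\<bar>)"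
        using v e by (intro set_integrable_abs set_integral_diff(1) i) auto
      show "set_integrable lborel {0<..} (\<lambda>y. ?g y * \<bar>v - a\<bar>)"
        using int by (rule set_integrable_mult_left)
      fix y :: real assume "y \<in> {0<..}"
      then have "\<bar>y powr (- v) - y powr (- a)\<bar> \<le> \<bar>v - a\<bar> * ((y powr (- (a - e - e)) + y powr (- (a + e + e))) / e)"
        using v e by (intro powr_exponent_diff_le) auto
      then have "\<bar>y powr (- v) - y powr (- a)\<bar> * \<bar>sin y\<bar> \<le> \<bar>v - a\<bar> * ((y powr (- (a - e - e)) + y powr (- (a + e + e))) / e) * \<bar>sin y\<bar>"
        by (intro mult_right_mono) auto
      moreover have "\<bar>y powr (- v) * sin y - y powr (- a) * sin y\<bar> = \<bar>y powr (- v) - y powr (- a)\<bar> * \<bar>sin y\<bar>"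
        by (simp only: left_diff_distrib[symmetric] abs_mult)
      ultimately show "\<bar>y powr (- v) * sin y - y powr (- a) * sin y\<bar> \<le> ?g y * \<bar>v - a\<bar>"
        by (simp only: mult_ac)
    qed
    also have "\<dots> = (LBINT y:{0<..}. ?g y) * \<bar>v - a\<bar>"
      by (rule set_integral_mult_left)
    finally show ?thesis .
  qed
  moreover have "eventually (\<lambda>v. v \<in> {a - e..a + e}) (nhds a)"
    using e by (intro eventually_mono[OF eventually_nhds_in_open[of "{a - e<..<a + e}" a]]) auto
  ultimately have "eventually (\<lambda>v. \<bar>?I v - ?I a\<bar> \<le> (LBINT y:{0<..}. ?g y) * \<bar>v - a\<bar>) (nhds a)"
    by (elim eventually_mono) blast
  then show ?thesis unfolding lipschitz_at_def by blast
qed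

lemma stable_const_positive:
  assumes "1 < a" "a < 2"
  shows "0 < stable_const a"
  using sin_powr_integral_pos[OF assms] by (simp add: stable_const_def)

lemma lipschitz_at_scale:
  fixes T a :: real
  assumes "1 < a" "a < 2" "T > 0"
  shows "lipschitz_at (\<lambda>a. stable_const a powr (1 / a) * T powr (1 / a)) a"
proof -
  let ?I = "\<lambda>a. LBINT y:{0<..}. y powr (- a) * sin y"
  have deriv: "((\<lambda>v. - ln v + ln T) has_real_derivative - inverse v) (at v)" if "v > 0" for v :: real
    using that by (auto intro!: derivative_eq_intros simp: inverse_eq_divide)
  have "lipschitz_at (\<lambda>a. - ln (?I a) + ln T) a"
    by (rule lipschitz_at_compose[OF lipschitz_at_stable_integral[OF assms(1,2)]
          lipschitz_at_deriv[OF deriv[OF sin_powr_integral_pos[OF assms(1,2)]]]])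
  moreover have "lipschitz_at (\<lambda>a. 1 / a) a"
    using assms by (intro lipschitz_at_deriv[of _ "- 1 / (a * a)"]) (auto intro!: derivative_eq_intros)
  ultimately have "lipschitz_at (\<lambda>a. (1 / a) * (- ln (?I a) + ln T)) a"
    by (intro lipschitz_at_mult)
  then have "lipschitz_at (\<lambda>a. exp ((1 / a) * (- ln (?I a) + ln T))) a"
    by (rule lipschitz_at_compose[OF _ lipschitz_at_deriv[OF DERIV_exp]])
  moreover have "eventually (\<lambda>a. exp ((1 / a) * (- ln (?I a) + ln T)) = stable_const a powr (1 / a) * T powr (1 / a)) (nhds a)"
  proof (rule eventually_mono[OF eventually_nhds_in_open[of "{1<..<2}" a]])
    fix v :: real assume "v \<in> {1<..<2}"
    then have "?I v > 0" by (intro sin_powr_integral_pos) auto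
    then show "exp ((1 / v) * (- ln (?I v) + ln T)) = stable_const v powr (1 / v) * T powr (1 / v)"
      using \<open>T > 0\<close> by (simp add: stable_const_def powr_def ln_inverse exp_add[symmetric] algebra_simps add_divide_distrib)
  qed (use assms in auto)
  ultimately show ?thesis by (rule lipschitz_at_cong)
qed

section \<open>Levy motion\<close>

text \<open>The integrand whose stable integral is the Levy motion at time \<open>t\<close>; the sign is the orientation of
  the integral for negative times.\<close>

definition levy_kernel :: "real \<Rightarrow> real \<Rightarrow> real" where
  "levy_kernel t x = (if 0 \<le> t then indicator {0..t} x else - indicator {t..0} x)"

lemma levy_kernel_measurable[measurable]: "levy_kernel t \<in> borel_measurable borel"
  unfolding levy_kernel_def by measurable

lemma levy_kernel_sum_in_L_space:
  assumes "a > 0" "finite K"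
  shows "(\<lambda>x. \<Sum>k\<in>K. \<theta> k * levy_kernel (\<tau> k) x) \<in> L_space a"
proof -
  let ?C = "\<Sum>k\<in>K. \<bar>\<theta> k\<bar>" and ?R = "\<Sum>k\<in>K. \<bar>\<tau> k\<bar>"
  have bound: "\<bar>\<Sum>k\<in>K. \<theta> k * levy_kernel (\<tau> k) x\<bar> \<le> ?C * indicator {- ?R..?R} x" for x
  proof (cases "x \<in> {- ?R..?R}")
    case True
    have "\<bar>\<Sum>k\<in>K. \<theta> k * levy_kernel (\<tau> k) x\<bar> \<le> (\<Sum>k\<in>K. \<bar>\<theta> k * levy_kernel (\<tau> k) x\<bar>)"
      by (rule sum_abs)
    also have "\<dots> \<le> ?C"
      by (intro sum_mono) (auto simp: levy_kernel_def abs_mult indicator_def)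
    finally show ?thesis using True by simp
  next
    case False
    have "levy_kernel (\<tau> k) x = 0" if "k \<in> K" for k
    proof -
      have "\<bar>\<tau> k\<bar> \<le> ?R" using \<open>finite K\<close> that by (intro member_le_sum) auto
      then show ?thesis using False by (auto simp: levy_kernel_def indicator_def)
    qed
    then show ?thesis using False by simp
  qed
  have "integrable lborel (\<lambda>x. \<bar>\<Sum>k\<in>K. \<theta> k * levy_kernel (\<tau> k) x\<bar> powr a)"
  proof (rule Bochner_Integration.integrable_bound)
    show "integrable lborel (\<lambda>x. ?C powr a * indicator {- ?R..?R} x)"
      by (intro integrable_mult_right integrable_real_indicator) (auto simp: emeasure_lborel_Icc_eq)
    have "\<bar>\<Sum>k\<in>K. \<theta> k * levy_kernel (\<tau> k) x\<bar> powr a \<le> (?C * indicator {- ?R..?R} x) powr a" for x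
      using bound assms by (intro powr_mono2) auto
    also have "(?C * indicator {- ?R..?R} x) powr a = ?C powr a * indicator {- ?R..?R} x" for x
      using assms by (cases "x \<in> {- ?R..?R}") auto
    finally have "norm (\<bar>\<Sum>k\<in>K. \<theta> k * levy_kernel (\<tau> k) x\<bar> powr a) \<le> norm (?C powr a * indicator {- ?R..?R} x)" for x
      unfolding real_norm_def by (simp only: abs_of_nonneg powr_ge_zero mult_nonneg_nonneg indicator_pos_le)
    then show "AE x in lborel. norm (\<bar>\<Sum>k\<in>K. \<theta> k * levy_kernel (\<tau> k) x\<bar> powr a) \<le> norm (?C powr a * indicator {- ?R..?R} x)"
      by (rule AE_I2)
  qed measurable
  then show ?thesis by (simp add: L_space_def)
qed

lemma levy_kernel_in_L_space: "a > 0 \<Longrightarrow> levy_kernel t \<in> L_space a"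
  using levy_kernel_sum_in_L_space[of a "{()}" "\<lambda>_. 1" "\<lambda>_. t"] by simp

context
  fixes a :: real and N :: "'v measure" and \<Phi> :: "(real \<Rightarrow> real) \<Rightarrow> 'v \<Rightarrow> real"
  assumes a: "a > 0" and \<Phi>: "stable_integral a N \<Phi>"
begin

lemma stable_integral_measurable: "f \<in> L_space a \<Longrightarrow> \<Phi> f \<in> borel_measurable N"
  using \<Phi> by (simp add: stable_integral_def)

lemma stable_integral_linear:
  "f \<in> L_space a \<Longrightarrow> g \<in> L_space a \<Longrightarrow> AE \<omega> in N. \<Phi> (\<lambda>x. p * f x + q * g x) \<omega> = p * \<Phi> f \<omega> + q * \<Phi> g \<omega>"
  using \<Phi> unfolding stable_integral_def by blast

lemma stable_integral_sum:
  "AE \<omega> in N. \<Phi> (\<lambda>x. \<Sum>k<n. \<theta> k * levy_kernel (\<tau> k) x) \<omega> = (\<Sum>k<n::nat. \<theta> k * \<Phi> (levy_kernel (\<tau> k)) \<omega>)"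
proof (induction n)
  case 0
  show ?case
    using stable_integral_linear[OF levy_kernel_in_L_space levy_kernel_in_L_space, OF a a, of 0 0 0 0] by simp
next
  case (Suc n)
  have "AE \<omega> in N. \<Phi> (\<lambda>x. 1 * (\<Sum>k<n. \<theta> k * levy_kernel (\<tau> k) x) + \<theta> n * levy_kernel (\<tau> n) x) \<omega> =
      1 * \<Phi> (\<lambda>x. \<Sum>k<n. \<theta> k * levy_kernel (\<tau> k) x) \<omega> + \<theta> n * \<Phi> (levy_kernel (\<tau> n)) \<omega>"
    by (rule stable_integral_linear[OF levy_kernel_sum_in_L_space levy_kernel_in_L_space]) (use a in auto)
  with Suc show ?case
    by eventually_elim simp
qed

lemma AE_levy_motion: "AE \<omega> in N. levy_motion \<Phi> t \<omega> = \<Phi> (levy_kernel t) \<omega>"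
proof (cases "0 \<le> t")
  case True
  then have "levy_kernel t = indicator {0..t}" by (simp add: levy_kernel_def fun_eq_iff)
  then show ?thesis using True by (simp add: levy_motion_def)
next
  case False
  have neg: "levy_kernel t x = - indicator {t..0} x" for x
    using False by (simp add: levy_kernel_def)
  have "indicator {t..0} = (\<lambda>x. - 1 * levy_kernel t x + 0 * levy_kernel t x)"
    by (simp add: neg fun_eq_iff)
  then have "AE \<omega> in N. \<Phi> (indicator {t..0}) \<omega> = - 1 * \<Phi> (levy_kernel t) \<omega> + 0 * \<Phi> (levy_kernel t) \<omega>"
    using stable_integral_linear[OF levy_kernel_in_L_space levy_kernel_in_L_space, OF a a] by metis
  then show ?thesis
    using False by (auto simp: levy_motion_def)
qed

lemma levy_motion_measurable: "levy_motion \<Phi> t \<in> borel_measurable N"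
proof (cases "0 \<le> t")
  case True
  then have "levy_kernel t = indicator {0..t}" by (simp add: levy_kernel_def fun_eq_iff)
  moreover have "levy_motion \<Phi> t = \<Phi> (indicator {0..t})"
    using True by (simp add: levy_motion_def fun_eq_iff)
  ultimately show ?thesis
    using stable_integral_measurable[OF levy_kernel_in_L_space[OF a], of t] by simp
next
  case False
  have "indicator {t..0} = (\<lambda>x. \<Sum>k\<in>{()}. - 1 * levy_kernel t x)"
    using False by (simp add: levy_kernel_def fun_eq_iff)
  then have "\<Phi> (indicator {t..0}) \<in> borel_measurable N"
    using stable_integral_measurable[OF levy_kernel_sum_in_L_space[OF a, of "{()}" "\<lambda>_. - 1" "\<lambda>_. t"]] by simp
  moreover have "levy_motion \<Phi> t = (\<lambda>\<omega>. - \<Phi> (indicator {t..0}) \<omega>)"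
    using False by (simp add: levy_motion_def fun_eq_iff)
  ultimately show ?thesis by simp
qed

text \<open>Linearity of the stable integral reduces a joint characteristic function to that of one integral.\<close>

lemma char_levy_motion:
  assumes "\<beta> > 0"
  shows "(LINT \<omega>|N. iexp (\<Sum>k<n::nat. \<theta> k * (\<beta> * levy_motion \<Phi> (\<tau> k) \<omega>))) =
    complex_of_real (exp (- (\<beta> powr a * (LINT x|lborel. \<bar>\<Sum>k<n. \<theta> k * levy_kernel (\<tau> k) x\<bar> powr a))))"
proof -
  let ?f = "\<lambda>x. \<Sum>k<n. \<theta> k * levy_kernel (\<tau> k) x"
  have f: "?f \<in> L_space a" by (intro levy_kernel_sum_in_L_space a) simp
  have "AE \<omega> in N. \<forall>k. levy_motion \<Phi> (\<tau> k) \<omega> = \<Phi> (levy_kernel (\<tau> k)) \<omega>"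
    using AE_levy_motion by (simp add: AE_all_countable)
  then have ae: "AE \<omega> in N. (\<Sum>k<n. \<theta> k * (\<beta> * levy_motion \<Phi> (\<tau> k) \<omega>)) = \<beta> * \<Phi> ?f \<omega>"
    using stable_integral_sum[of \<theta> \<tau> n] by eventually_elim (simp add: sum_distrib_left mult_ac)
  have [measurable]: "levy_motion \<Phi> t \<in> borel_measurable N" "\<Phi> ?f \<in> borel_measurable N" for t
    using levy_motion_measurable stable_integral_measurable[OF f] by auto
  have "(LINT \<omega>|N. iexp (\<Sum>k<n. \<theta> k * (\<beta> * levy_motion \<Phi> (\<tau> k) \<omega>))) = (LINT \<omega>|N. iexp (\<beta> * \<Phi> ?f \<omega>))"
    using ae by (intro integral_cong_AE) (auto elim!: eventually_mono simp del: of_real_sum of_real_mult)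
  also have "\<dots> = char (distr N borel (\<Phi> ?f)) \<beta>"
    unfolding char_def by (subst integral_distr) auto
  also have "\<dots> = complex_of_real (exp (- (\<bar>\<beta>\<bar> powr a * (LINT x|lborel. \<bar>?f x\<bar> powr a))))"
    using \<Phi> f unfolding stable_integral_def by blast
  finally show ?thesis using assms by simp
qed

end

section \<open>The local form of the multistable process\<close>

lemma integral_uniform_interval:
  fixes g :: "real \<Rightarrow> real"
  assumes "T > 0" and [measurable]: "g \<in> borel_measurable borel"
  shows "(LINT x|uniform_measure lborel {0..T}. g x) = (LINT x|lborel. indicator {0..T} x * g x) / T"
proof -
  have "uniform_measure lborel {0..T} = density lborel (\<lambda>x. ennreal (indicator {0..T} x / T))"
    unfolding uniform_measure_def using \<open>T > 0\<close>
    by (intro density_cong) (auto simp: indicator_def divide_ennreal[symmetric] simp flip: ennreal_1)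
  then have "(LINT x|uniform_measure lborel {0..T}. g x) = (LINT x|lborel. (indicator {0..T} x / T) *\<^sub>R g x)"
    using \<open>T > 0\<close> by (simp add: integral_density)
  then show ?thesis by simp
qed

lemma (in prob_space) tail_prob_small:
  fixes X :: "'a \<Rightarrow> real"
  assumes [measurable]: "X \<in> borel_measurable M" and "\<eta> > 0"
  shows "\<exists>K::nat. prob {\<omega> \<in> space M. \<not> X \<omega> \<le> real K} < \<eta>"
proof -
  let ?A = "\<lambda>K. {\<omega> \<in> space M. \<not> X \<omega> \<le> real K}"
  have "(\<lambda>K. prob (?A K)) \<longlonglongrightarrow> prob (\<Inter>K. ?A K)"
  proof (rule finite_Lim_measure_decseq)
    show "range ?A \<subseteq> events" by auto
    show "decseq ?A" by (auto simp: decseq_def)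
  qed
  also have "(\<Inter>K. ?A K) = {}"
    using real_arch_simple by (fastforce simp: not_le)
  finally have "eventually (\<lambda>K. prob (?A K) < \<eta>) sequentially"
    using \<open>\<eta> > 0\<close> by (auto dest: order_tendstoD(2)[of _ 0 _ \<eta>])
  then show ?thesis by (auto simp: eventually_sequentially)
qed

locale multistable = poisson_sign_series M \<epsilon> N \<Gamma> V
  for M :: "'w measure" and \<epsilon> :: "nat \<Rightarrow> 'w \<Rightarrow> real"
    and N :: "real \<Rightarrow> 'w \<Rightarrow> nat" and \<Gamma> :: "nat \<Rightarrow> 'w \<Rightarrow> real" and V :: "nat \<Rightarrow> 'w \<Rightarrow> real" +
  fixes T c d u :: real and \<alpha> b :: "real \<Rightarrow> real" and Y :: "real \<Rightarrow> 'w \<Rightarrow> real"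
  assumes uniform_marks: "distr M borel (V 0) = uniform_measure lborel {0..T}"
    and u: "0 < u" "u < T"
    and \<alpha>_range: "1 < c" "d < 2" "\<And>t. t \<in> {0..T} \<Longrightarrow> \<alpha> t \<in> {c..d}"
    and \<alpha>_lipschitz: "lipschitz_at \<alpha> u"
    and b_lipschitz: "lipschitz_at b u" and b_pos: "0 < b u"
    and Y_eq: "\<And>t \<omega>. t \<in> {0..T} \<Longrightarrow> \<omega> \<in> space M \<Longrightarrow>
      Y t \<omega> = b t * stable_const (\<alpha> t) powr (1 / \<alpha> t) * T powr (1 / \<alpha> t) *
        (\<Sum>i. \<epsilon> i \<omega> * \<Gamma> i \<omega> powr (- (1 / \<alpha> t)) * indicator {0..t} (V i \<omega>))"
begin

abbreviation "a \<equiv> \<alpha> u"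

definition amplitude :: "real \<Rightarrow> real" where
  "amplitude t = b t * (stable_const (\<alpha> t) powr (1 / \<alpha> t) * T powr (1 / \<alpha> t))"

text \<open>The series for a constant index \<open>s\<close>, which is a stable integral of \<open>f\<close> over \<open>[0, T]\<close> up to a
  constant factor.\<close>

definition frozen :: "real \<Rightarrow> (real \<Rightarrow> real) \<Rightarrow> 'w \<Rightarrow> real" where
  "frozen s f \<omega> = (\<Sum>i. \<epsilon> i \<omega> * (\<Gamma> i \<omega> powr (- (1 / s)) * f (V i \<omega>)))"

text \<open>The rescaled increment with index and amplitude held at their values at \<open>u\<close>, so that only the
  indicator moves.\<close>

definition stable_increment :: "real \<Rightarrow> real \<Rightarrow> 'w \<Rightarrow> real" where
  "stable_increment r t \<omega> =
     r powr (- (1 / a)) * amplitude u * frozen a (\<lambda>v. indicator {0..u + r * t} v - indicator {0..u} v) \<omega>"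

lemma index_range: "t \<in> {0..T} \<Longrightarrow> 1 < \<alpha> t \<and> \<alpha> t < 2"
  using \<alpha>_range(1,2) \<alpha>_range(3)[of t] by auto

lemma a: "1 < a" "a < 2"
  using index_range[of u] u by auto

lemma frozen_measurable[measurable (raw)]:
  assumes [measurable]: "f \<in> borel_measurable borel"
  shows "frozen s f \<in> borel_measurable M"
  unfolding frozen_def by measurable

lemma stable_increment_measurable[measurable]: "stable_increment r t \<in> borel_measurable M"
  unfolding stable_increment_def by measurable

lemma Y_frozen: "t \<in> {0..T} \<Longrightarrow> \<omega> \<in> space M \<Longrightarrow> Y t \<omega> = amplitude t * frozen (\<alpha> t) (indicator {0..t}) \<omega>"
  by (simp add: Y_eq amplitude_def frozen_def mult.assoc)

lemma Y_measurable: "t \<in> {0..T} \<Longrightarrow> Y t \<in> borel_measurable M"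
  by (subst measurable_cong[OF Y_frozen]) measurable

lemma AE_summable_frozen:
  assumes "1 < s" "s < 2" "f \<in> borel_measurable borel" "\<And>v. \<bar>f v\<bar> \<le> B"
  shows "AE \<omega> in M. summable (\<lambda>i. \<epsilon> i \<omega> * (\<Gamma> i \<omega> powr (- (1 / s)) * f (V i \<omega>)))"
  using AE_summable_lepage[OF assms] by simp

text \<open>The two exceptional points come from the end points of the intervals: the increment of the
  indicator is half-open, the kernel is closed.\<close>

lemma increment_kernel:
  assumes "r > 0" "u + r * t \<in> {0..T}" "v \<noteq> u" "v \<noteq> u + r * t"
  shows "indicator {0..u + r * t} v - indicator {0..u} v = levy_kernel t ((v - u) / r)"
proof -
  have iff: "(v - u) / r \<le> t \<longleftrightarrow> v \<le> u + r * t" "t \<le> (v - u) / r \<longleftrightarrow> u + r * t \<le> v"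
    "0 \<le> (v - u) / r \<longleftrightarrow> u \<le> v" "(v - u) / r \<le> 0 \<longleftrightarrow> v \<le> u"
    using \<open>r > 0\<close> by (simp_all add: pos_divide_le_eq pos_le_divide_eq algebra_simps)
  show ?thesis
  proof (cases "0 \<le> t")
    case True
    then have "u \<le> u + r * t" using \<open>r > 0\<close> by simp
    moreover have "levy_kernel t ((v - u) / r) = (if u \<le> v \<and> v \<le> u + r * t then 1 else 0)"
      using True by (simp only: levy_kernel_def indicator_def atLeastAtMost_iff iff if_True of_bool_def)
    ultimately show ?thesis
      using assms(3) u by (auto simp: indicator_def)
  next
    case False
    then have "u + r * t \<le> u" using \<open>r > 0\<close> by (simp add: mult_le_0_iff)
    moreover have "levy_kernel t ((v - u) / r) = - (if u + r * t \<le> v \<and> v \<le> u then 1 else 0)"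
      using False by (simp only: levy_kernel_def indicator_def atLeastAtMost_iff iff if_False of_bool_def)
    ultimately show ?thesis
      using assms(2,4) u by (auto simp: indicator_def)
  qed
qed

text \<open>The substitution \<open>v = u + r x\<close> yields a factor \<open>r\<close> in the exponent, which the power \<open>a\<close> of
  \<open>r powr (- (1 / a))\<close> cancels; the density \<open>1 / T\<close> of the marks and the stable constant cancel against the amplitude.\<close>

lemma char_stable_increment:
  assumes "finite K" "r > 0" and \<tau>: "\<And>k. k \<in> K \<Longrightarrow> u + r * \<tau> k \<in> {0..T}"
  shows "(LINT \<omega>|M. iexp (\<Sum>k\<in>K. \<theta> k * stable_increment r (\<tau> k) \<omega>)) =
    complex_of_real (exp (- (b u powr a * (LINT x|lborel. \<bar>\<Sum>k\<in>K. \<theta> k * levy_kernel (\<tau> k) x\<bar> powr a))))"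
proof -
  define f where "f k v = (indicator {0..u + r * \<tau> k} v - indicator {0..u} v :: real)" for k v
  define F where "F v = (\<Sum>k\<in>K. \<theta> k * f k v)" for v
  define G where "G x = (\<Sum>k\<in>K. \<theta> k * levy_kernel (\<tau> k) x)" for x
  define \<rho> where "\<rho> = r powr (- (1 / a)) * amplitude u"
  have [measurable]: "f k \<in> borel_measurable borel" for k unfolding f_def by measurable
  have [measurable]: "F \<in> borel_measurable borel" unfolding F_def by measurable
  have [measurable]: "G \<in> borel_measurable borel" unfolding G_def by measurable
  have f_bound: "\<bar>f k v\<bar> \<le> 1" for k v by (auto simp: f_def indicator_def)
  have F_bound: "\<bar>F v\<bar> \<le> (\<Sum>k\<in>K. \<bar>\<theta> k\<bar>)" for v
    unfolding F_def by (rule order_trans[OF sum_abs sum_mono]) (use f_bound in \<open>auto simp: abs_mult mult_left_le\<close>)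
  have "T > 0" using u by simp
  have const: "stable_const a > 0" by (rule stable_const_positive[OF a])
  have "AE \<omega> in M. summable (\<lambda>i. \<epsilon> i \<omega> * (\<Gamma> i \<omega> powr (- (1 / a)) * f k (V i \<omega>)))" for k
    by (rule AE_summable_frozen[OF a, of "f k" 1]) (use f_bound in auto)
  then have "AE \<omega> in M. \<forall>k\<in>K. summable (\<lambda>i. \<epsilon> i \<omega> * (\<Gamma> i \<omega> powr (- (1 / a)) * f k (V i \<omega>)))"
    using \<open>finite K\<close> by (intro AE_finite_allI) auto
  then have "AE \<omega> in M. (\<Sum>k\<in>K. \<theta> k * stable_increment r (\<tau> k) \<omega>) = \<rho> * frozen a F \<omega>"
  proof eventually_elim
    case (elim \<omega>)
    have "(\<Sum>k\<in>K. \<theta> k * stable_increment r (\<tau> k) \<omega>) = \<rho> * (\<Sum>k\<in>K. \<theta> k * frozen a (f k) \<omega>)"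
      by (simp add: stable_increment_def f_def[abs_def] \<rho>_def sum_distrib_left mult_ac)
    also have "(\<Sum>k\<in>K. \<theta> k * frozen a (f k) \<omega>) = (\<Sum>k\<in>K. \<Sum>i. \<theta> k * (\<epsilon> i \<omega> * (\<Gamma> i \<omega> powr (- (1 / a)) * f k (V i \<omega>))))"
      unfolding frozen_def using elim by (intro sum.cong refl suminf_mult[symmetric]) auto
    also have "\<dots> = (\<Sum>i. \<Sum>k\<in>K. \<theta> k * (\<epsilon> i \<omega> * (\<Gamma> i \<omega> powr (- (1 / a)) * f k (V i \<omega>))))"
      using elim by (intro suminf_sum[symmetric] summable_mult) auto
    also have "\<dots> = frozen a F \<omega>"
      unfolding frozen_def F_def by (simp add: sum_distrib_left mult_ac)
    finally show ?case .
  qed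
  then have "(LINT \<omega>|M. iexp (\<Sum>k\<in>K. \<theta> k * stable_increment r (\<tau> k) \<omega>)) = (LINT \<omega>|M. iexp (\<rho> * frozen a F \<omega>))"
    by (intro integral_cong_AE) (auto elim!: eventually_mono simp del: of_real_sum of_real_mult)
  also have "\<dots> = complex_of_real (exp (- (\<bar>\<rho>\<bar> powr a * expectation (\<lambda>\<omega>. \<bar>F (V 0 \<omega>)\<bar> powr a) / stable_const a)))"
    unfolding frozen_def by (rule char_lepage[OF a _ F_bound]) simp
  also have "\<bar>\<rho>\<bar> powr a * expectation (\<lambda>\<omega>. \<bar>F (V 0 \<omega>)\<bar> powr a) / stable_const a =
      b u powr a * (LINT x|lborel. \<bar>G x\<bar> powr a)"
  proof -
    have "amplitude u > 0" using b_pos const \<open>T > 0\<close> by (simp add: amplitude_def)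
    then have "\<bar>\<rho>\<bar> powr a = (r powr (- (1 / a))) powr a * amplitude u powr a"
      using \<open>r > 0\<close> by (simp add: \<rho>_def powr_mult abs_mult)
    also have "(r powr (- (1 / a))) powr a = 1 / r"
    proof -
      have "- (1 / a) * a = - 1" using a by simp
      then have "(r powr (- (1 / a))) powr a = r powr (- 1)" by (simp only: powr_powr)
      then show ?thesis using \<open>r > 0\<close> by (simp add: powr_minus_divide)
    qed
    also have "amplitude u powr a = b u powr a * (stable_const a * T)"
      using a b_pos const \<open>T > 0\<close> by (simp add: amplitude_def powr_mult powr_powr)
    finally have \<rho>: "\<bar>\<rho>\<bar> powr a = 1 / r * (b u powr a * (stable_const a * T))" .
    have "expectation (\<lambda>\<omega>. \<bar>F (V 0 \<omega>)\<bar> powr a) = (LINT x|distr M borel (V 0). \<bar>F x\<bar> powr a)"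
      by (subst integral_distr) auto
    also have "\<dots> = (LINT x|lborel. indicator {0..T} x * \<bar>F x\<bar> powr a) / T"
      unfolding uniform_marks by (rule integral_uniform_interval[OF \<open>T > 0\<close>]) measurable
    also have "(LINT x|lborel. indicator {0..T} x * \<bar>F x\<bar> powr a) = (LINT x|lborel. \<bar>G ((x - u) / r)\<bar> powr a)"
    proof (rule integral_cong_AE)
      have "AE v in lborel. v \<notin> insert u ((\<lambda>k. u + r * \<tau> k) ` K)"
        using \<open>finite K\<close> by (intro AE_not_in finite_imp_null_set_lborel) auto
      then show "AE v in lborel. indicator {0..T} v * \<bar>F v\<bar> powr a = \<bar>G ((v - u) / r)\<bar> powr a"
      proof eventually_elim
        case (elim v)
        have "F v = G ((v - u) / r)"
          unfolding F_def G_def f_def using elim \<tau> \<open>r > 0\<close>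
          by (intro sum.cong refl arg_cong2[of _ _ _ _ "(*)"] increment_kernel) auto
        moreover have "F v = 0" if "v \<notin> {0..T}"
          unfolding F_def f_def using that \<tau> u by (intro sum.neutral) (auto simp: indicator_def, fastforce)
        ultimately show ?case by (auto simp: indicator_def)
      qed
    qed measurable
    also have "\<dots> = r * (LINT x|lborel. \<bar>G x\<bar> powr a)"
      using lborel_integral_real_affine[of r "\<lambda>x. \<bar>G ((x - u) / r)\<bar> powr a" u] \<open>r > 0\<close> by simp
    finally have "expectation (\<lambda>\<omega>. \<bar>F (V 0 \<omega>)\<bar> powr a) = r * (LINT x|lborel. \<bar>G x\<bar> powr a) / T" .
    with \<rho> show ?thesis
      using \<open>r > 0\<close> \<open>T > 0\<close> const by simp
  qed
  finally show ?thesis by (simp add: G_def)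
qed


lemma amplitude_lipschitz: "lipschitz_at amplitude u"
proof -
  have "lipschitz_at (\<lambda>v. b v * (stable_const (\<alpha> v) powr (1 / \<alpha> v) * T powr (1 / \<alpha> v))) u"
    using u by (intro lipschitz_at_mult[OF b_lipschitz] lipschitz_at_compose[OF \<alpha>_lipschitz lipschitz_at_scale[OF a]]) auto
  then show ?thesis by (simp add: amplitude_def[abs_def])
qed

text \<open>A difference of products is split into the change of the amplitude and the change of the power. The
  exponents \<open>1 / \<alpha> v\<close> lie in \<open>[1 / d, 1 / c]\<close>, and \<open>1 / d > 1 / 2\<close> leaves room to widen this range
  without losing square summability.\<close>

lemma coefficient_bound:
  obtains K p q where "K > 0" "1 / 2 < p" "1 / 2 < q"
    "eventually (\<lambda>v. \<forall>x>0. \<bar>amplitude v * x powr (- (1 / \<alpha> v)) - amplitude u * x powr (- (1 / a))\<bar> \<le>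
      K * \<bar>v - u\<bar> * (x powr (- p) + x powr (- q))) (nhds u)"
proof -
  have "1 < d" using \<alpha>_range(3)[of u] \<alpha>_range(1) u by auto
  define e where "e = (1 / d - 1 / 2) / 2"
  define p where "p = 1 / d - e"
  define q where "q = 1 / c + e"
  have "1 / d > 1 / 2" using \<open>1 < d\<close> \<alpha>_range(2) by (simp add: field_simps)
  then have "e > 0" "1 / 2 < p" by (auto simp: e_def p_def field_simps)
  have inverse_range: "1 / \<alpha> v \<in> {1 / d..1 / c}" if "v \<in> {0..T}" for v
    using \<alpha>_range(3)[OF that] \<alpha>_range(1) by (auto intro!: divide_left_mono mult_pos_pos)
  have "1 / d \<le> 1 / c" using inverse_range[of u] u by auto
  then have "1 / 2 < q" using \<open>1 / d > 1 / 2\<close> \<open>e > 0\<close> by (simp add: q_def)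
  have "lipschitz_at (\<lambda>a. 1 / a) a"
    using a by (intro lipschitz_at_deriv[of _ "- 1 / (a * a)"]) (auto intro!: derivative_eq_intros)
  then have "lipschitz_at (\<lambda>v. 1 / \<alpha> v) u"
    by (rule lipschitz_at_compose[OF \<alpha>_lipschitz])
  then obtain K1 where K1: "K1 > 0" "eventually (\<lambda>v. \<bar>1 / \<alpha> v - 1 / a\<bar> \<le> K1 * \<bar>v - u\<bar>) (nhds u)"
    by (rule lipschitz_atE)
  obtain K2 where K2: "K2 > 0" "eventually (\<lambda>v. \<bar>amplitude v - amplitude u\<bar> \<le> K2 * \<bar>v - u\<bar>) (nhds u)"
    using amplitude_lipschitz by (rule lipschitz_atE)
  define K where "K = K2 + \<bar>amplitude u\<bar> * K1 / e"
  have "K > 0" unfolding K_def using K1 K2 \<open>e > 0\<close> by (intro add_pos_nonneg) auto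
  have "eventually (\<lambda>v. v \<in> {0..T}) (nhds u)"
    using u by (intro eventually_mono[OF eventually_nhds_in_open[of "{0<..<T}" u]]) auto
  with K1(2) K2(2)
  have "eventually (\<lambda>v. \<forall>x>0. \<bar>amplitude v * x powr (- (1 / \<alpha> v)) - amplitude u * x powr (- (1 / a))\<bar> \<le>
      K * \<bar>v - u\<bar> * (x powr (- p) + x powr (- q))) (nhds u)"
  proof eventually_elim
    case (elim v)
    show ?case
    proof (intro allI impI)
      fix x :: real assume "x > 0"
      let ?S = "x powr (- p) + x powr (- q)"
      have "x powr (- (1 / \<alpha> v)) \<le> ?S"
      proof (cases "1 \<le> x")
        case True
        have "x powr (- (1 / \<alpha> v)) \<le> x powr (- p)"
          using True inverse_range[OF elim(3)] \<open>e > 0\<close> by (intro powr_mono) (auto simp: p_def)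
        then show ?thesis by (simp add: add_increasing2)
      next
        case False
        have "x powr (- (1 / \<alpha> v)) \<le> x powr (- q)"
          using False \<open>x > 0\<close> inverse_range[OF elim(3)] \<open>e > 0\<close> by (intro powr_mono') (auto simp: q_def)
        then show ?thesis by (simp add: add_increasing)
      qed
      then have 1: "\<bar>amplitude v - amplitude u\<bar> * x powr (- (1 / \<alpha> v)) \<le> (K2 * \<bar>v - u\<bar>) * ?S"
        using elim(2) by (intro mult_mono) auto
      have "\<bar>x powr (- (1 / \<alpha> v)) - x powr (- (1 / a))\<bar> \<le> \<bar>1 / \<alpha> v - 1 / a\<bar> * (?S / e)"
        unfolding p_def q_def using \<open>x > 0\<close> \<open>e > 0\<close> elim(3) u
        by (intro powr_exponent_diff_le inverse_range) auto
      also have "\<dots> \<le> (K1 * \<bar>v - u\<bar>) * (?S / e)"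
        using elim(1) \<open>e > 0\<close> by (intro mult_right_mono) auto
      finally have 2: "\<bar>amplitude u\<bar> * \<bar>x powr (- (1 / \<alpha> v)) - x powr (- (1 / a))\<bar> \<le> \<bar>amplitude u\<bar> * ((K1 * \<bar>v - u\<bar>) * (?S / e))"
        by (intro mult_left_mono) auto
      have "amplitude v * x powr (- (1 / \<alpha> v)) - amplitude u * x powr (- (1 / a)) =
          (amplitude v - amplitude u) * x powr (- (1 / \<alpha> v)) + amplitude u * (x powr (- (1 / \<alpha> v)) - x powr (- (1 / a)))"
        by (simp add: algebra_simps)
      also have "\<bar>\<dots>\<bar> \<le> \<bar>amplitude v - amplitude u\<bar> * x powr (- (1 / \<alpha> v)) + \<bar>amplitude u\<bar> * \<bar>x powr (- (1 / \<alpha> v)) - x powr (- (1 / a))\<bar>"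
        by (rule order_trans[OF abs_triangle_ineq]) (simp add: abs_mult)
      also have "\<dots> \<le> (K2 * \<bar>v - u\<bar>) * ?S + \<bar>amplitude u\<bar> * ((K1 * \<bar>v - u\<bar>) * (?S / e))"
        using 1 2 by (rule add_mono)
      also have "\<dots> = K * \<bar>v - u\<bar> * ?S"
        using \<open>e > 0\<close> by (simp add: K_def field_simps)
      finally show "\<bar>amplitude v * x powr (- (1 / \<alpha> v)) - amplitude u * x powr (- (1 / a))\<bar> \<le> K * \<bar>v - u\<bar> * ?S" .
    qed
  qed
  with that \<open>K > 0\<close> \<open>1 / 2 < p\<close> \<open>1 / 2 < q\<close> show ?thesis by blast
qed

text \<open>The coefficient of the \<open>i\<close>-th sign in the difference between the rescaled increment of \<open>Y\<close> and
  \<open>stable_increment\<close>, as a function of the arrivals and the marks.\<close>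

definition change :: "real \<Rightarrow> real \<Rightarrow> nat \<Rightarrow> (nat \<Rightarrow> real) \<times> (nat \<Rightarrow> real) \<Rightarrow> real" where
  "change r v i x = r powr (- (1 / a)) *
     ((amplitude v * fst x i powr (- (1 / \<alpha> v)) - amplitude u * fst x i powr (- (1 / a))) * indicator {0..v} (snd x i))"

lemma change_measurable[measurable]: "change r v i \<in> borel_measurable (sequence_space \<Otimes>\<^sub>M sequence_space)"
  unfolding change_def by measurable

lemma AE_remainder_series:
  assumes v: "u + r * t \<in> {0..T}"
  shows "AE \<omega> in M. r powr (- (1 / a)) * (Y (u + r * t) \<omega> - Y u \<omega>) - stable_increment r t \<omega> =
    (\<Sum>i. \<epsilon> i \<omega> * change r (u + r * t) i (data \<omega>))"
proof -
  let ?v = "u + r * t"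
  let ?w = "\<lambda>s f i \<omega>. \<epsilon> i \<omega> * (\<Gamma> i \<omega> powr (- (1 / s)) * f (V i \<omega>))"
  have ind: "\<bar>indicator A x :: real\<bar> \<le> 1" for A :: "real set" and x by (simp add: indicator_def)
  have s1: "AE \<omega> in M. summable (\<lambda>i. ?w (\<alpha> ?v) (indicator {0..?v}) i \<omega>)"
    using index_range[OF v] ind by (intro AE_summable_frozen[of _ _ 1]) auto
  have s2: "AE \<omega> in M. summable (\<lambda>i. ?w a (indicator {0..?v}) i \<omega>)"
    using a ind by (intro AE_summable_frozen[of _ _ 1]) auto
  have s3: "AE \<omega> in M. summable (\<lambda>i. ?w a (indicator {0..u}) i \<omega>)"
    using a ind by (intro AE_summable_frozen[of _ _ 1]) auto
  show ?thesis
    using s1 s2 s3 AE_space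
  proof eventually_elim
    case (elim \<omega>)
    have "frozen a (\<lambda>v. indicator {0..?v} v - indicator {0..u} v) \<omega> = (\<Sum>i. ?w a (indicator {0..?v}) i \<omega> - ?w a (indicator {0..u}) i \<omega>)"
      unfolding frozen_def by (simp add: right_diff_distrib)
    also have "\<dots> = frozen a (indicator {0..?v}) \<omega> - frozen a (indicator {0..u}) \<omega>"
      unfolding frozen_def using elim by (intro suminf_diff[symmetric]) auto
    finally have diff: "frozen a (\<lambda>v. indicator {0..?v} v - indicator {0..u} v) \<omega> = frozen a (indicator {0..?v}) \<omega> - frozen a (indicator {0..u}) \<omega>" .
    have "(\<Sum>i. \<epsilon> i \<omega> * change r ?v i (data \<omega>)) =
        (\<Sum>i. r powr (- (1 / a)) * (amplitude ?v * ?w (\<alpha> ?v) (indicator {0..?v}) i \<omega> - amplitude u * ?w a (indicator {0..?v}) i \<omega>))"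
      by (simp add: change_def data_def algebra_simps)
    also have "\<dots> = r powr (- (1 / a)) * (\<Sum>i. amplitude ?v * ?w (\<alpha> ?v) (indicator {0..?v}) i \<omega> - amplitude u * ?w a (indicator {0..?v}) i \<omega>)"
      using elim by (intro suminf_mult summable_diff summable_mult) auto
    also have "(\<Sum>i. amplitude ?v * ?w (\<alpha> ?v) (indicator {0..?v}) i \<omega> - amplitude u * ?w a (indicator {0..?v}) i \<omega>) =
        (\<Sum>i. amplitude ?v * ?w (\<alpha> ?v) (indicator {0..?v}) i \<omega>) - (\<Sum>i. amplitude u * ?w a (indicator {0..?v}) i \<omega>)"
      using elim by (intro suminf_diff[symmetric] summable_mult) auto
    also have "\<dots> = amplitude ?v * frozen (\<alpha> ?v) (indicator {0..?v}) \<omega> - amplitude u * frozen a (indicator {0..?v}) \<omega>"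
      unfolding frozen_def using elim by (simp add: suminf_mult)
    finally show ?case
      using elim(4) v u unfolding stable_increment_def diff by (simp add: Y_frozen algebra_simps)
  qed
qed

text \<open>Given the arrivals and the marks, the variance of the difference is at most the square of a multiple
  of \<open>r powr (1 - 1 / a)\<close> times the random variable \<open>W\<close>, which does not depend on \<open>r\<close>. The exponent is
  positive, so the bound falls below any level outside the small event that \<open>W\<close> is large.\<close>

lemma remainder_tendsto_0:
  assumes "\<delta> > 0"
  shows "((\<lambda>r. prob {\<omega> \<in> space M. \<delta> \<le> \<bar>r powr (- (1 / a)) * (Y (u + r * t) \<omega> - Y u \<omega>) - stable_increment r t \<omega>\<bar>}) \<longlongrightarrow> 0) (at_right 0)"
proof (rule tendstoI)
  fix \<eta> :: real assume "\<eta> > 0"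
  obtain K p q where K: "K > 0" and pq: "1 / 2 < p" "1 / 2 < q" and coeff:
    "eventually (\<lambda>v. \<forall>x>0. \<bar>amplitude v * x powr (- (1 / \<alpha> v)) - amplitude u * x powr (- (1 / a))\<bar> \<le>
      K * \<bar>v - u\<bar> * (x powr (- p) + x powr (- q))) (nhds u)"
    using coefficient_bound by blast
  define S where "S i \<omega> = (\<Gamma> i \<omega> powr (- p) + \<Gamma> i \<omega> powr (- q))\<^sup>2" for i \<omega>
  define W where "W \<omega> = (\<Sum>i. S i \<omega>)" for \<omega>
  have [measurable]: "S i \<in> borel_measurable M" for i unfolding S_def by measurable
  have [measurable]: "W \<in> borel_measurable M" unfolding W_def by measurable
  have "1 < 2 * p" "1 < 2 * q" using pq by auto
  then have "AE \<omega> in M. summable (\<lambda>i. \<Gamma> i \<omega> powr (- (2 * p)))" "AE \<omega> in M. summable (\<lambda>i. \<Gamma> i \<omega> powr (- (2 * q)))"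
    by (simp_all only: AE_summable_arrivals_powr)
  then have S_sum: "AE \<omega> in M. summable (\<lambda>i. S i \<omega>)"
  proof eventually_elim
    case (elim \<omega>)
    have square: "(x powr (- s))\<^sup>2 = x powr (- (2 * s))" for x s :: real
      by (simp add: power2_eq_square powr_add[symmetric])
    have le: "S i \<omega> \<le> 2 * (\<Gamma> i \<omega> powr (- (2 * p)) + \<Gamma> i \<omega> powr (- (2 * q)))" for i
      using sum_squares_bound[of "\<Gamma> i \<omega> powr (- p)" "\<Gamma> i \<omega> powr (- q)"]
      unfolding S_def power2_sum square by simp
    have nonneg: "0 \<le> S i \<omega>" for i by (simp add: S_def)
    have "summable (\<lambda>i. 2 * (\<Gamma> i \<omega> powr (- (2 * p)) + \<Gamma> i \<omega> powr (- (2 * q))))"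
      using elim by (intro summable_mult summable_add)
    then show ?case
      by (rule summable_comparison_test'[where N = 0]) (simp only: real_norm_def abs_of_nonneg[OF nonneg] le)
  qed
  obtain n :: nat where n: "prob {\<omega> \<in> space M. \<not> W \<omega> \<le> real n} < \<eta> / 2"
    using tail_prob_small[of W "\<eta> / 2"] \<open>\<eta> > 0\<close> by auto
  \<comment> \<open>With this bound on the conditional variance, Chebyshev's inequality contributes \<open>\<eta> / 4\<close>.\<close>
  define \<kappa> where "\<kappa> = \<delta>\<^sup>2 * \<eta> / 16"
  have "\<kappa> > 0" using assms \<open>\<eta> > 0\<close> by (simp add: \<kappa>_def)
  have to_u: "filterlim (\<lambda>r. u + r * t) (nhds u) (at_right 0)"
  proof -
    have "((\<lambda>r. u + r * t) \<longlongrightarrow> u + 0 * t) (at_right 0)"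
      by (intro tendsto_intros)
    then show ?thesis by simp
  qed
  have "1 - 1 / a > 0" using a by simp
  then have "((\<lambda>r. r powr (1 - 1 / a)) \<longlongrightarrow> 0) (at_right 0)"
    by real_asymp
  then have "((\<lambda>r. (r powr (1 - 1 / a) * (K * \<bar>t\<bar>))\<^sup>2 * real n) \<longlongrightarrow> (0 * (K * \<bar>t\<bar>))\<^sup>2 * real n) (at_right 0)"
    by (intro tendsto_intros)
  moreover have "eventually (\<lambda>r. (r powr (1 - 1 / a) * (K * \<bar>t\<bar>))\<^sup>2 * real n =
      (r powr (- (1 / a)) * (K * \<bar>r * t\<bar>))\<^sup>2 * real n) (at_right 0)"
    using eventually_at_right_less[of 0]
  proof eventually_elim
    case (elim r)
    then have "r powr (1 - 1 / a) = r powr (- (1 / a)) * \<bar>r\<bar>"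
      by (simp add: powr_diff powr_minus field_simps)
    then show ?case by (simp add: abs_mult mult_ac)
  qed
  ultimately have "((\<lambda>r. (r powr (- (1 / a)) * (K * \<bar>r * t\<bar>))\<^sup>2 * real n) \<longlongrightarrow> (0 * (K * \<bar>t\<bar>))\<^sup>2 * real n) (at_right 0)"
    by (rule Lim_transform_eventually)
  then have small: "eventually (\<lambda>r. (r powr (- (1 / a)) * (K * \<bar>r * t\<bar>))\<^sup>2 * real n < \<kappa>) (at_right 0)"
    using \<open>\<kappa> > 0\<close> by (intro order_tendstoD(2)) auto
  have inside: "eventually (\<lambda>r. u + r * t \<in> {0..T}) (at_right 0)"
    using u by (intro eventually_compose_filterlim[OF _ to_u] eventually_mono[OF eventually_nhds_in_open[of "{0<..<T}" u]]) auto
  show "eventually (\<lambda>r. dist (prob {\<omega> \<in> space M. \<delta> \<le> \<bar>r powr (- (1 / a)) * (Y (u + r * t) \<omega> - Y u \<omega>) - stable_increment r t \<omega>\<bar>}) 0 < \<eta>) (at_right 0)"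
    using small inside eventually_compose_filterlim[OF coeff to_u] eventually_at_right_less[of 0]
  proof eventually_elim
    case (elim r)
    let ?v = "u + r * t"
    define L0 where "L0 = r powr (- (1 / a)) * (K * \<bar>r * t\<bar>)"
    have [measurable]: "Y ?v \<in> borel_measurable M" "Y u \<in> borel_measurable M"
      using Y_measurable elim(2) u by auto
    have "prob {\<omega> \<in> space M. \<delta> \<le> \<bar>r powr (- (1 / a)) * (Y ?v \<omega> - Y u \<omega>) - stable_increment r t \<omega>\<bar>} =
        prob {\<omega> \<in> space M. \<delta> \<le> \<bar>\<Sum>i. \<epsilon> i \<omega> * change r ?v i (data \<omega>)\<bar>}"
      using AE_remainder_series[OF elim(2)] by (intro finite_measure_eq_AE) (auto elim!: eventually_mono)
    also have "\<dots> \<le> prob {\<omega> \<in> space M. \<not> (summable (\<lambda>i. (change r ?v i (data \<omega>))\<^sup>2) \<and> (\<Sum>i. (change r ?v i (data \<omega>))\<^sup>2) \<le> \<kappa>)} + 4 * \<kappa> / \<delta>\<^sup>2"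
      using assms \<open>\<kappa> > 0\<close> by (intro prob_series_ge) auto
    also have "prob {\<omega> \<in> space M. \<not> (summable (\<lambda>i. (change r ?v i (data \<omega>))\<^sup>2) \<and> (\<Sum>i. (change r ?v i (data \<omega>))\<^sup>2) \<le> \<kappa>)}
        \<le> prob {\<omega> \<in> space M. \<not> W \<omega> \<le> real n}"
    proof (rule finite_measure_mono_AE)
      show "AE \<omega> in M. \<omega> \<in> {\<omega> \<in> space M. \<not> (summable (\<lambda>i. (change r ?v i (data \<omega>))\<^sup>2) \<and> (\<Sum>i. (change r ?v i (data \<omega>))\<^sup>2) \<le> \<kappa>)}
          \<longrightarrow> \<omega> \<in> {\<omega> \<in> space M. \<not> W \<omega> \<le> real n}"
        using S_sum AE_arrivals
      proof eventually_elim
        case (elim \<omega>)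
        have le: "(change r ?v i (data \<omega>))\<^sup>2 \<le> L0\<^sup>2 * S i \<omega>" for i
        proof -
          have "\<bar>change r ?v i (data \<omega>)\<bar> \<le> r powr (- (1 / a)) * (K * \<bar>?v - u\<bar> * (\<Gamma> i \<omega> powr (- p) + \<Gamma> i \<omega> powr (- q)) * 1)"
            unfolding change_def data_def abs_mult fst_conv snd_conv
            using elim(2) \<open>\<forall>x>0. _ x\<close>
            by (intro mult_mono) (use K in \<open>auto simp: indicator_def intro!: mult_nonneg_nonneg\<close>)
          also have "\<dots> = L0 * (\<Gamma> i \<omega> powr (- p) + \<Gamma> i \<omega> powr (- q))"
            by (simp add: L0_def mult.assoc)
          finally have "\<bar>change r ?v i (data \<omega>)\<bar>\<^sup>2 \<le> (L0 * (\<Gamma> i \<omega> powr (- p) + \<Gamma> i \<omega> powr (- q)))\<^sup>2"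
            by (intro power_mono) auto
          then show ?thesis by (simp add: S_def power_mult_distrib)
        qed
        have sum: "summable (\<lambda>i. L0\<^sup>2 * S i \<omega>)" using elim(1) by (rule summable_mult)
        then have "summable (\<lambda>i. (change r ?v i (data \<omega>))\<^sup>2)"
          by (rule summable_comparison_test'[where N = 0]) (use le in auto)
        moreover have "(\<Sum>i. (change r ?v i (data \<omega>))\<^sup>2) \<le> \<kappa>" if "W \<omega> \<le> real n"
        proof -
          have "(\<Sum>i. (change r ?v i (data \<omega>))\<^sup>2) \<le> (\<Sum>i. L0\<^sup>2 * S i \<omega>)"
            using le calculation sum by (rule suminf_le)
          also have "\<dots> = L0\<^sup>2 * W \<omega>"
            unfolding W_def using elim(1) by (rule suminf_mult)
          also have "\<dots> \<le> L0\<^sup>2 * real n"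
            using that by (intro mult_left_mono) auto
          also have "\<dots> < \<kappa>" using \<open>(r powr (- (1 / a)) * (K * \<bar>r * t\<bar>))\<^sup>2 * real n < \<kappa>\<close> by (simp add: L0_def)
          finally show ?thesis by simp
        qed
        ultimately show ?case by auto
      qed
    qed measurable
    also have "\<dots> < \<eta> / 2" by (rule n)
    also have "4 * \<kappa> / \<delta>\<^sup>2 = \<eta> / 4" using assms by (simp add: \<kappa>_def)
    finally show ?case using \<open>\<eta> > 0\<close> by simp
  qed
qed


text \<open>The common part of the two claims of the theorem, on a given stable integral and on the path space.
  The process is seen to be non-trivial from the characteristic function of its value at time 1.\<close>

lemma has_local_formI:
  fixes L :: "real \<Rightarrow> 'v \<Rightarrow> real"
  assumes Q: "prob_space Q" and L[measurable]: "\<And>t. L t \<in> borel_measurable Q"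
    and char_L: "\<And>(n :: nat) \<theta> \<tau>. (LINT \<omega>|Q. iexp (\<Sum>k<n. \<theta> k * L (\<tau> k) \<omega>)) =
      complex_of_real (exp (- (b u powr a * (LINT x|lborel. \<bar>\<Sum>k<n. \<theta> k * levy_kernel (\<tau> k) x\<bar> powr a))))"
  shows "has_local_form M {0..T} Y (1 / a) u Q L"
  unfolding has_local_form_def
proof (intro conjI)
  show "is_interval {0..T}" by (rule is_interval_cc)
  show "u \<in> interior {0..T}" using u by simp
  show "stochastic_process M {0..T} Y"
    using Y_measurable prob_space_axioms by (simp add: stochastic_process_def)
  show "stochastic_process Q UNIV L"
    using Q L by (simp add: stochastic_process_def)
  interpret Q: prob_space Q by fact
  show "\<exists>t. \<not> (AE \<omega> in Q. L t \<omega> = 0)"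
  proof (intro exI notI)
    assume "AE \<omega> in Q. L 1 \<omega> = 0"
    then have "(LINT \<omega>|Q. iexp (L 1 \<omega>)) = (LINT \<omega>|Q. 1)"
      by (intro integral_cong_AE) auto
    moreover have "(LINT \<omega>|Q. iexp (L 1 \<omega>)) = complex_of_real (exp (- (b u powr a * (LINT x|lborel. \<bar>levy_kernel 1 x\<bar> powr a))))"
      using char_L[of "\<lambda>_. 1" "\<lambda>_. 1" 1] by simp
    moreover have "\<bar>levy_kernel 1 x\<bar> powr a = indicator {0..1} x" for x
      using a by (auto simp: levy_kernel_def indicator_def)
    ultimately have "complex_of_real (exp (- (b u powr a))) = complex_of_real 1"
      by (simp add: Q.prob_space)
    then have "exp (- (b u powr a)) = 1" by (simp only: of_real_eq_iff)
    then show False using b_pos by simp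
  qed
  show "fdd_converges (at_right 0) M (\<lambda>r t \<omega>. r powr (- (1 / a)) * (Y (u + r * t) \<omega> - Y u \<omega>)) Q L"
    unfolding fdd_converges_def
  proof (intro allI)
    fix n :: nat and \<tau> :: "nat \<Rightarrow> real"
    have near: "eventually (\<lambda>r. \<forall>k<n. u + r * \<tau> k \<in> {0..T}) (at_right 0)"
    proof -
      have "eventually (\<lambda>r. u + r * \<tau> k \<in> {0..T}) (at_right 0)" for k
      proof -
        have "((\<lambda>r. u + r * \<tau> k) \<longlongrightarrow> u + 0 * \<tau> k) (at_right 0)"
          by (intro tendsto_intros)
        then have "eventually (\<lambda>r. u + r * \<tau> k \<in> {0<..<T}) (at_right 0)"
          using u by (intro topological_tendstoD) auto
        then show ?thesis by eventually_elim auto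
      qed
      then have "eventually (\<lambda>r. \<forall>k\<in>{..<n}. u + r * \<tau> k \<in> {0..T}) (at_right 0)"
        by (intro eventually_ball_finite) auto
      then show ?thesis by (simp only: Ball_def lessThan_iff)
    qed
    show "converges_in_distribution ({..<n} \<rightarrow>\<^sub>E (UNIV :: real set)) (at_right 0) M
        (\<lambda>r \<omega>. \<lambda>k\<in>{..<n}. r powr (- (1 / a)) * (Y (u + r * \<tau> k) \<omega> - Y u \<omega>)) Q (\<lambda>\<omega>. \<lambda>k\<in>{..<n}. L (\<tau> k) \<omega>)"
    proof (rule slutsky[where Z = "\<lambda>r k. stable_increment r (\<tau> k)"])
      show "eventually (\<lambda>r. \<forall>k<n. (\<lambda>\<omega>. r powr (- (1 / a)) * (Y (u + r * \<tau> k) \<omega> - Y u \<omega>)) \<in> borel_measurable M) (at_right 0)"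
        using near
      proof eventually_elim
        case (elim r)
        have [measurable]: "Y u \<in> borel_measurable M" using u by (intro Y_measurable) auto
        have "(\<lambda>\<omega>. r powr (- (1 / a)) * (Y (u + r * \<tau> k) \<omega> - Y u \<omega>)) \<in> borel_measurable M" if "k < n" for k
        proof -
          have [measurable]: "Y (u + r * \<tau> k) \<in> borel_measurable M" using elim that by (intro Y_measurable) auto
          show ?thesis by measurable
        qed
        then show ?case by blast
      qed
      show "eventually (\<lambda>r. distr M (coord_space n) (\<lambda>\<omega>. \<lambda>k\<in>{..<n}. stable_increment r (\<tau> k) \<omega>) =
          distr Q (coord_space n) (\<lambda>\<omega>. \<lambda>k\<in>{..<n}. L (\<tau> k) \<omega>)) (at_right 0)"
        using near eventually_at_right_less[of 0]
      proof eventually_elim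
        case (elim r)
        show ?case
        proof (rule char_unique_PiM)
          show "(LINT \<omega>|M. iexp (\<Sum>j\<in>{..<n}. \<theta> j * stable_increment r (\<tau> j) \<omega>)) =
              (LINT \<omega>|Q. iexp (\<Sum>j\<in>{..<n}. \<theta> j * L (\<tau> j) \<omega>))" for \<theta>
            unfolding char_L using elim by (intro char_stable_increment) auto
        qed (use Q prob_space_axioms in auto)
      qed
    qed (use Q prob_space_axioms remainder_tendsto_0 in auto)
  qed
qed

text \<open>A step with which all times in \<open>J\<close> stay inside the interval. The law of the increments does not depend on
  its choice.\<close>

definition admissible_step :: "real set \<Rightarrow> real" where
  "admissible_step J = (SOME r. r > 0 \<and> (\<forall>t\<in>J. u + r * t \<in> {0..T}))"

lemma admissible_step:
  assumes "finite J"
  shows "admissible_step J > 0" and "t \<in> J \<Longrightarrow> u + admissible_step J * t \<in> {0..T}"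
proof -
  define R where "R = Max (insert 1 (abs ` J))"
  have R: "1 \<le> R" "\<And>t. t \<in> J \<Longrightarrow> \<bar>t\<bar> \<le> R"
    unfolding R_def using assms by (auto intro!: Max_ge)
  define r where "r = min u (T - u) / R"
  have "r > 0" using R(1) u by (simp add: r_def)
  moreover have "u + r * t \<in> {0..T}" if "t \<in> J" for t
  proof -
    have "\<bar>r * t\<bar> \<le> r * R"
      using R(2)[OF that] \<open>r > 0\<close> by (simp add: abs_mult)
    also have "\<dots> = min u (T - u)" using R(1) by (simp add: r_def)
    finally show ?thesis by auto
  qed
  ultimately have "\<exists>r. r > 0 \<and> (\<forall>t\<in>J. u + r * t \<in> {0..T})" by blast
  then have *: "admissible_step J > 0 \<and> (\<forall>t\<in>J. u + admissible_step J * t \<in> {0..T})"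
    unfolding admissible_step_def by (rule someI_ex)
  then show "admissible_step J > 0" and "t \<in> J \<Longrightarrow> u + admissible_step J * t \<in> {0..T}"
    by blast+
qed

definition local_law :: "real set \<Rightarrow> (real \<Rightarrow> real) measure" where
  "local_law J = distr M (\<Pi>\<^sub>M t\<in>J. borel) (\<lambda>\<omega>. \<lambda>t\<in>J. stable_increment (admissible_step J) t \<omega>)"

lemma increments_measurable[measurable]:
  "(\<lambda>\<omega>. \<lambda>t\<in>J. stable_increment r t \<omega>) \<in> measurable M (\<Pi>\<^sub>M t\<in>J. borel)"
  by (intro measurable_restrict) measurable

text \<open>The steps for \<open>J\<close> and for \<open>H\<close> may differ, but by self-similarity both give the same joint
  characteristic functions.\<close>

lemma local_law_consistent:
  assumes "J \<subseteq> H" "finite H"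
  shows "local_law J = distr (local_law H) (\<Pi>\<^sub>M t\<in>J. borel) (\<lambda>f. restrict f J)"
proof -
  have J: "finite J" using assms by (rule finite_subset)
  have "distr (local_law H) (\<Pi>\<^sub>M t\<in>J. borel) (\<lambda>f. restrict f J) =
      distr M (\<Pi>\<^sub>M t\<in>J. borel) ((\<lambda>f. restrict f J) \<circ> (\<lambda>\<omega>. \<lambda>t\<in>H. stable_increment (admissible_step H) t \<omega>))"
    unfolding local_law_def using assms(1)
    by (intro distr_distr increments_measurable measurable_restrict_subset)
  also have "(\<lambda>f. restrict f J) \<circ> (\<lambda>\<omega>. \<lambda>t\<in>H. stable_increment (admissible_step H) t \<omega>) =
      (\<lambda>\<omega>. \<lambda>t\<in>J. stable_increment (admissible_step H) t \<omega>)"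
    using assms(1) by (auto simp: fun_eq_iff restrict_def)
  also have "distr M (\<Pi>\<^sub>M t\<in>J. borel) (\<lambda>\<omega>. \<lambda>t\<in>J. stable_increment (admissible_step H) t \<omega>) = local_law J"
    unfolding local_law_def
  proof (rule char_unique_PiM)
    show "(LINT \<omega>|M. iexp (\<Sum>j\<in>J. \<theta> j * stable_increment (admissible_step H) j \<omega>)) =
        (LINT \<omega>|M. iexp (\<Sum>j\<in>J. \<theta> j * stable_increment (admissible_step J) j \<omega>))" for \<theta>
      using J assms admissible_step
      by (subst (1 2) char_stable_increment[where \<tau> = "\<lambda>t. t"]) auto
  qed (use J prob_space_axioms in auto)
  finally show ?thesis ..
qed

text \<open>Kolmogorov's extension theorem turns the consistent family into the law of a process on the path
  space, and the coordinate process is the local form.\<close>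

lemma local_form_exists:
  "\<exists>(Q :: (real \<Rightarrow> real) measure) L. has_local_form M {0..T} Y (1 / a) u Q L"
proof -
  have "prob_space (local_law J)" for J
    unfolding local_law_def by (intro prob_space_distr) measurable
  then have "projective_family UNIV local_law (\<lambda>_. borel)"
    unfolding projective_family_def using local_law_consistent by blast
  then interpret P: polish_projective "UNIV :: real set" local_law
    unfolding polish_projective_def .
  have [measurable_cong]: "sets P.lim = sets (\<Pi>\<^sub>M t\<in>UNIV. borel)" by simp
  have marginal: "distr P.lim (\<Pi>\<^sub>M t\<in>J. borel) (\<lambda>x. restrict x J) = local_law J" if "finite J" for J
  proof (rule measure_eqI)
    show sets: "sets (distr P.lim (\<Pi>\<^sub>M t\<in>J. borel) (\<lambda>x. restrict x J)) = sets (local_law J)"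
      by (simp add: local_law_def)
    fix A assume "A \<in> sets (distr P.lim (\<Pi>\<^sub>M t\<in>J. borel) (\<lambda>x. restrict x J))"
    then have A: "A \<in> sets (\<Pi>\<^sub>M t\<in>J. borel)" by simp
    have "emeasure (distr P.lim (\<Pi>\<^sub>M t\<in>J. borel) (\<lambda>x. restrict x J)) A = emeasure P.lim (prod_emb UNIV (\<lambda>_. borel) J A)"
      using A by (intro emeasure_distr_restrict) auto
    also have "\<dots> = emeasure (local_law J) A"
      using A that by (intro P.emeasure_lim_emb) auto
    finally show "emeasure (distr P.lim (\<Pi>\<^sub>M t\<in>J. borel) (\<lambda>x. restrict x J)) A = emeasure (local_law J) A" .
  qed
  have "has_local_form M {0..T} Y (1 / a) u P.lim (\<lambda>t x. x t)"
  proof (rule has_local_formI)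
    show "prob_space P.lim" by (rule P.P.prob_space_axioms)
    show "(\<lambda>x. x t) \<in> borel_measurable P.lim" for t by measurable
    fix n :: nat and \<theta> \<tau> :: "nat \<Rightarrow> real"
    define J where "J = \<tau> ` {..<n}"
    have J: "finite J" "\<And>k. k < n \<Longrightarrow> \<tau> k \<in> J" by (auto simp: J_def)
    have mf: "(\<lambda>x. iexp (\<Sum>k<n. \<theta> k * x (\<tau> k))) \<in> borel_measurable (\<Pi>\<^sub>M t\<in>J. borel)"
    proof -
      have "(\<lambda>x. x (\<tau> k)) \<in> borel_measurable (\<Pi>\<^sub>M t\<in>J. borel :: real measure)" if "k < n" for k
        using J that by (intro measurable_component_singleton) auto
      then have "(\<lambda>x. \<Sum>k<n. \<theta> k * x (\<tau> k)) \<in> borel_measurable (\<Pi>\<^sub>M t\<in>J. borel)"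
        by (intro borel_measurable_sum borel_measurable_times) auto
      then show ?thesis by measurable
    qed
    have "(LINT x|P.lim. iexp (\<Sum>k<n. \<theta> k * x (\<tau> k))) = (LINT x|P.lim. iexp (\<Sum>k<n. \<theta> k * restrict x J (\<tau> k)))"
      using J by (intro Bochner_Integration.integral_cong refl arg_cong[of _ _ "\<lambda>x. iexp x"] sum.cong) auto
    also have "\<dots> = (LINT x|local_law J. iexp (\<Sum>k<n. \<theta> k * x (\<tau> k)))"
      unfolding marginal[OF J(1), symmetric] using mf by (subst integral_distr) auto
    also have "\<dots> = (LINT \<omega>|M. iexp (\<Sum>k<n. \<theta> k * (\<lambda>t\<in>J. stable_increment (admissible_step J) t \<omega>) (\<tau> k)))"
      unfolding local_law_def using mf by (subst integral_distr) auto
    also have "\<dots> = (LINT \<omega>|M. iexp (\<Sum>k<n. \<theta> k * stable_increment (admissible_step J) (\<tau> k) \<omega>))"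
      using J by (intro Bochner_Integration.integral_cong refl arg_cong[of _ _ "\<lambda>x. iexp x"] sum.cong) auto
    also have "\<dots> = complex_of_real (exp (- (b u powr a * (LINT x|lborel. \<bar>\<Sum>k<n. \<theta> k * levy_kernel (\<tau> k) x\<bar> powr a))))"
      using J admissible_step[OF J(1)] by (intro char_stable_increment) auto
    finally show "(LINT x|P.lim. iexp (\<Sum>k<n. \<theta> k * x (\<tau> k))) =
        complex_of_real (exp (- (b u powr a * (LINT x|lborel. \<bar>\<Sum>k<n. \<theta> k * levy_kernel (\<tau> k) x\<bar> powr a))))" .
  qed
  then show ?thesis by blast
qed

lemma local_form_levy_motion:
  assumes "stable_integral a Q \<Phi>"
  shows "has_local_form M {0..T} Y (1 / a) u Q (\<lambda>t \<omega>. b u * levy_motion \<Phi> t \<omega>)"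
proof (rule has_local_formI)
  have "a > 0" using a by simp
  show "prob_space Q" using assms by (simp add: stable_integral_def)
  show "(\<lambda>\<omega>. b u * levy_motion \<Phi> t \<omega>) \<in> borel_measurable Q" for t
    using levy_motion_measurable[OF \<open>a > 0\<close> assms] by simp
  show "(LINT \<omega>|Q. iexp (\<Sum>k<n. \<theta> k * (b u * levy_motion \<Phi> (\<tau> k) \<omega>))) =
      complex_of_real (exp (- (b u powr a * (LINT x|lborel. \<bar>\<Sum>k<n. \<theta> k * levy_kernel (\<tau> k) x\<bar> powr a))))"
    for n :: nat and \<theta> \<tau>
    using \<open>a > 0\<close> assms b_pos by (rule char_levy_motion)
qed

end

theorem theorem6:
  fixes M :: "'w measure"
    and T c d :: real
    and \<alpha> b :: "real \<Rightarrow> real"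
    and P :: "real \<Rightarrow> 'w \<Rightarrow> nat"
    and \<Gamma> V \<gamma> :: "nat \<Rightarrow> 'w \<Rightarrow> real"
    and Y :: "real \<Rightarrow> 'w \<Rightarrow> real"
  assumes "prob_space M"
    and "0 < T"
    and "1 < c" and "d < 2"
    and "\<And>t. t \<in> {0..T} \<Longrightarrow> \<alpha> t \<in> {c..d}"
    and "\<And>t. t \<in> {0..T} \<Longrightarrow> 0 < b t"
    and "continuously_differentiable_on \<alpha> {0..T}"
    and "continuously_differentiable_on b {0..T}"
    and "poisson_process M 1 P" and "arrival_times M P \<Gamma>"
    and "prob_space.indep_vars M (\<lambda>_. borel) V UNIV"
    and "\<And>i. distr M borel (V i) = uniform_measure lborel {0..T}"
    and "prob_space.indep_vars M (\<lambda>_. borel) \<gamma> UNIV"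
    and "\<And>i. measure M {\<omega> \<in> space M. \<gamma> i \<omega> = 1} = 1 / 2"
    and "\<And>i. measure M {\<omega> \<in> space M. \<gamma> i \<omega> = - 1} = 1 / 2"
    and "prob_space.indep_vars M (\<lambda>_. \<Pi>\<^sub>M i\<in>(UNIV :: nat set). (borel :: real measure))
           (\<lambda>k \<omega> i. ([\<Gamma>, V, \<gamma>] ! k) i \<omega>) {0, 1, 2}"
    and "\<And>t \<omega>. t \<in> {0..T} \<Longrightarrow> \<omega> \<in> space M \<Longrightarrow>
           Y t \<omega> = b t * stable_const (\<alpha> t) powr (1 / \<alpha> t) * T powr (1 / \<alpha> t) *
             (\<Sum>i. \<gamma> i \<omega> * \<Gamma> i \<omega> powr (- (1 / \<alpha> t)) * indicator {0..t} (V i \<omega>))"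
  shows "\<forall>u\<in>{0<..<T}.
           localisable M {0..T} Y (1 / \<alpha> u) u \<and>
           (\<forall>(N :: 'v measure) \<Phi>. stable_integral (\<alpha> u) N \<Phi> \<longrightarrow>
              has_local_form M {0..T} Y (1 / \<alpha> u) u N (\<lambda>t \<omega>. b u * levy_motion \<Phi> t \<omega>))"
proof (intro ballI conjI allI impI)
  fix u :: real assume u: "u \<in> {0<..<T}"
  have lipschitz: "lipschitz_at f u" if C1: "continuously_differentiable_on f {0..T}" for f
  proof -
    obtain f' where "\<forall>x\<in>{0..T}. (f has_real_derivative f' x) (at x within {0..T})"
      using C1 unfolding continuously_differentiable_on_def by blast
    then have "(f has_real_derivative f' u) (at u within {0..T})"
      using u by simp
    moreover have "at u within {0..T} = at u"
      using u by (intro at_within_interior) simp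
    ultimately show ?thesis
      by (simp add: lipschitz_at_deriv)
  qed
  interpret multistable M \<gamma> P \<Gamma> V T c d u \<alpha> b Y
  proof (intro multistable.intro multistable_axioms.intro poisson_sign_series.intro
      poisson_sign_series_axioms.intro rademacher_sequence.intro rademacher_sequence_axioms.intro
      poisson_arrivals.intro poisson_arrivals_axioms.intro)
    show "distr M borel (V i) = distr M borel (V 0)" for i
      using assms(12) by simp
    show "lipschitz_at \<alpha> u" "lipschitz_at b u"
      by (rule lipschitz; fact)+
    show "0 < u" "u < T" "0 < b u"
      using u assms(6)[of u] by auto
  qed (fact assms)+
  show "localisable M {0..T} Y (1 / \<alpha> u) u"
    unfolding localisable_def by (rule local_form_exists)
  show "has_local_form M {0..T} Y (1 / \<alpha> u) u N (\<lambda>t \<omega>. b u * levy_motion \<Phi> t \<omega>)"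
    if "stable_integral (\<alpha> u) N \<Phi>" for N :: "'v measure" and \<Phi>
    using that by (rule local_form_levy_motion)
qed

end
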